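(* Let $Q$ be a smooth manifold, $L\in C^\infty(TQ)$ a strongly convex (autonomous) Lagrangian with energy $E_L$ and Lagrangian vector field $\Gamma_L$, and let $e\in\mathbb{R}$. Let $U\subset TQ\setminus\{0\}$ be a nonempty open set, invariant under $(x,y)\mapsto(x,sy)$ for all $s>0$, and let $\iota^0_e:U\to(0,\infty)$ be a smooth function satisfying $$E_L\!\left(x,\frac{y}{\iota_e^0(x,y)}\right)=e\qquad\text{for all }(x,y)\in U .$$ Define on $U$ $$F_e(x,y)=\iota^0_e(x,y)\left(L\!\left(x,\frac{y}{\iota^0_e(x,y)}\right)+e\right).$$ For an open set $W\subset Q$ and $f\in C^\infty(W)$, put $U_W=U\cap TW$, $F_e^{f}=F_e+\frac{\partial f}{\partial x^i}y^i$ on $U_W$ (the function $F_e$ changed by a total time derivative; $F^{0}_e=F_e$) and $E_e^{f}=\frac12 (F_e^{f})^2$. 1. Whenever $E_e^{f}$ is a regular Lagrangian on $U_W$, with canonical spray $\Gamma_{E_e^{f}}$, there is a unique spray on $U_W$ that is both projectively equivalent to $\Gamma_{E_e^{f}}$ and tangent to the level set $\{\iota^0_e=1\}$; the restriction of $\Gamma_L$ to $\{E_L=e\}\cap U_W$ coincides with the restriction of this spray to $\{\iota_e^0=1\}\cap U_W$. 2. Every point of $\tau_Q(U)\subset Q$ has an open neighbourhood $W$ and a function $f\in C^\infty(W)$ such that $F_e^{f}$ is a Finsler function on $U_W$, and such that every solution $x(t)$ of the Euler-Lagrange equations of $L$ with energy $E_L(x(t),\dot x(t))=e$ and with $(x(t),\dot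 x(t))\in U_W$ is, after an orientation-preserving reparametrization, a geodesic of $F_e^{f}$.
   Context: $\tau_Q:TQ\to Q$ is the tangent bundle with natural coordinates $(x^i,y^i)$; $TQ\setminus\{0\}$ is $TQ$ with the zero section removed; $\Delta_Q=y^i\,\partial/\partial y^i$ is the Liouville vector field. All definitions below also apply on open subsets of $TQ$. A Lagrangian $L$ is regular if $(\partial^2L/\partial y^i\partial y^j)$ is non-singular everywhere, and strongly convex if this matrix is positive-definite everywhere. Its energy is $E_L=\Delta_Q(L)-L$. A second-order vector field is a vector field $\Gamma$ of the form $y^i\partial/\partial x^i+f^i(x,y)\partial/\partial y^i$. A Lagrangian vector field of $L$ is a second-order vector field $\Gamma_L$ with $\Gamma_L(\partial L/\partial y^i)-\partial L/\partial x^i=0$ for all $i$; it is unique if $L$ is regular, and the solutions of the Euler-Lagrange equations of $L$ are then its base integral curves (projections to $Q$ of its integral curves). A function $F$ is 1-homogeneous if $\Delta_Q(F)=F$. A spray is a second-order vector field $\Gamma$ on an open subset of $TQ\setminus\{0\}$ with $[\Delta_Q,\Gamma]=\Gamma$. Two sprays $\Gamma,\Gamma'$ are projectively equivalent if $\Gamma'=\Gamma+P\Delta_Q$ for some function $P$ with $\Delta_Q(P)=P$ (equivalently, they have the same base integral curves with given initial point and direction, up to orientation-preserving reparametrization). A Finsler function on an open subset of $TQ\setminus\{0\}$ invariant under positive scaling of the fibres is a smooth, positive, 1-homogeneous function $F$ such that $E=\frac12F^2$ is strongly convex. For a 1-homogeneous function $F$ with $E=\frac12F^2$ regular, the canonical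 spray $\Gamma_E$ of $F$ is the Lagrangian vector field of $E$ (it is a spray). The geodesics of $F$ are the base integral curves of $\Gamma_E$, considered as unparametrized oriented curves, i.e. up to orientation-preserving reparametrization; they may be computed with any spray projectively equivalent to $\Gamma_E$. *)

theory Defs
  imports "HOL-Analysis.Analysis"
begin

section \<open>Smooth maps between Euclidean spaces\<close>

text \<open>The domain \<open>S\<close> is always an open set. All iterated directional derivatives are required to
  exist as Frechet derivatives and to be continuous.\<close>

primrec Ck_on :: "nat \<Rightarrow> 'a::euclidean_space set \<Rightarrow> ('a \<Rightarrow> 'b::real_normed_vector) \<Rightarrow> bool" where
  "Ck_on 0 S f \<longleftrightarrow> continuous_on S f"
| "Ck_on (Suc k) S f \<longleftrightarrow>
     (\<forall>x\<in>S. f differentiable (at x)) \<and> (\<forall>v. Ck_on k S (\<lambda>x. frechet_derivative f (at x) v))"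

definition smooth_on :: "'a::euclidean_space set \<Rightarrow> ('a \<Rightarrow> 'b::real_normed_vector) \<Rightarrow> bool" where
  "smooth_on S f \<longleftrightarrow> (\<forall>k. Ck_on k S f)"


section \<open>Smooth manifolds\<close>

text \<open>A chart is a pair of a coordinate domain and a coordinate map; the values of the map outside
  the domain are irrelevant. A manifold is given by a smooth atlas, not necessarily maximal: it
  determines the underlying set, the topology and the smooth structure.\<close>

type_synonym ('p, 'e) chart = "'p set \<times> ('p \<Rightarrow> 'e)"

abbreviation chart_dom :: "('p, 'e) chart \<Rightarrow> 'p set" where
  "chart_dom c \<equiv> fst c"

abbreviation coords :: "('p, 'e) chart \<Rightarrow> 'p \<Rightarrow> 'e" where
  "coords c \<equiv> snd c"

definition param :: "('p, 'e) chart \<Rightarrow> 'e \<Rightarrow> 'p" where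
  "param c = inv_into (chart_dom c) (coords c)"

definition points :: "('p, 'e) chart set \<Rightarrow> 'p set" where
  "points A = (\<Union>c\<in>A. chart_dom c)"

definition smooth_atlas :: "('p, 'e::euclidean_space) chart set \<Rightarrow> bool" where
  "smooth_atlas A \<longleftrightarrow>
     (\<forall>c\<in>A. inj_on (coords c) (chart_dom c) \<and> open (coords c ` chart_dom c)) \<and>
     (\<forall>c\<in>A. \<forall>d\<in>A. open (coords c ` (chart_dom c \<inter> chart_dom d)) \<and>
        smooth_on (coords c ` (chart_dom c \<inter> chart_dom d)) (\<lambda>x. coords d (param c x)))"

definition atlas_open :: "('p, 'e::euclidean_space) chart set \<Rightarrow> 'p set \<Rightarrow> bool" where
  "atlas_open A S \<longleftrightarrow> S \<subseteq> points A \<and> (\<forall>c\<in>A. open (coords c ` (chart_dom c \<inter> S)))"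

definition atlas_topology :: "('p, 'e::euclidean_space) chart set \<Rightarrow> 'p topology" where
  "atlas_topology A = topology (atlas_open A)"

lemma istopology_atlas_open:
  assumes "smooth_atlas A"
  shows "istopology (atlas_open A)"
proof -
  have 1: "atlas_open A (S \<inter> T)" if "atlas_open A S" "atlas_open A T" for S T
  proof -
    have "coords c ` (chart_dom c \<inter> (S \<inter> T)) = coords c ` (chart_dom c \<inter> S) \<inter> coords c ` (chart_dom c \<inter> T)"
      if "c \<in> A" for c
      using assms that unfolding smooth_atlas_def inj_on_def by blast
    with that show ?thesis
      unfolding atlas_open_def by auto
  qed
  have 2: "atlas_open A (\<Union>K)" if "\<forall>S\<in>K. atlas_open A S" for K
  proof -
    have "coords c ` (chart_dom c \<inter> \<Union>K) = (\<Union>S\<in>K. coords c ` (chart_dom c \<inter> S))" for c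
      by blast
    with that show ?thesis
      unfolding atlas_open_def by (metis (no_types, lifting) Sup_least open_UN)
  qed
  show ?thesis
    unfolding istopology_def using 1 2 by blast
qed

lemma openin_atlas_topology:
  assumes "smooth_atlas A"
  shows "openin (atlas_topology A) S \<longleftrightarrow> atlas_open A S"
  unfolding atlas_topology_def
  by (simp add: istopology_atlas_open[OF assms] topology_inverse')

definition smooth_manifold :: "('p, 'e::euclidean_space) chart set \<Rightarrow> bool" where
  "smooth_manifold A \<longleftrightarrow> smooth_atlas A \<and>
     Hausdorff_space (atlas_topology A) \<and> second_countable (atlas_topology A)"

definition smooth_fun ::
    "('p, 'e::euclidean_space) chart set \<Rightarrow> 'p set \<Rightarrow> ('p \<Rightarrow> real) \<Rightarrow> bool" where
  "smooth_fun A U g \<longleftrightarrow> (\<forall>c\<in>A. smooth_on (coords c ` (chart_dom c \<inter> U)) (\<lambda>x. g (param c x)))"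


section \<open>Tangent vectors and vector fields\<close>

text \<open>A tangent vector at \<open>p\<close> is the family of its components in the charts around \<open>p\<close>, related to
  each other by the derivatives of the coordinate changes. Components in the other charts are
  normalised to \<open>0\<close>, so that equality of tangent vectors is equality of functions.\<close>

type_synonym ('p, 'e) tvec = "('p, 'e) chart \<Rightarrow> 'e"
type_synonym ('p, 'e) tangent = "'p \<times> ('p, 'e) tvec"

definition tangent_space ::
    "('p, 'e::euclidean_space) chart set \<Rightarrow> 'p \<Rightarrow> ('p, 'e) tvec set" where
  "tangent_space A p = {v.
     (\<forall>c. \<not> (c \<in> A \<and> p \<in> chart_dom c) \<longrightarrow> v c = 0) \<and>
     (\<forall>c\<in>A. \<forall>d\<in>A. p \<in> chart_dom c \<inter> chart_dom d \<longrightarrow>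
        v d = frechet_derivative (\<lambda>x. coords d (param c x)) (at (coords c p)) (v c))}"

definition tangent_bundle ::
    "('p, 'e::euclidean_space) chart set \<Rightarrow> ('p, 'e) tangent set" where
  "tangent_bundle A = {(p, v). p \<in> points A \<and> v \<in> tangent_space A p}"

text \<open>The derivative of a function along a tangent vector at \<open>p\<close>, computed in an arbitrary chart
  around \<open>p\<close>.\<close>

definition dir_deriv ::
    "('p, 'e::euclidean_space) chart set \<Rightarrow> ('p \<Rightarrow> real) \<Rightarrow> 'p \<Rightarrow> ('p, 'e) tvec \<Rightarrow> real" where
  "dir_deriv A g p v =
     (let c = (SOME c. c \<in> A \<and> p \<in> chart_dom c)
      in frechet_derivative (\<lambda>x. g (param c x)) (at (coords c p)) (v c))"

definition vector_field ::
    "('p, 'e::euclidean_space) chart set \<Rightarrow> 'p set \<Rightarrow> ('p \<Rightarrow> ('p, 'e) tvec) \<Rightarrow> bool" where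
  "vector_field A U X \<longleftrightarrow>
     (\<forall>p\<in>U. X p \<in> tangent_space A p) \<and>
     (\<forall>c\<in>A. smooth_on (coords c ` (chart_dom c \<inter> U)) (\<lambda>x. X (param c x) c))"

definition lie_bracket ::
    "('p, 'e::euclidean_space) chart set \<Rightarrow> ('p \<Rightarrow> ('p, 'e) tvec) \<Rightarrow> ('p \<Rightarrow> ('p, 'e) tvec)
      \<Rightarrow> 'p \<Rightarrow> ('p, 'e) tvec" where
  "lie_bracket A X Y p = (\<lambda>c. if c \<in> A \<and> p \<in> chart_dom c
     then frechet_derivative (\<lambda>x. Y (param c x) c) (at (coords c p)) (X p c)
        - frechet_derivative (\<lambda>x. X (param c x) c) (at (coords c p)) (Y p c)
     else 0)"

text \<open>The curve \<open>\<gamma>\<close> is differentiable at \<open>t\<close> with velocity \<open>v\<close>. That \<open>\<gamma>\<close> stays in the chart domains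
  near \<open>t\<close> has to be said explicitly, since coordinate maps are arbitrary outside their domains.\<close>

definition has_velocity ::
    "('p, 'e::euclidean_space) chart set \<Rightarrow> (real \<Rightarrow> 'p) \<Rightarrow> ('p, 'e) tvec \<Rightarrow> real \<Rightarrow> bool" where
  "has_velocity A \<gamma> v t \<longleftrightarrow>
     \<gamma> t \<in> points A \<and> v \<in> tangent_space A (\<gamma> t) \<and>
     (\<forall>c\<in>A. \<gamma> t \<in> chart_dom c \<longrightarrow>
        (\<forall>\<^sub>F s in nhds t. \<gamma> s \<in> chart_dom c) \<and>
        ((\<lambda>s. coords c (\<gamma> s)) has_vector_derivative v c) (at t))"

definition integral_curve ::
    "('p, 'e::euclidean_space) chart set \<Rightarrow> 'p set \<Rightarrow> ('p \<Rightarrow> ('p, 'e) tvec)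
      \<Rightarrow> real set \<Rightarrow> (real \<Rightarrow> 'p) \<Rightarrow> bool" where
  "integral_curve A U X I \<gamma> \<longleftrightarrow>
     open I \<and> is_interval I \<and> (\<forall>t\<in>I. \<gamma> t \<in> U \<and> has_velocity A \<gamma> (X (\<gamma> t)) t)"

definition tangent_to ::
    "('p, 'e::euclidean_space) chart set \<Rightarrow> ('p \<Rightarrow> ('p, 'e) tvec) \<Rightarrow> 'p set \<Rightarrow> bool" where
  "tangent_to A X S \<longleftrightarrow>
     (\<forall>p\<in>S. \<exists>\<gamma> \<epsilon>. \<epsilon> > 0 \<and> \<gamma> 0 = p \<and> (\<forall>s. \<bar>s\<bar> < \<epsilon> \<longrightarrow> \<gamma> s \<in> S) \<and> has_velocity A \<gamma> (X p) 0)"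


section \<open>The tangent bundle as a manifold\<close>

text \<open>The chart \<open>c = (x\<^sup>i)\<close> of the base induces the natural chart \<open>(x\<^sup>i, y\<^sup>i)\<close> of the tangent bundle.
  All notions above apply to the tangent bundle through the atlas of natural charts.\<close>

definition natural_chart ::
    "('q, 'e::euclidean_space) chart set \<Rightarrow> ('q, 'e) chart \<Rightarrow> (('q, 'e) tangent, 'e \<times> 'e) chart" where
  "natural_chart A c =
     ({p \<in> tangent_bundle A. fst p \<in> chart_dom c}, \<lambda>p. (coords c (fst p), snd p c))"

definition tangent_atlas ::
    "('q, 'e::euclidean_space) chart set \<Rightarrow> (('q, 'e) tangent, 'e \<times> 'e) chart set" where
  "tangent_atlas A = natural_chart A ` A"

definition slit_tangent_bundle ::
    "('q, 'e::euclidean_space) chart set \<Rightarrow> ('q, 'e) tangent set" where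
  "slit_tangent_bundle A = {p \<in> tangent_bundle A. snd p \<noteq> (\<lambda>c. 0)}"

definition scale :: "real \<Rightarrow> ('q, 'e::euclidean_space) tangent \<Rightarrow> ('q, 'e) tangent" where
  "scale s p = (fst p, \<lambda>c. s *\<^sub>R snd p c)"

definition open_cone ::
    "('q, 'e::euclidean_space) chart set \<Rightarrow> ('q, 'e) tangent set \<Rightarrow> bool" where
  "open_cone A U \<longleftrightarrow>
     openin (atlas_topology (tangent_atlas A)) U \<and> U \<subseteq> slit_tangent_bundle A \<and>
     (\<forall>p\<in>U. \<forall>s>0. scale s p \<in> U)"

definition over :: "('q, 'e) tangent set \<Rightarrow> 'q set \<Rightarrow> ('q, 'e) tangent set" where
  "over U W = {p \<in> U. fst p \<in> W}"

text \<open>A tangent vector of the tangent bundle has components \<open>(a\<^sup>i, b\<^sup>i)\<close> in the natural charts, standing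
  for \<open>a\<^sup>i \<partial>/\<partial>x\<^sup>i + b\<^sup>i \<partial>/\<partial>y\<^sup>i\<close>.\<close>

definition liouville ::
    "('q, 'e::euclidean_space) chart set \<Rightarrow> ('q, 'e) tangent
      \<Rightarrow> (('q, 'e) tangent, 'e \<times> 'e) tvec" where
  "liouville A p = (\<lambda>C. if C \<in> tangent_atlas A \<and> p \<in> chart_dom C then (0, snd (coords C p)) else 0)"

definition second_order ::
    "('q, 'e::euclidean_space) chart set \<Rightarrow> ('q, 'e) tangent set
      \<Rightarrow> (('q, 'e) tangent \<Rightarrow> (('q, 'e) tangent, 'e \<times> 'e) tvec) \<Rightarrow> bool" where
  "second_order A U X \<longleftrightarrow>
     vector_field (tangent_atlas A) U X \<and>
     (\<forall>C\<in>tangent_atlas A. \<forall>p\<in>chart_dom C \<inter> U. fst (X p C) = snd (coords C p))"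

definition one_homogeneous ::
    "('q, 'e::euclidean_space) chart set \<Rightarrow> ('q, 'e) tangent set
      \<Rightarrow> (('q, 'e) tangent \<Rightarrow> real) \<Rightarrow> bool" where
  "one_homogeneous A U F \<longleftrightarrow> (\<forall>p\<in>U. dir_deriv (tangent_atlas A) F p (liouville A p) = F p)"

definition spray ::
    "('q, 'e::euclidean_space) chart set \<Rightarrow> ('q, 'e) tangent set
      \<Rightarrow> (('q, 'e) tangent \<Rightarrow> (('q, 'e) tangent, 'e \<times> 'e) tvec) \<Rightarrow> bool" where
  "spray A U X \<longleftrightarrow>
     openin (atlas_topology (tangent_atlas A)) U \<and> U \<subseteq> slit_tangent_bundle A \<and>
     second_order A U X \<and>
     (\<forall>p\<in>U. lie_bracket (tangent_atlas A) (liouville A) X p = X p)"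

definition projectively_equivalent ::
    "('q, 'e::euclidean_space) chart set \<Rightarrow> ('q, 'e) tangent set
      \<Rightarrow> (('q, 'e) tangent \<Rightarrow> (('q, 'e) tangent, 'e \<times> 'e) tvec)
      \<Rightarrow> (('q, 'e) tangent \<Rightarrow> (('q, 'e) tangent, 'e \<times> 'e) tvec) \<Rightarrow> bool" where
  "projectively_equivalent A U X Y \<longleftrightarrow>
     spray A U X \<and> spray A U Y \<and>
     (\<exists>P. smooth_fun (tangent_atlas A) U P \<and> one_homogeneous A U P \<and>
        (\<forall>p\<in>U. \<forall>C. Y p C = X p C + P p *\<^sub>R liouville A p C))"


section \<open>Lagrangians\<close>

definition energy ::
    "('q, 'e::euclidean_space) chart set \<Rightarrow> (('q, 'e) tangent \<Rightarrow> real) \<Rightarrow> ('q, 'e) tangent \<Rightarrow> real" where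
  "energy A L p = dir_deriv (tangent_atlas A) L p (liouville A p) - L p"

definition partial_x :: "'n \<Rightarrow> ((real^'n) \<times> (real^'n) \<Rightarrow> real) \<Rightarrow> (real^'n) \<times> (real^'n) \<Rightarrow> real" where
  "partial_x i g z = frechet_derivative g (at z) (axis i 1, 0)"

definition partial_y :: "'n \<Rightarrow> ((real^'n) \<times> (real^'n) \<Rightarrow> real) \<Rightarrow> (real^'n) \<times> (real^'n) \<Rightarrow> real" where
  "partial_y i g z = frechet_derivative g (at z) (0, axis i 1)"

definition fibre_hessian ::
    "((real^'n) \<times> (real^'n) \<Rightarrow> real) \<Rightarrow> (real^'n) \<times> (real^'n) \<Rightarrow> real^'n^'n" where
  "fibre_hessian g z = (\<chi> i j. partial_y i (partial_y j g) z)"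

definition regular ::
    "('q, real^'n) chart set \<Rightarrow> ('q, real^'n) tangent set \<Rightarrow> (('q, real^'n) tangent \<Rightarrow> real) \<Rightarrow> bool" where
  "regular A U L \<longleftrightarrow>
     (\<forall>C\<in>tangent_atlas A. \<forall>p\<in>chart_dom C \<inter> U.
        invertible (fibre_hessian (\<lambda>z. L (param C z)) (coords C p)))"

definition strongly_convex ::
    "('q, real^'n) chart set \<Rightarrow> ('q, real^'n) tangent set \<Rightarrow> (('q, real^'n) tangent \<Rightarrow> real) \<Rightarrow> bool" where
  "strongly_convex A U L \<longleftrightarrow>
     (\<forall>C\<in>tangent_atlas A. \<forall>p\<in>chart_dom C \<inter> U. \<forall>w. w \<noteq> 0 \<longrightarrow>
        w \<bullet> (fibre_hessian (\<lambda>z. L (param C z)) (coords C p) *v w) > 0)"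

definition lagrangian_vector_field ::
    "('q, real^'n) chart set \<Rightarrow> ('q, real^'n) tangent set \<Rightarrow> (('q, real^'n) tangent \<Rightarrow> real)
      \<Rightarrow> (('q, real^'n) tangent \<Rightarrow> (('q, real^'n) tangent, (real^'n) \<times> (real^'n)) tvec) \<Rightarrow> bool" where
  "lagrangian_vector_field A U L X \<longleftrightarrow>
     second_order A U X \<and>
     (\<forall>C\<in>tangent_atlas A. \<forall>p\<in>chart_dom C \<inter> U. \<forall>i.
        frechet_derivative (partial_y i (\<lambda>z. L (param C z))) (at (coords C p)) (X p C)
          - partial_x i (\<lambda>z. L (param C z)) (coords C p) = 0)"

definition tangent_lift ::
    "('q, 'e::euclidean_space) chart set \<Rightarrow> (real \<Rightarrow> 'q) \<Rightarrow> real \<Rightarrow> ('q, 'e) tangent" where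
  "tangent_lift A x t =
     (x t, \<lambda>c. if c \<in> A \<and> x t \<in> chart_dom c then vector_derivative (\<lambda>s. coords c (x s)) (at t) else 0)"

text \<open>Solutions of the Euler-Lagrange equations are twice differentiable curves on an open interval
  satisfying \<open>d/dt (\<partial>L/\<partial>y\<^sup>i) = \<partial>L/\<partial>x\<^sup>i\<close> along their lift, in all natural charts.\<close>

definition euler_lagrange_solution ::
    "('q, real^'n) chart set \<Rightarrow> (('q, real^'n) tangent \<Rightarrow> real) \<Rightarrow> real set \<Rightarrow> (real \<Rightarrow> 'q) \<Rightarrow> bool" where
  "euler_lagrange_solution A L I x \<longleftrightarrow>
     open I \<and> is_interval I \<and>
     (\<forall>t\<in>I. has_velocity A x (snd (tangent_lift A x t)) t \<and>
        (\<forall>C\<in>tangent_atlas A. tangent_lift A x t \<in> chart_dom C \<longrightarrow>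
           (\<lambda>s. coords C (tangent_lift A x s)) differentiable (at t) \<and>
           (\<forall>i. ((\<lambda>s. partial_y i (\<lambda>z. L (param C z)) (coords C (tangent_lift A x s)))
                  has_real_derivative
                  partial_x i (\<lambda>z. L (param C z)) (coords C (tangent_lift A x t))) (at t))))"


section \<open>Finsler functions\<close>

definition half_square :: "('a \<Rightarrow> real) \<Rightarrow> 'a \<Rightarrow> real" where
  "half_square F p = (1/2) * (F p)\<^sup>2"

definition finsler_function ::
    "('q, real^'n) chart set \<Rightarrow> ('q, real^'n) tangent set \<Rightarrow> (('q, real^'n) tangent \<Rightarrow> real) \<Rightarrow> bool" where
  "finsler_function A U F \<longleftrightarrow>
     open_cone A U \<and> smooth_fun (tangent_atlas A) U F \<and> (\<forall>p\<in>U. F p > 0) \<and>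
     one_homogeneous A U F \<and> strongly_convex A U (half_square F)"

definition canonical_spray ::
    "('q, real^'n) chart set \<Rightarrow> ('q, real^'n) tangent set \<Rightarrow> (('q, real^'n) tangent \<Rightarrow> real)
      \<Rightarrow> (('q, real^'n) tangent \<Rightarrow> (('q, real^'n) tangent, (real^'n) \<times> (real^'n)) tvec) \<Rightarrow> bool" where
  "canonical_spray A U F X \<longleftrightarrow> lagrangian_vector_field A U (half_square F) X"

definition base_integral_curve ::
    "('q, 'e::euclidean_space) chart set \<Rightarrow> ('q, 'e) tangent set
      \<Rightarrow> (('q, 'e) tangent \<Rightarrow> (('q, 'e) tangent, 'e \<times> 'e) tvec) \<Rightarrow> real set \<Rightarrow> (real \<Rightarrow> 'q) \<Rightarrow> bool" where
  "base_integral_curve A U X I x \<longleftrightarrow>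
     (\<exists>\<gamma>. integral_curve (tangent_atlas A) U X I \<gamma> \<and> (\<forall>t\<in>I. x t = fst (\<gamma> t)))"

definition orientation_preserving_reparametrization ::
    "real set \<Rightarrow> real set \<Rightarrow> (real \<Rightarrow> real) \<Rightarrow> bool" where
  "orientation_preserving_reparametrization J I \<phi> \<longleftrightarrow>
     open J \<and> is_interval J \<and> smooth_on J \<phi> \<and> (\<forall>s\<in>J. deriv \<phi> s > 0) \<and> bij_betw \<phi> J I"

definition geodesic ::
    "('q, real^'n) chart set \<Rightarrow> ('q, real^'n) tangent set \<Rightarrow> (('q, real^'n) tangent \<Rightarrow> real)
      \<Rightarrow> real set \<Rightarrow> (real \<Rightarrow> 'q) \<Rightarrow> bool" where
  "geodesic A U F I x \<longleftrightarrow> (\<exists>X. canonical_spray A U F X \<and> base_integral_curve A U X I x)"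


section \<open>The function \<open>F\<^sub>e\<close> and its change by a total time derivative\<close>

definition fixed_energy_function ::
    "(('q, 'e::euclidean_space) tangent \<Rightarrow> real) \<Rightarrow> (('q, 'e) tangent \<Rightarrow> real) \<Rightarrow> real
      \<Rightarrow> ('q, 'e) tangent \<Rightarrow> real" where
  "fixed_energy_function L \<iota> e p = \<iota> p * (L (scale (1 / \<iota> p) p) + e)"

definition add_total_derivative ::
    "('q, 'e::euclidean_space) chart set \<Rightarrow> ('q \<Rightarrow> real) \<Rightarrow> (('q, 'e) tangent \<Rightarrow> real)
      \<Rightarrow> ('q, 'e) tangent \<Rightarrow> real" where
  "add_total_derivative A f F p = F p + dir_deriv A f (fst p) (snd p)"

end

theory Submission
  imports Defs
begin

text \<open>Differentiating \<open>F\<close> and using that the energy of \<open>y / \<iota>\<close> is \<open>e\<close>, all terms containing derivatives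
  of \<open>\<iota>\<close> cancel: \<open>\<partial>F/\<partial>y = \<partial>L/\<partial>y\<close> and \<open>\<partial>F/\<partial>x = \<iota> \<partial>L/\<partial>x\<close>, both right hand sides taken at \<open>(x, y / \<iota>)\<close>.
  Since the energy is strictly increasing along rays, \<open>\<iota>\<close> is homogeneous. Hence the extension \<open>\<Gamma>\<close> of
  \<open>\<Gamma>\<^sub>L\<close> from the level set \<open>\<iota> = 1\<close> by homogeneity is a spray that annihilates \<open>\<iota>\<close> and satisfies the Euler-Lagrange
  equations of \<open>F\<close>. Then \<open>\<Gamma> - (\<Gamma>(F) / F) \<Delta>\<close> satisfies those of \<open>F\<^sup>2 / 2\<close>, so it is the canonical spray, and no
  linear system has to be solved to obtain its existence and smoothness.

  The vertical Hessian of \<open>F\<close> is the restriction of that of \<open>L\<close> to a complement of the radial direction.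
  So \<open>F\<close> is a Finsler function wherever it is positive, and by strict convexity of \<open>L\<close> positivity near \<open>q\<close>
  is achieved by adding the differential of a function with value \<open>- \<partial>L/\<partial>y(q, 0)\<close> at \<open>q\<close>. A solution of energy \<open>e\<close>
  becomes a geodesic when it is parametrized by the arc length of \<open>F\<close>.\<close>

text \<open>The map \<open>\<rho>(x, y) = (x, y / \<iota>)\<close> takes values in the energy level,
  so the energy of \<open>L\<close> is constant along it. Differentiated vertically, this relation
  yields the orthogonality behind the Hessian formula; differentiated along the homogeneous
  extension, together with conservation of energy along \<open>\<Gamma>\<^sub>L\<close>, it forces
  \<open>\<Gamma>(\<iota>) = 0\<close>. Regularity of \<open>F\<^sup>2 / 2\<close> enters because at
  a zero of \<open>F\<close> the radial direction would lie in the kernel of its vertical Hessian;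
  so dividing by \<open>F\<close> is legitimate. The tangent spray is unique because two candidates
  differ by a multiple of \<Delta>, which is transverse to the level set since
  \<open>\<Delta>(\<iota>) = \<iota>\<close>.

  The obstacle in the second claim is that the energy level over a neighbourhood of \<open>q\<close>
  need not be bounded in the fibres, so continuity alone gives no neighbourhood common to all
  directions. The estimate is therefore made on a small sphere, which is compact and lies below the
  energy level, and convexity carries it outward along rays.\<close>

abbreviation fderiv :: "('a::real_normed_vector \<Rightarrow> 'b::real_normed_vector) \<Rightarrow> 'a \<Rightarrow> 'a \<Rightarrow> 'b" where
  "fderiv f x \<equiv> frechet_derivative f (at x)"

section \<open>Calculus of smooth maps\<close>

lemma fderiv_eq: "(f has_derivative f') (at x) \<Longrightarrow> fderiv f x v = f' v"
  using frechet_derivative_at by metis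

lemma fderiv_cong:
  assumes "open S" "x \<in> S" "\<And>y. y \<in> S \<Longrightarrow> f y = g y"
  shows "fderiv f x = fderiv g x"
proof -
  have "(f has_derivative d) (at x) = (g has_derivative d) (at x)" for d
    using has_derivative_transform_within_open[OF _ assms(1,2), of f d UNIV g]
      has_derivative_transform_within_open[OF _ assms(1,2), of g d UNIV f] assms(3) by auto
  then show ?thesis
    unfolding frechet_derivative_def by simp
qed

section \<open>Closure properties of maps of class C^k\<close>

lemma Ck_on_cong:
  assumes "open S" "\<And>x. x \<in> S \<Longrightarrow> f x = g x" "Ck_on k S f"
  shows "Ck_on k S g"
  using assms(2,3)
proof (induction k arbitrary: f g)
  case 0
  then show ?case by (metis Ck_on.simps(1) continuous_on_cong)
next
  case (Suc k)
  have "g differentiable at x" if "x \<in> S" for x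
  proof -
    have "(f has_derivative fderiv f x) (at x)"
      using Suc.prems(2) that by (simp flip: frechet_derivative_works)
    from has_derivative_transform_within_open[OF this assms(1) that Suc.prems(1)]
    show ?thesis by (auto simp: differentiable_def)
  qed
  moreover have "Ck_on k S (\<lambda>x. fderiv g x v)" for v
    by (rule Suc.IH[of "\<lambda>x. fderiv f x v"])
      (use Suc.prems fderiv_cong[OF assms(1), of _ f g] in auto)
  ultimately show ?case by auto
qed

text \<open>Frees later inductions from \<open>frechet_derivative\<close>: any explicit formula for
  the derivative may be used, as it agrees with the chosen one on the open set
  \<open>S\<close>.\<close>

lemma Ck_on_SucI:
  assumes "open S" "\<And>x. x \<in> S \<Longrightarrow> (f has_derivative f' x) (at x)" "\<And>v. Ck_on k S (\<lambda>x. f' x v)"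
  shows "Ck_on (Suc k) S f"
proof -
  have "Ck_on k S (\<lambda>x. fderiv f x v)" for v
    by (rule Ck_on_cong[OF assms(1) _ assms(3)[of v]]) (use fderiv_eq assms(2) in metis)
  then show ?thesis
    using assms(2) by (auto simp: differentiable_def)
qed

lemma Ck_on_has_derivative:
  "Ck_on (Suc k) S f \<Longrightarrow> x \<in> S \<Longrightarrow> (f has_derivative fderiv f x) (at x)"
  by (simp flip: frechet_derivative_works)

text \<open>The recursion does not list membership in the lower classes; it is recovered level by
  level down to continuity, which follows from differentiability.\<close>

lemma Ck_on_Suc_imp: "Ck_on (Suc k) S f \<Longrightarrow> Ck_on k S f"
proof (induction k arbitrary: f)
  case 0
  then show ?case
    by (auto intro!: continuous_at_imp_continuous_on differentiable_imp_continuous_within)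
next
  case (Suc k)
  then show ?case
    by (metis Ck_on.simps(2))
qed

lemma Ck_on_subset: "Ck_on k S f \<Longrightarrow> T \<subseteq> S \<Longrightarrow> Ck_on k T f"
  by (induction k arbitrary: f) (auto intro: continuous_on_subset)

lemma Ck_on_const: "Ck_on k S (\<lambda>x. c)"
  by (induction k arbitrary: c) auto

lemma Ck_on_bounded_linear:
  assumes "bounded_linear h" "open S" shows "Ck_on k S h"
proof (cases k)
  case 0
  then show ?thesis using assms by (simp add: linear_continuous_on)
next
  case (Suc m)
  show ?thesis
    unfolding Suc
    by (rule Ck_on_SucI[OF assms(2), of _ "\<lambda>x. h"])
      (auto intro: bounded_linear_imp_has_derivative assms Ck_on_const)
qed

lemma Ck_on_add:
  assumes "open S" "Ck_on k S f" "Ck_on k S g"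
  shows "Ck_on k S (\<lambda>x. f x + g x)"
  using assms(2,3)
proof (induction k arbitrary: f g)
  case 0
  then show ?case by (auto intro: continuous_intros)
next
  case (Suc k)
  show ?case
    by (rule Ck_on_SucI[OF assms(1), of _ "\<lambda>x v. fderiv f x v + fderiv g x v"])
      (use Suc Ck_on_has_derivative[OF Suc.prems(1)] Ck_on_has_derivative[OF Suc.prems(2)]
        in \<open>auto intro!: has_derivative_add\<close>)
qed

text \<open>Both terms of the product rule pair a function with a derivative, each of class
  \<open>k\<close> again. Products, scalar multiples and inner products are instances.\<close>

lemma Ck_on_bilinear:
  assumes "bounded_bilinear m" "open S" "Ck_on k S f" "Ck_on k S g"
  shows "Ck_on k S (\<lambda>x. m (f x) (g x))"
  using assms(3,4)
proof (induction k arbitrary: f g)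
  case 0
  then show ?case using bounded_bilinear.continuous_on[OF assms(1)] by simp
next
  case (Suc k)
  have "Ck_on k S (\<lambda>x. m (f x) (fderiv g x v) + m (fderiv f x v) (g x))" for v
    using Suc.prems Ck_on_Suc_imp[OF Suc.prems(1)] Ck_on_Suc_imp[OF Suc.prems(2)]
    by (intro Ck_on_add assms Suc.IH) auto
  then show ?case
    using Ck_on_has_derivative[OF Suc.prems(1)] Ck_on_has_derivative[OF Suc.prems(2)]
    by (intro Ck_on_SucI[OF assms(2), of _ "\<lambda>x v. m (f x) (fderiv g x v) + m (fderiv f x v) (g x)"]
        bounded_bilinear.FDERIV[OF assms(1)])
qed

lemma Ck_on_sum:
  assumes "open S" "\<And>i. i \<in> I \<Longrightarrow> Ck_on k S (f i)"
  shows "Ck_on k S (\<lambda>x. \<Sum>i\<in>I. f i x)"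
  using assms(2) by (induction I rule: infinite_finite_induct) (auto intro: Ck_on_const Ck_on_add assms(1))

text \<open>\<open>Ck_on\<close> only controls derivatives in a fixed direction. Expanding in the
  basis transfers this to directions that depend on the point.\<close>

lemma fderiv_expand:
  fixes f :: "'a::euclidean_space \<Rightarrow> 'b::real_normed_vector"
  assumes "f differentiable (at x)"
  shows "fderiv f x v = (\<Sum>b\<in>Basis. (v \<bullet> b) *\<^sub>R fderiv f x b)"
proof -
  have "linear (fderiv f x)" using assms by (rule linear_frechet_derivative)
  then have "fderiv f x (\<Sum>b\<in>Basis. (v \<bullet> b) *\<^sub>R b) = (\<Sum>b\<in>Basis. (v \<bullet> b) *\<^sub>R fderiv f x b)"
    by (simp add: linear_sum linear_scale)
  then show ?thesis
    by (simp add: euclidean_representation)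
qed

lemma Ck_on_inner_const:
  assumes "open S" "Ck_on k S f" shows "Ck_on k S (\<lambda>x. f x \<bullet> b)"
  using Ck_on_bilinear[OF bounded_bilinear_inner assms Ck_on_const] .

text \<open>The induction varies \<open>f\<close> but keeps \<open>g\<close>, since the directional
  derivatives of \<open>f\<close> are composed with the same \<open>g\<close>.\<close>

lemma Ck_on_compose:
  fixes g :: "'a::euclidean_space \<Rightarrow> 'b::euclidean_space" and f :: "'b \<Rightarrow> 'c::real_normed_vector"
  assumes "open S" "g ` S \<subseteq> T" "Ck_on k T f" "Ck_on k S g"
  shows "Ck_on k S (\<lambda>x. f (g x))"
  using assms(3,4)
proof (induction k arbitrary: f)
  case 0
  then show ?case using assms(2) by (auto intro: continuous_on_compose2)
next
  case (Suc k)
  \<comment> \<open>The chain rule, written over the basis so that every factor is a derivative in a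
    fixed direction.\<close>
  define d where "d x v = (\<Sum>b\<in>Basis. (fderiv g x v \<bullet> b) *\<^sub>R fderiv f (g x) b)" for x v
  have "((\<lambda>x. f (g x)) has_derivative d x) (at x)" if "x \<in> S" for x
  proof -
    have "((\<lambda>x. f (g x)) has_derivative (\<lambda>v. fderiv f (g x) (fderiv g x v))) (at x)"
      using that assms(2) Suc.prems
      by (intro has_derivative_compose[where f=g and g=f] Ck_on_has_derivative) auto
    moreover have "f differentiable at (g x)"
      using that assms(2) Suc.prems by auto
    ultimately show ?thesis
      unfolding d_def by (simp flip: fderiv_expand)
  qed
  moreover have "Ck_on k S (\<lambda>x. d x v)" for v
    unfolding d_def
    using Suc.prems Ck_on_Suc_imp[OF Suc.prems(2)]
    by (intro Ck_on_sum assms(1) Ck_on_bilinear[OF bounded_bilinear_scaleR] Ck_on_inner_const Suc.IH) auto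
  ultimately show ?case
    by (rule Ck_on_SucI[OF assms(1)])
qed

lemma Ck_on_inverse:
  fixes f :: "'a::euclidean_space \<Rightarrow> real"
  assumes "open S" "\<And>x. x \<in> S \<Longrightarrow> f x \<noteq> 0" "Ck_on k S f"
  shows "Ck_on k S (\<lambda>x. inverse (f x))"
  using assms(3)
proof (induction k)
  case 0
  then show ?case using assms by (auto intro!: continuous_intros)
next
  case (Suc k)
  note I = Suc.IH[OF Ck_on_Suc_imp[OF Suc.prems]]
  \<comment> \<open>The sign is kept as a constant factor, so that the lemma on products applies to
    the whole expression.\<close>
  have "Ck_on k S (\<lambda>x. - 1 * (inverse (f x) * fderiv f x v * inverse (f x)))" for v
    using Suc.prems by (intro Ck_on_bilinear[OF bounded_bilinear_mult] assms(1) I Ck_on_const) auto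
  then show ?case
    using Ck_on_has_derivative[OF Suc.prems] assms(2)
    by (intro Ck_on_SucI[OF assms(1), of _ "\<lambda>x v. - 1 * (inverse (f x) * fderiv f x v * inverse (f x))"])
      (auto intro!: has_derivative_inverse)
qed

section \<open>Smooth maps\<close>

lemma smooth_on_cong:
  "open S \<Longrightarrow> (\<And>x. x \<in> S \<Longrightarrow> f x = g x) \<Longrightarrow> smooth_on S f \<Longrightarrow> smooth_on S g"
  unfolding smooth_on_def using Ck_on_cong by metis

lemma smooth_on_subset: "smooth_on S f \<Longrightarrow> T \<subseteq> S \<Longrightarrow> smooth_on T f"
  unfolding smooth_on_def using Ck_on_subset by metis

lemma smooth_on_differentiable: "smooth_on S f \<Longrightarrow> x \<in> S \<Longrightarrow> f differentiable (at x)"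
  unfolding smooth_on_def by (metis Ck_on.simps(2))

lemma smooth_on_has_derivative: "smooth_on S f \<Longrightarrow> x \<in> S \<Longrightarrow> (f has_derivative fderiv f x) (at x)"
  using smooth_on_differentiable frechet_derivative_works by blast

lemma smooth_on_continuous_on: "smooth_on S f \<Longrightarrow> continuous_on S f"
  unfolding smooth_on_def by (metis Ck_on.simps(1))

lemma smooth_on_const: "smooth_on S (\<lambda>x. c)"
  by (simp add: smooth_on_def Ck_on_const)

lemma smooth_on_bounded_linear: "open S \<Longrightarrow> bounded_linear h \<Longrightarrow> smooth_on S h"
  by (simp add: smooth_on_def Ck_on_bounded_linear)

lemma smooth_on_add: "open S \<Longrightarrow> smooth_on S f \<Longrightarrow> smooth_on S g \<Longrightarrow> smooth_on S (\<lambda>x. f x + g x)"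
  by (simp add: smooth_on_def Ck_on_add)

lemma smooth_on_sum:
  "open S \<Longrightarrow> (\<And>i. i \<in> I \<Longrightarrow> smooth_on S (f i)) \<Longrightarrow> smooth_on S (\<lambda>x. \<Sum>i\<in>I. f i x)"
  by (simp add: smooth_on_def Ck_on_sum)

lemma smooth_on_bilinear:
  "bounded_bilinear m \<Longrightarrow> open S \<Longrightarrow> smooth_on S f \<Longrightarrow> smooth_on S g \<Longrightarrow> smooth_on S (\<lambda>x. m (f x) (g x))"
  by (simp add: smooth_on_def Ck_on_bilinear)

lemmas smooth_on_mult = smooth_on_bilinear[OF bounded_bilinear_mult]
lemmas smooth_on_scaleR = smooth_on_bilinear[OF bounded_bilinear_scaleR]
lemmas smooth_on_inner = smooth_on_bilinear[OF bounded_bilinear_inner]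

lemma smooth_on_inverse:
  fixes f :: "'a::euclidean_space \<Rightarrow> real"
  shows "open S \<Longrightarrow> (\<And>x. x \<in> S \<Longrightarrow> f x \<noteq> 0) \<Longrightarrow> smooth_on S f \<Longrightarrow> smooth_on S (\<lambda>x. inverse (f x))"
  by (simp add: smooth_on_def Ck_on_inverse)

lemma smooth_on_compose:
  fixes g :: "'a::euclidean_space \<Rightarrow> 'b::euclidean_space" and f :: "'b \<Rightarrow> 'c::real_normed_vector"
  shows "open S \<Longrightarrow> g ` S \<subseteq> T \<Longrightarrow> smooth_on T f \<Longrightarrow> smooth_on S g \<Longrightarrow> smooth_on S (\<lambda>x. f (g x))"
  unfolding smooth_on_def using Ck_on_compose by blast

lemma smooth_on_linear_compose:
  fixes g :: "'a::euclidean_space \<Rightarrow> 'b::euclidean_space"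
  shows "open S \<Longrightarrow> bounded_linear h \<Longrightarrow> smooth_on S g \<Longrightarrow> smooth_on S (\<lambda>x. h (g x))"
  using smooth_on_compose[of S g UNIV h] smooth_on_bounded_linear[of UNIV h] by auto

lemma smooth_on_minus:
  fixes f g :: "'a::euclidean_space \<Rightarrow> 'b::euclidean_space"
  assumes "open S" "smooth_on S f" "smooth_on S g"
  shows "smooth_on S (\<lambda>x. f x - g x)"
  using smooth_on_add[OF assms(1,2) smooth_on_linear_compose[OF assms(1) bounded_linear_minus[OF bounded_linear_ident] assms(3)]]
  by simp

lemma smooth_on_Pair:
  fixes f :: "'a::euclidean_space \<Rightarrow> 'b::euclidean_space" and g :: "'a \<Rightarrow> 'c::euclidean_space"
  assumes "open S" "smooth_on S f" "smooth_on S g"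
  shows "smooth_on S (\<lambda>x. (f x, g x))"
proof -
  have "smooth_on S (\<lambda>x. (f x, 0) + (0, g x))"
    by (intro smooth_on_add assms smooth_on_linear_compose[where h = "\<lambda>y. (y, 0)" and g = f]
        smooth_on_linear_compose[where h = "\<lambda>y. (0, y)" and g = g]
        bounded_linear_Pair bounded_linear_ident bounded_linear_zero)
  then show ?thesis by simp
qed

lemma smooth_on_fst: "open S \<Longrightarrow> smooth_on S fst"
  and smooth_on_snd: "open S \<Longrightarrow> smooth_on S snd"
  by (auto intro: smooth_on_bounded_linear bounded_linear_fst bounded_linear_snd)

lemma smooth_on_fderiv:
  "smooth_on S f \<Longrightarrow> smooth_on S (\<lambda>x. fderiv f x v)"
  unfolding smooth_on_def by (metis Ck_on.simps(2))

text \<open>Both the foot point and the direction move with \<open>x\<close>. This makes the fibre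
  part of a tangent bundle transition smooth, and also the derivative of a function along a vector
  field.\<close>

lemma smooth_on_fderiv_compose:
  fixes g :: "'a::euclidean_space \<Rightarrow> 'b::euclidean_space" and f :: "'b \<Rightarrow> 'c::real_normed_vector"
  assumes "open S" "g ` S \<subseteq> T" "smooth_on T f" "smooth_on S g" "smooth_on S h"
  shows "smooth_on S (\<lambda>x. fderiv f (g x) (h x))"
proof (rule smooth_on_cong[OF assms(1)])
  show "smooth_on S (\<lambda>x. \<Sum>b\<in>Basis. (h x \<bullet> b) *\<^sub>R fderiv f (g x) b)"
    by (intro smooth_on_sum smooth_on_scaleR smooth_on_inner smooth_on_const assms
        smooth_on_compose[OF assms(1,2) smooth_on_fderiv[OF assms(3)] assms(4)])
next
  fix x assume "x \<in> S"
  then have "f differentiable at (g x)"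
    using assms(2,3) smooth_on_differentiable by blast
  from fderiv_expand[OF this, of "h x"]
  show "(\<Sum>b\<in>Basis. (h x \<bullet> b) *\<^sub>R fderiv f (g x) b) = fderiv f (g x) (h x)"
    by simp
qed

lemma fderiv_compose:
  assumes "g differentiable (at x)" "f differentiable (at (g x))"
  shows "fderiv (\<lambda>x. f (g x)) x v = fderiv f (g x) (fderiv g x v)"
  by (rule fderiv_eq, rule has_derivative_compose[where f=g and g=f])
    (use assms in \<open>simp_all flip: frechet_derivative_works\<close>)

lemma linear_fderiv: "smooth_on S f \<Longrightarrow> x \<in> S \<Longrightarrow> linear (fderiv f x)"
  using smooth_on_differentiable linear_frechet_derivative by blast

lemma has_vector_derivative_compose:
  assumes "(\<gamma> has_vector_derivative v) (at t)" "f differentiable (at (\<gamma> t))"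
  shows "((\<lambda>s. f (\<gamma> s)) has_vector_derivative fderiv f (\<gamma> t) v) (at t)"
proof -
  have "((\<lambda>s. f (\<gamma> s)) has_derivative (\<lambda>h. fderiv f (\<gamma> t) (h *\<^sub>R v))) (at t)"
    using assms unfolding has_vector_derivative_def
    by (intro has_derivative_compose[where f=\<gamma> and g=f]) (simp_all flip: frechet_derivative_works)
  moreover have "fderiv f (\<gamma> t) (h *\<^sub>R v) = h *\<^sub>R fderiv f (\<gamma> t) v" for h
    using linear_frechet_derivative[OF assms(2)] linear_scale by blast
  ultimately show ?thesis
    unfolding has_vector_derivative_def by simp
qed

section \<open>Symmetry of second derivatives\<close>

lemma second_difference_mean_value:
  fixes f :: "'a::euclidean_space \<Rightarrow> real"
  assumes "smooth_on S f" "0 < s"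
    and sub: "\<And>a b. 0 \<le> a \<Longrightarrow> a \<le> s \<Longrightarrow> 0 \<le> b \<Longrightarrow> b \<le> s \<Longrightarrow> x + a *\<^sub>R u + b *\<^sub>R v \<in> S"
  obtains a b where "0 \<le> a" "a \<le> s" "0 \<le> b" "b \<le> s"
    "f (x + s *\<^sub>R u + s *\<^sub>R v) - f (x + s *\<^sub>R u) - f (x + s *\<^sub>R v) + f x
      = s * (s * fderiv (\<lambda>y. fderiv f y u) (x + a *\<^sub>R u + b *\<^sub>R v) v)"
proof -
  have 1: "((\<lambda>a. f (x + a *\<^sub>R u + b *\<^sub>R v)) has_real_derivative fderiv f (x + a *\<^sub>R u + b *\<^sub>R v) u) (at a)"
    if "x + a *\<^sub>R u + b *\<^sub>R v \<in> S" for a b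
    unfolding has_real_derivative_iff_has_vector_derivative
    by (rule has_vector_derivative_compose)
      (auto intro!: derivative_eq_intros smooth_on_differentiable[OF assms(1)] that)
  have 2: "((\<lambda>b. fderiv f (x + a *\<^sub>R u + b *\<^sub>R v) u) has_real_derivative
      fderiv (\<lambda>y. fderiv f y u) (x + a *\<^sub>R u + b *\<^sub>R v) v) (at b)"
    if "x + a *\<^sub>R u + b *\<^sub>R v \<in> S" for a b
    unfolding has_real_derivative_iff_has_vector_derivative
    by (rule has_vector_derivative_compose[where f = "\<lambda>y. fderiv f y u"])
      (auto intro!: derivative_eq_intros smooth_on_differentiable[OF smooth_on_fderiv[OF assms(1)]] that)
  \<comment> \<open>The mean value theorem in the direction \<open>u\<close>, applied to the
    difference of \<open>f\<close> between the two ends of the segment in direction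
    \<open>v\<close>.\<close>
  have "\<exists>a>0. a < s \<and>
      (f (x + s *\<^sub>R u + s *\<^sub>R v) - f (x + s *\<^sub>R u + 0 *\<^sub>R v)) - (f (x + 0 *\<^sub>R u + s *\<^sub>R v) - f (x + 0 *\<^sub>R u + 0 *\<^sub>R v))
      = (s - 0) * (fderiv f (x + a *\<^sub>R u + s *\<^sub>R v) u - fderiv f (x + a *\<^sub>R u + 0 *\<^sub>R v) u)"
    by (rule MVT2[OF assms(2)]) (use assms(2) in \<open>intro DERIV_diff 1 sub; simp\<close>)
  then obtain a where a: "0 < a" "a < s"
    "(f (x + s *\<^sub>R u + s *\<^sub>R v) - f (x + s *\<^sub>R u)) - (f (x + s *\<^sub>R v) - f x)
      = s * (fderiv f (x + a *\<^sub>R u + s *\<^sub>R v) u - fderiv f (x + a *\<^sub>R u + 0 *\<^sub>R v) u)" by auto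
  have "\<exists>b>0. b < s \<and> fderiv f (x + a *\<^sub>R u + s *\<^sub>R v) u - fderiv f (x + a *\<^sub>R u + 0 *\<^sub>R v) u
      = (s - 0) * fderiv (\<lambda>y. fderiv f y u) (x + a *\<^sub>R u + b *\<^sub>R v) v"
    by (rule MVT2[OF assms(2)]) (use a in \<open>intro 2 sub; simp\<close>)
  then obtain b where b: "0 < b" "b < s" "fderiv f (x + a *\<^sub>R u + s *\<^sub>R v) u - fderiv f (x + a *\<^sub>R u + 0 *\<^sub>R v) u
      = s * fderiv (\<lambda>y. fderiv f y u) (x + a *\<^sub>R u + b *\<^sub>R v) v" by auto
  show ?thesis
    by (rule that[of a b]) (use a b in auto)
qed

text \<open>The second difference of \<open>f\<close> over a small parallelogram is symmetric in
  \<open>u\<close> and \<open>v\<close>. It equals \<open>s * s\<close> times either mixed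
  derivative at some point of the parallelogram, and continuity takes both to their values at
  \<open>x\<close>.\<close>

lemma fderiv_commute:
  fixes f :: "'a::euclidean_space \<Rightarrow> real"
  assumes "open S" "smooth_on S f" "x \<in> S"
  shows "fderiv (\<lambda>y. fderiv f y u) x v = fderiv (\<lambda>y. fderiv f y v) x u"
proof -
  let ?g = "\<lambda>y. fderiv (\<lambda>y. fderiv f y u) y v" and ?h = "\<lambda>y. fderiv (\<lambda>y. fderiv f y v) y u"
  have "dist (?g x) (?h x) \<le> 0 + e" if "e > 0" for e
  proof -
    have "continuous_on S ?g" "continuous_on S ?h"
      by (intro smooth_on_continuous_on smooth_on_fderiv assms)+
    then obtain d1 d2 where d: "d1 > 0" "\<And>y. y \<in> S \<Longrightarrow> dist y x < d1 \<Longrightarrow> dist (?g y) (?g x) < e/2"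
       "d2 > 0" "\<And>y. y \<in> S \<Longrightarrow> dist y x < d2 \<Longrightarrow> dist (?h y) (?h x) < e/2"
      using assms(3) \<open>e > 0\<close> unfolding continuous_on_iff by (metis half_gt_zero)
    obtain d3 where d3: "d3 > 0" "ball x d3 \<subseteq> S"
      using assms open_contains_ball by blast
    define d where "d = min d1 (min d2 d3)"
    \<comment> \<open>Keeps the parallelogram with sides \<open>s *\<^sub>R u\<close> and
      \<open>s *\<^sub>R v\<close> within distance \<open>d\<close> of \<open>x\<close>; the summand
      1 covers vanishing vectors.\<close>
    define s where "s = d / (2 * (norm u + norm v + 1))"
    have N: "norm u + norm v + 1 > 0"
      by (smt (verit) norm_ge_zero)
    have s: "s > 0" using d d3 N by (simp add: s_def d_def)
    \<comment> \<open>Only the sum of the norms matters, so one estimate covers both orders of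
      \<open>u\<close> and \<open>v\<close>.\<close>
    have near: "dist (x + a *\<^sub>R w + b *\<^sub>R z) x < d"
      if "0 \<le> a" "a \<le> s" "0 \<le> b" "b \<le> s" "norm w + norm z = norm u + norm v" for a b w z
    proof -
      have "norm (a *\<^sub>R w + b *\<^sub>R z) \<le> s * norm w + s * norm z"
        using that by (intro norm_triangle_le add_mono) (auto intro!: mult_right_mono)
      also have "\<dots> = s * (norm u + norm v)" using that(5) by (simp flip: distrib_left)
      also have "\<dots> < s * (2 * (norm u + norm v + 1))"
        using s by (smt (verit) mult_strict_left_mono norm_ge_zero)
      also have "\<dots> = d" using N by (simp add: s_def)
      finally show ?thesis by (simp add: dist_norm add.assoc)
    qed
    have inS: "y \<in> S" if "dist y x < d" for y
      using that d3 by (auto simp: d_def dist_commute subset_iff)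
    obtain a b where 1: "0 \<le> a" "a \<le> s" "0 \<le> b" "b \<le> s"
      "f (x + s *\<^sub>R u + s *\<^sub>R v) - f (x + s *\<^sub>R u) - f (x + s *\<^sub>R v) + f x = s * (s * ?g (x + a *\<^sub>R u + b *\<^sub>R v))"
      using second_difference_mean_value[OF assms(2) s, of x u v] inS near by (metis (no_types, lifting))
    obtain a' b' where 2: "0 \<le> a'" "a' \<le> s" "0 \<le> b'" "b' \<le> s"
      "f (x + s *\<^sub>R v + s *\<^sub>R u) - f (x + s *\<^sub>R v) - f (x + s *\<^sub>R u) + f x = s * (s * ?h (x + a' *\<^sub>R v + b' *\<^sub>R u))"
      using second_difference_mean_value[OF assms(2) s, of x v u] inS near by (metis (no_types, lifting) add.commute)
    have "s * (s * ?g (x + a *\<^sub>R u + b *\<^sub>R v)) = s * (s * ?h (x + a' *\<^sub>R v + b' *\<^sub>R u))"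
      using 1(5) 2(5) by (simp add: algebra_simps)
    then have eq: "?g (x + a *\<^sub>R u + b *\<^sub>R v) = ?h (x + a' *\<^sub>R v + b' *\<^sub>R u)"
      using s by simp
    have A: "dist (x + a *\<^sub>R u + b *\<^sub>R v) x < d" by (rule near) (use 1 in auto)
    have B: "dist (x + a' *\<^sub>R v + b' *\<^sub>R u) x < d" by (rule near) (use 2 in auto)
    have "dist (?g (x + a *\<^sub>R u + b *\<^sub>R v)) (?g x) < e/2"
      using A inS d(2) by (simp add: d_def)
    moreover have "dist (?h (x + a' *\<^sub>R v + b' *\<^sub>R u)) (?h x) < e/2"
      using B inS d(4) by (simp add: d_def)
    ultimately show ?thesis using eq unfolding dist_real_def by linarith
  qed
  then have "dist (?g x) (?h x) \<le> 0" by (rule field_le_epsilon)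
  then show ?thesis by simp
qed

lemma has_vector_derivative_cong_eventually:
  assumes "\<forall>\<^sub>F s in nhds t. f s = g s" "(f has_vector_derivative v) (at t)"
  shows "(g has_vector_derivative v) (at t)"
proof -
  have "f t = g t" using assms(1) eventually_nhds_x_imp_x by fastforce
  moreover have "\<forall>\<^sub>F s in at t. f s = g s" using assms(1) eventually_nhds_conv_at by blast
  ultimately show ?thesis
    using assms(2) has_derivative_transform_eventually[of f "\<lambda>h. h *\<^sub>R v" t UNIV g]
    by (simp add: has_vector_derivative_def)
qed


section \<open>Functions, curves and tangent vectors in charts\<close>

locale atlas =
  fixes A :: "('p, 'e::euclidean_space) chart set"
  assumes smooth_atlas: "smooth_atlas A"
begin

abbreviation transition :: "('p, 'e) chart \<Rightarrow> ('p, 'e) chart \<Rightarrow> 'e \<Rightarrow> 'e" where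
  "transition c d \<equiv> \<lambda>x. coords d (param c x)"

abbreviation overlap :: "('p, 'e) chart \<Rightarrow> ('p, 'e) chart \<Rightarrow> 'e set" where
  "overlap c d \<equiv> coords c ` (chart_dom c \<inter> chart_dom d)"

lemma param_coords [simp]: "c \<in> A \<Longrightarrow> p \<in> chart_dom c \<Longrightarrow> param c (coords c p) = p"
  using smooth_atlas unfolding smooth_atlas_def param_def by (auto intro: inv_into_f_f)

lemma coords_eqD: "c \<in> A \<Longrightarrow> p \<in> chart_dom c \<Longrightarrow> q \<in> chart_dom c \<Longrightarrow> coords c p = coords c q \<Longrightarrow> p = q"
  using param_coords by metis

lemma open_overlap: "c \<in> A \<Longrightarrow> d \<in> A \<Longrightarrow> open (overlap c d)"
  and smooth_transition: "c \<in> A \<Longrightarrow> d \<in> A \<Longrightarrow> smooth_on (overlap c d) (transition c d)"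
  using smooth_atlas unfolding smooth_atlas_def by auto

lemma open_coords_image: "c \<in> A \<Longrightarrow> atlas_open A U \<Longrightarrow> open (coords c ` (chart_dom c \<inter> U))"
  by (simp add: atlas_open_def)

lemma atlas_open_points: "atlas_open A (points A)"
  unfolding atlas_open_def points_def
proof (intro conjI ballI)
  fix c assume "c \<in> A"
  then have "chart_dom c \<inter> \<Union> (fst ` A) = chart_dom c" by auto
  then show "open (coords c ` (chart_dom c \<inter> \<Union> (fst ` A)))"
    using smooth_atlas \<open>c \<in> A\<close> unfolding smooth_atlas_def by simp
qed auto

lemma differentiable_transition:
  "c \<in> A \<Longrightarrow> d \<in> A \<Longrightarrow> p \<in> chart_dom c \<Longrightarrow> p \<in> chart_dom d \<Longrightarrow> transition c d differentiable (at (coords c p))"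
  by (rule smooth_on_differentiable[OF smooth_transition]) auto

lemma chart_change:
  assumes "c \<in> A" "d \<in> A" "p \<in> chart_dom c" "p \<in> chart_dom d"
    and "(\<lambda>x. F (param d x)) differentiable (at (coords d p))"
  shows "fderiv (\<lambda>x. F (param c x)) (coords c p) v
      = fderiv (\<lambda>x. F (param d x)) (coords d p) (fderiv (transition c d) (coords c p) v)"
proof -
  have "fderiv (\<lambda>x. F (param c x)) (coords c p) v = fderiv (\<lambda>x. F (param d (transition c d x))) (coords c p) v"
    using assms by (subst fderiv_cong[OF open_overlap[of c d]]) auto
  also have "\<dots> = fderiv (\<lambda>x. F (param d x)) (coords d p) (fderiv (transition c d) (coords c p) v)"
    using assms differentiable_transition fderiv_compose[of "transition c d" "coords c p" "\<lambda>x. F (param d x)" v]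
    by simp
  finally show ?thesis .
qed

lemma transition_self:
  assumes "c \<in> A" "p \<in> chart_dom c"
  shows "fderiv (transition c c) (coords c p) v = v"
proof -
  have "fderiv (transition c c) (coords c p) v = fderiv (\<lambda>x. x) (coords c p) v"
    using assms by (subst fderiv_cong[OF open_overlap[of c c]]) auto
  then show ?thesis by simp
qed

lemma tangent_spaceD:
  assumes "v \<in> tangent_space A p" "c \<in> A" "d \<in> A" "p \<in> chart_dom c" "p \<in> chart_dom d"
  shows "v d = fderiv (transition c d) (coords c p) (v c)"
  using assms unfolding tangent_space_def by blast

lemma tangent_space_zero:
  "v \<in> tangent_space A p \<Longrightarrow> \<not> (c \<in> A \<and> p \<in> chart_dom c) \<Longrightarrow> v c = 0"
  unfolding tangent_space_def by blast

lemma tangent_space_add: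
  assumes "v \<in> tangent_space A p" "w \<in> tangent_space A p"
  shows "(\<lambda>c. v c + w c) \<in> tangent_space A p"
  unfolding tangent_space_def
proof (intro CollectI conjI allI impI ballI)
  fix c assume "\<not> (c \<in> A \<and> p \<in> chart_dom c)"
  then show "v c + w c = 0" using tangent_space_zero[OF assms(1), of c] tangent_space_zero[OF assms(2), of c] by simp
next
  fix c d assume "c \<in> A" "d \<in> A" "p \<in> chart_dom c \<inter> chart_dom d"
  then show "v d + w d = fderiv (transition c d) (coords c p) (v c + w c)"
    using tangent_spaceD[OF assms(1), of c d] tangent_spaceD[OF assms(2), of c d]
      linear_add[OF linear_frechet_derivative[OF differentiable_transition[of c d p]], of "v c" "w c"]
    by (metis IntE)
qed

lemma tangent_space_scaleR:
  assumes "v \<in> tangent_space A p"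
  shows "(\<lambda>c. s *\<^sub>R v c) \<in> tangent_space A p"
  unfolding tangent_space_def
proof (intro CollectI conjI allI impI ballI)
  fix c assume "\<not> (c \<in> A \<and> p \<in> chart_dom c)"
  then show "s *\<^sub>R v c = 0" using tangent_space_zero[OF assms, of c] by simp
next
  fix c d assume "c \<in> A" "d \<in> A" "p \<in> chart_dom c \<inter> chart_dom d"
  then show "s *\<^sub>R v d = fderiv (transition c d) (coords c p) (s *\<^sub>R v c)"
    using tangent_spaceD[OF assms, of c d]
      linear_scale[OF linear_frechet_derivative[OF differentiable_transition[of c d p]], of s "v c"]
    by (metis IntE)
qed

lemma tangent_space_eqI:
  assumes "v \<in> tangent_space A p" "w \<in> tangent_space A p" "c \<in> A" "p \<in> chart_dom c" "v c = w c"
  shows "v = w"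
proof
  fix d show "v d = w d"
  proof (cases "d \<in> A \<and> p \<in> chart_dom d")
    case True then show ?thesis
      using assms(3-5) tangent_spaceD[OF assms(1), of c d] tangent_spaceD[OF assms(2), of c d] by simp
  next
    case False then show ?thesis using assms tangent_space_zero by metis
  qed
qed

lemma smooth_fun_differentiable:
  assumes "smooth_fun A U g" "c \<in> A" "p \<in> chart_dom c" "p \<in> U"
  shows "(\<lambda>x. g (param c x)) differentiable (at (coords c p))"
  using assms unfolding smooth_fun_def by (intro smooth_on_differentiable) auto

text \<open>The definition picks an arbitrary chart; compatibility of the components with chart
  changes makes the choice irrelevant.\<close>

lemma dir_deriv_chart:
  assumes "smooth_fun A U g" "p \<in> U" "v \<in> tangent_space A p" "c \<in> A" "p \<in> chart_dom c"
  shows "dir_deriv A g p v = fderiv (\<lambda>x. g (param c x)) (coords c p) (v c)"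
proof -
  define d where "d = (SOME c. c \<in> A \<and> p \<in> chart_dom c)"
  have d: "d \<in> A \<and> p \<in> chart_dom d"
    unfolding d_def by (rule someI[of _ c]) (use assms in auto)
  have "dir_deriv A g p v = fderiv (\<lambda>x. g (param d x)) (coords d p) (v d)"
    by (simp add: dir_deriv_def d_def Let_def)
  also have "\<dots> = fderiv (\<lambda>x. g (param c x)) (coords c p) (v c)"
    using assms d smooth_fun_differentiable[OF assms(1)] chart_change[of c d p g "v c"] tangent_spaceD[of v p c d]
    by simp
  finally show ?thesis .
qed

text \<open>Covers additivity and, with \<open>w = v\<close> and the factor \<open>s - 1\<close>,
  also scaling by \<open>s\<close>.\<close>

lemma dir_deriv_add_scaleR:
  assumes "smooth_fun A U g" "p \<in> U" "atlas_open A U" "v \<in> tangent_space A p" "w \<in> tangent_space A p"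
  shows "dir_deriv A g p (\<lambda>c. v c + s *\<^sub>R w c) = dir_deriv A g p v + s * dir_deriv A g p w"
proof -
  obtain c where c: "c \<in> A" "p \<in> chart_dom c"
    using assms unfolding atlas_open_def points_def by auto
  have "linear (fderiv (\<lambda>x. g (param c x)) (coords c p))"
    using smooth_fun_differentiable[OF assms(1) c assms(2)] by (rule linear_frechet_derivative)
  then show ?thesis
    using assms c tangent_space_add[OF assms(4) tangent_space_scaleR[OF assms(5)]]
    by (simp add: dir_deriv_chart linear_add linear_scale)
qed

lemma smooth_fun_subset: "smooth_fun A U f \<Longrightarrow> V \<subseteq> U \<Longrightarrow> smooth_fun A V f"
  unfolding smooth_fun_def by (metis (no_types, lifting) Int_mono image_mono order_refl smooth_on_subset)

lemma smooth_fun_mult: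
  "atlas_open A U \<Longrightarrow> smooth_fun A U f \<Longrightarrow> smooth_fun A U g \<Longrightarrow> smooth_fun A U (\<lambda>p. f p * g p)"
  unfolding smooth_fun_def by (auto intro: smooth_on_mult open_coords_image)

lemma smooth_fun_divide:
  assumes "atlas_open A U" "\<And>p. p \<in> U \<Longrightarrow> g p \<noteq> 0" "smooth_fun A U f" "smooth_fun A U g"
  shows "smooth_fun A U (\<lambda>p. f p / g p)"
proof -
  have "smooth_fun A U (\<lambda>p. inverse (g p))"
    unfolding smooth_fun_def
  proof
    fix c assume c: "c \<in> A"
    show "smooth_on (coords c ` (chart_dom c \<inter> U)) (\<lambda>x. inverse (g (param c x)))"
      by (rule smooth_on_inverse) (use assms c in \<open>auto simp: smooth_fun_def intro: open_coords_image\<close>)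
  qed
  from smooth_fun_mult[OF assms(1,3) this] show ?thesis by (simp add: divide_inverse)
qed

lemma vector_fieldD:
  "vector_field A U X \<Longrightarrow> p \<in> U \<Longrightarrow> X p \<in> tangent_space A p"
  "vector_field A U X \<Longrightarrow> c \<in> A \<Longrightarrow> smooth_on (coords c ` (chart_dom c \<inter> U)) (\<lambda>x. X (param c x) c)"
  unfolding vector_field_def by auto

lemma smooth_fun_dir_deriv:
  assumes "atlas_open A U" "smooth_fun A U g" "vector_field A U X"
  shows "smooth_fun A U (\<lambda>p. dir_deriv A g p (X p))"
  unfolding smooth_fun_def
proof
  fix c assume c: "c \<in> A"
  note o = open_coords_image[OF c assms(1)]
  have "smooth_on (coords c ` (chart_dom c \<inter> U)) (\<lambda>x. fderiv (\<lambda>x. g (param c x)) x (X (param c x) c))"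
    using assms(2) c
    by (intro smooth_on_fderiv_compose[OF o _ _ smooth_on_bounded_linear[OF o bounded_linear_ident]
          vector_fieldD(2)[OF assms(3) c], where T = "coords c ` (chart_dom c \<inter> U)"])
      (auto simp: smooth_fun_def)
  then show "smooth_on (coords c ` (chart_dom c \<inter> U)) (\<lambda>x. dir_deriv A g (param c x) (X (param c x)))"
    by (rule smooth_on_cong[OF o, rotated])
      (use c assms vector_fieldD in \<open>auto simp: dir_deriv_chart[where U=U and c=c]\<close>)
qed

section \<open>Velocities of curves\<close>

lemma has_velocity_chart:
  assumes "has_velocity A \<gamma> v t" "c \<in> A" "\<gamma> t \<in> chart_dom c"
  shows "\<forall>\<^sub>F s in nhds t. \<gamma> s \<in> chart_dom c"
    and "((\<lambda>s. coords c (\<gamma> s)) has_vector_derivative v c) (at t)"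
  using assms unfolding has_velocity_def by auto

text \<open>What needs an argument in the other charts is that the curve stays in their domains,
  since coordinate maps are arbitrary elsewhere.\<close>

lemma has_velocityI:
  assumes "c \<in> A" "\<gamma> t \<in> chart_dom c" "\<forall>\<^sub>F s in nhds t. \<gamma> s \<in> chart_dom c"
    "((\<lambda>s. coords c (\<gamma> s)) has_vector_derivative v c) (at t)" "v \<in> tangent_space A (\<gamma> t)"
  shows "has_velocity A \<gamma> v t"
proof -
  have "(\<forall>\<^sub>F s in nhds t. \<gamma> s \<in> chart_dom d) \<and> ((\<lambda>s. coords d (\<gamma> s)) has_vector_derivative v d) (at t)"
    if d: "d \<in> A" "\<gamma> t \<in> chart_dom d" for d
  proof
    have "isCont (\<lambda>s. coords c (\<gamma> s)) t"
      using assms(4) has_vector_derivative_continuous by blast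
    then have "((\<lambda>s. coords c (\<gamma> s)) \<longlongrightarrow> coords c (\<gamma> t)) (nhds t)"
      by (simp add: isCont_def tendsto_nhds_iff)
    \<comment> \<open>Continuity keeps the coordinates in the open overlap, and injectivity of
      \<open>c\<close> on its domain turns this into membership in the domain of
      \<open>d\<close>.\<close>
    then have "\<forall>\<^sub>F s in nhds t. coords c (\<gamma> s) \<in> overlap c d"
      by (rule topological_tendstoD) (use open_overlap assms d in auto)
    with assms(3) show ev: "\<forall>\<^sub>F s in nhds t. \<gamma> s \<in> chart_dom d"
      by eventually_elim (use coords_eqD[OF assms(1)] in fastforce)
    have "((\<lambda>s. transition c d (coords c (\<gamma> s))) has_vector_derivative
        fderiv (transition c d) (coords c (\<gamma> t)) (v c)) (at t)"
      by (rule has_vector_derivative_compose[OF assms(4)]) (use assms d differentiable_transition in auto)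
    then have "((\<lambda>s. transition c d (coords c (\<gamma> s))) has_vector_derivative v d) (at t)"
      using assms d tangent_spaceD[OF assms(5) assms(1) d(1)] by simp
    moreover have "\<forall>\<^sub>F s in nhds t. transition c d (coords c (\<gamma> s)) = coords d (\<gamma> s)"
      using assms(3) by eventually_elim (use assms in auto)
    ultimately show "((\<lambda>s. coords d (\<gamma> s)) has_vector_derivative v d) (at t)"
      by (rule has_vector_derivative_cong_eventually[rotated])
  qed
  moreover have "\<gamma> t \<in> points A" using assms unfolding points_def by auto
  ultimately show ?thesis using assms(5) unfolding has_velocity_def by blast
qed

lemma has_velocity_fun:
  assumes "smooth_fun A U g" "\<gamma> t \<in> U" "has_velocity A \<gamma> v t"
  shows "((\<lambda>s. g (\<gamma> s)) has_real_derivative dir_deriv A g (\<gamma> t) v) (at t)"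
proof -
  obtain c where c: "c \<in> A" "\<gamma> t \<in> chart_dom c" and v: "v \<in> tangent_space A (\<gamma> t)"
    using assms unfolding has_velocity_def points_def by auto
  have "((\<lambda>s. g (param c (coords c (\<gamma> s)))) has_vector_derivative
      fderiv (\<lambda>x. g (param c x)) (coords c (\<gamma> t)) (v c)) (at t)"
    by (rule has_vector_derivative_compose[where f = "\<lambda>x. g (param c x)"])
      (use assms c has_velocity_chart smooth_fun_differentiable in auto)
  moreover have "\<forall>\<^sub>F s in nhds t. g (param c (coords c (\<gamma> s))) = g (\<gamma> s)"
    using has_velocity_chart(1)[OF assms(3) c] by eventually_elim (use c in auto)
  ultimately show ?thesis
    unfolding has_real_derivative_iff_has_vector_derivative dir_deriv_chart[OF assms(1,2) v c]
    by (rule has_vector_derivative_cong_eventually[rotated])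
qed

end


section \<open>Natural charts of the tangent bundle\<close>

locale base_atlas = base: atlas A for A :: "('q, 'e::euclidean_space) chart set"
begin

text \<open>The tangent vector at \<open>p\<close> with component \<open>y\<close> in the chart
  \<open>c\<close>; this inverts the fibre coordinate of the natural chart.\<close>

definition extend_vector :: "('q, 'e) chart \<Rightarrow> 'q \<Rightarrow> 'e \<Rightarrow> ('q, 'e) tvec" where
  "extend_vector c p y =
     (\<lambda>d. if d \<in> A \<and> p \<in> chart_dom d then fderiv (base.transition c d) (coords c p) y else 0)"

lemma extend_vector_self: "c \<in> A \<Longrightarrow> p \<in> chart_dom c \<Longrightarrow> extend_vector c p y c = y"
  by (simp add: extend_vector_def base.transition_self)

lemma extend_vector_tangent:
  assumes "c \<in> A" "p \<in> chart_dom c"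
  shows "extend_vector c p y \<in> tangent_space A p"
  unfolding tangent_space_def
proof (intro CollectI conjI allI impI ballI)
  fix d e assume "d \<in> A" "e \<in> A" "p \<in> chart_dom d \<inter> chart_dom e"
  then show "extend_vector c p y e = fderiv (base.transition d e) (coords d p) (extend_vector c p y d)"
    using assms base.differentiable_transition[of d e p] base.chart_change[of c d p "coords e" y]
    by (simp add: extend_vector_def)
qed (auto simp: extend_vector_def)

lemma chart_dom_natural: "chart_dom (natural_chart A c) = {p \<in> tangent_bundle A. fst p \<in> chart_dom c}"
  and coords_natural: "coords (natural_chart A c) p = (coords c (fst p), snd p c)"
  by (simp_all add: natural_chart_def)

lemma tangent_atlasE:
  assumes "C \<in> tangent_atlas A" obtains c where "c \<in> A" "C = natural_chart A c"
  using assms by (auto simp: tangent_atlas_def)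

lemma natural_chart_mem: "c \<in> A \<Longrightarrow> natural_chart A c \<in> tangent_atlas A"
  by (simp add: tangent_atlas_def)

lemma tangent_bundle_iff: "p \<in> tangent_bundle A \<longleftrightarrow> fst p \<in> points A \<and> snd p \<in> tangent_space A (fst p)"
  by (cases p) (simp add: tangent_bundle_def)

text \<open>Every \<open>y\<close> is attained as a fibre coordinate through
  \<open>extend_vector\<close>. The subset \<open>S\<close> may be an overlap as well as a whole
  domain.\<close>

lemma coords_natural_image:
  assumes "c \<in> A" "S \<subseteq> chart_dom c"
  shows "coords (natural_chart A c) ` {p \<in> tangent_bundle A. fst p \<in> S} = coords c ` S \<times> UNIV"
proof (intro equalityI subsetI)
  fix z assume "z \<in> coords c ` S \<times> (UNIV :: 'e set)"
  then obtain p y where p: "p \<in> S" "z = (coords c p, y)" by auto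
  moreover have "(p, extend_vector c p y) \<in> tangent_bundle A"
    using p assms extend_vector_tangent[of c p y] unfolding tangent_bundle_iff points_def by fastforce
  moreover have "coords (natural_chart A c) (p, extend_vector c p y) = z"
    using p assms extend_vector_self[of c p y] by (auto simp: coords_natural)
  ultimately show "z \<in> coords (natural_chart A c) ` {p \<in> tangent_bundle A. fst p \<in> S}"
    by (intro image_eqI[of _ _ "(p, extend_vector c p y)"]) auto
qed (auto simp: coords_natural)

lemma inj_on_natural:
  assumes "c \<in> A" shows "inj_on (coords (natural_chart A c)) (chart_dom (natural_chart A c))"
proof (rule inj_onI)
  fix p q assume pq: "p \<in> chart_dom (natural_chart A c)" "q \<in> chart_dom (natural_chart A c)"
    "coords (natural_chart A c) p = coords (natural_chart A c) q"
  then have "fst p = fst q" using assms base.coords_eqD by (auto simp: coords_natural chart_dom_natural)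
  moreover from this have "snd p = snd q"
    using base.tangent_space_eqI[of "snd p" "fst p" "snd q" c] pq assms
    by (auto simp: coords_natural chart_dom_natural tangent_bundle_iff)
  ultimately show "p = q" by (rule prod_eqI)
qed

lemma param_natural:
  assumes "c \<in> A" "x \<in> coords c ` chart_dom c"
  shows "param (natural_chart A c) (x, y) = (param c x, extend_vector c (param c x) y)"
proof -
  obtain p where p: "p \<in> chart_dom c" "x = coords c p" using assms by auto
  have "(p, extend_vector c p y) \<in> chart_dom (natural_chart A c)"
    using p assms extend_vector_tangent[of c p y]
    unfolding chart_dom_natural tangent_bundle_iff points_def by fastforce
  moreover have "coords (natural_chart A c) (p, extend_vector c p y) = (x, y)"
    using p assms extend_vector_self by (auto simp: coords_natural)
  ultimately have "param (natural_chart A c) (x, y) = (p, extend_vector c p y)"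
    unfolding param_def using inv_into_f_f[OF inj_on_natural[OF assms(1)]] by metis
  then show ?thesis using p assms by simp
qed

lemma natural_overlap:
  assumes "c \<in> A" "d \<in> A"
  shows "coords (natural_chart A c) ` (chart_dom (natural_chart A c) \<inter> chart_dom (natural_chart A d))
    = base.overlap c d \<times> UNIV"
proof -
  have "chart_dom (natural_chart A c) \<inter> chart_dom (natural_chart A d)
      = {p \<in> tangent_bundle A. fst p \<in> chart_dom c \<inter> chart_dom d}"
    by (auto simp: chart_dom_natural)
  then show ?thesis using coords_natural_image[OF assms(1), of "chart_dom c \<inter> chart_dom d"] by simp
qed

lemma natural_transition:
  assumes "c \<in> A" "d \<in> A" "x \<in> base.overlap c d"
  shows "coords (natural_chart A d) (param (natural_chart A c) (x, y))
    = (base.transition c d x, fderiv (base.transition c d) x y)"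
  using assms by (auto simp: param_natural coords_natural extend_vector_def)

lemma smooth_tangent_atlas: "smooth_atlas (tangent_atlas A)"
  unfolding smooth_atlas_def
proof (intro conjI ballI)
  fix C assume "C \<in> tangent_atlas A"
  then obtain c where c: "c \<in> A" "C = natural_chart A c" by (rule tangent_atlasE)
  show "inj_on (coords C) (chart_dom C)" using inj_on_natural c by simp
  show "open (coords C ` chart_dom C)"
    using natural_overlap[of c c] base.open_overlap[of c c] c by (simp add: open_Times)
  fix D assume "D \<in> tangent_atlas A"
  then obtain d where d: "d \<in> A" "D = natural_chart A d" by (rule tangent_atlasE)
  have o: "open (base.overlap c d \<times> (UNIV :: 'e set))"
    using base.open_overlap[of c d] c d by (simp add: open_Times)
  then show "open (coords C ` (chart_dom C \<inter> chart_dom D))"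
    using natural_overlap c d by simp
  have sm: "smooth_on (base.overlap c d) (base.transition c d)"
    using base.smooth_transition c d by simp
  have "smooth_on (base.overlap c d \<times> UNIV)
      (\<lambda>z. (base.transition c d (fst z), fderiv (base.transition c d) (fst z) (snd z)))"
    by (intro smooth_on_Pair smooth_on_compose[OF o _ sm smooth_on_fst]
        smooth_on_fderiv_compose[OF o _ sm smooth_on_fst smooth_on_snd] o) auto
  then show "smooth_on (coords C ` (chart_dom C \<inter> chart_dom D)) (\<lambda>x. coords D (param C x))"
    unfolding c d natural_overlap[OF c(1) d(1)]
    by (rule smooth_on_cong[OF o, rotated]) (use natural_transition[OF c(1) d(1)] in auto)
qed

end

sublocale base_atlas \<subseteq> tm: atlas "tangent_atlas A"
  by unfold_locales (rule smooth_tangent_atlas)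

context base_atlas
begin

lemma points_tangent_atlas: "points (tangent_atlas A) = tangent_bundle A"
  unfolding points_def tangent_atlas_def by (force simp: chart_dom_natural tangent_bundle_iff points_def)

lemma atlas_open_over:
  assumes "atlas_open (tangent_atlas A) U" "atlas_open A W"
  shows "atlas_open (tangent_atlas A) (over U W)"
  unfolding atlas_open_def
proof (intro conjI ballI)
  show "over U W \<subseteq> points (tangent_atlas A)" using assms by (auto simp: atlas_open_def over_def)
  fix C assume C: "C \<in> tangent_atlas A"
  then obtain c where c: "c \<in> A" "C = natural_chart A c" by (rule tangent_atlasE)
  \<comment> \<open>Restriction to \<open>W\<close> concerns only the base coordinate, so the image
    is cut out by an open cylinder.\<close>
  have "coords C ` (chart_dom C \<inter> over U W)
      = coords C ` (chart_dom C \<inter> U) \<inter> (coords c ` (chart_dom c \<inter> W) \<times> UNIV)"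
  proof (intro equalityI subsetI)
    fix z assume z: "z \<in> coords C ` (chart_dom C \<inter> U) \<inter> (coords c ` (chart_dom c \<inter> W) \<times> UNIV)"
    then obtain p q where p: "p \<in> chart_dom C" "p \<in> U" "z = coords C p" "q \<in> chart_dom c" "q \<in> W" "fst z = coords c q"
      by (elim IntE imageE) (force simp: mem_Times_iff)
    then have "fst p \<in> chart_dom c" "coords c q = coords c (fst p)"
      unfolding c coords_natural chart_dom_natural by auto
    with p c have "q = fst p" using base.coords_eqD by blast
    with p have "p \<in> chart_dom C \<inter> over U W" by (simp add: over_def)
    with p(3) show "z \<in> coords C ` (chart_dom C \<inter> over U W)" by blast
  qed (auto simp: over_def c coords_natural chart_dom_natural)
  then show "open (coords C ` (chart_dom C \<inter> over U W))"
    using assms base.open_coords_image[OF c(1)] tm.open_coords_image[OF C] by (auto intro!: open_Int open_Times)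
qed

section \<open>Fibre scaling and the Liouville field\<close>

lemma scale_mem_tangent_bundle: "p \<in> tangent_bundle A \<Longrightarrow> scale s p \<in> tangent_bundle A"
  by (simp add: tangent_bundle_iff scale_def base.tangent_space_scaleR)

lemma tangent_bundleD: "C \<in> tangent_atlas A \<Longrightarrow> p \<in> chart_dom C \<Longrightarrow> p \<in> tangent_bundle A"
  by (auto simp: points_def simp flip: points_tangent_atlas)

lemma tangent_bundle_chart:
  assumes "p \<in> tangent_bundle A" obtains C where "C \<in> tangent_atlas A" "p \<in> chart_dom C"
  using assms by (auto simp: points_def simp flip: points_tangent_atlas)

lemma scale_mem_chart_dom:
  assumes "C \<in> tangent_atlas A" "p \<in> chart_dom C" shows "scale s p \<in> chart_dom C"
  using assms by (elim tangent_atlasE) (simp add: chart_dom_natural scale_mem_tangent_bundle, simp add: scale_def)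

lemma coords_scale:
  assumes "C \<in> tangent_atlas A"
  shows "coords C (scale s p) = (fst (coords C p), s *\<^sub>R snd (coords C p))"
  using assms by (elim tangent_atlasE) (auto simp: coords_natural scale_def)

lemma scale_scale: "scale s (scale t p) = scale (s * t) p"
  by (simp add: scale_def)

lemma scale_one [simp]: "scale 1 p = p"
  by (simp add: scale_def)

lemma fst_scale [simp]: "fst (scale s p) = fst p"
  by (simp add: scale_def)

lemma param_scale:
  assumes "C \<in> tangent_atlas A" "z \<in> coords C ` chart_dom C"
  shows "param C (fst z, s *\<^sub>R snd z) = scale s (param C z)"
proof -
  obtain p where p: "p \<in> chart_dom C" "z = coords C p" using assms by auto
  have "param C (coords C (scale s p)) = scale s p"
    using assms p scale_mem_chart_dom by simp
  then show ?thesis using assms p by (simp add: coords_scale)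
qed

abbreviation fibre_scale :: "real \<Rightarrow> 'e \<times> 'e \<Rightarrow> 'e \<times> 'e" where
  "fibre_scale s z \<equiv> (fst z, s *\<^sub>R snd z)"

lemma natural_transition_scale:
  assumes "C \<in> tangent_atlas A" "D \<in> tangent_atlas A" "z \<in> tm.overlap C D"
  shows "tm.transition C D (fibre_scale s z) = fibre_scale s (tm.transition C D z)"
proof -
  obtain p where "p \<in> chart_dom C" "p \<in> chart_dom D" "z = coords C p" using assms by blast
  then show ?thesis using assms param_scale[of C z s] coords_scale[OF assms(2)] by simp
qed

text \<open>In natural charts fibre scaling is linear, hence its own derivative. Differentiating its
  commutation with the transitions shows that the scaled components transform correctly at
  \<open>scale s p\<close>.\<close>

lemma scaled_tangent:
  assumes v: "v \<in> tangent_space (tangent_atlas A) p"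
  shows "(\<lambda>C. fibre_scale s (v C)) \<in> tangent_space (tangent_atlas A) (scale s p)"
  unfolding tangent_space_def
proof (intro CollectI conjI allI impI ballI)
  fix C assume "\<not> (C \<in> tangent_atlas A \<and> scale s p \<in> chart_dom C)"
  then have "\<not> (C \<in> tangent_atlas A \<and> p \<in> chart_dom C)" using scale_mem_chart_dom by blast
  then show "fibre_scale s (v C) = 0" using tm.tangent_space_zero[OF v] by (simp add: zero_prod_def)
next
  fix C D assume C: "C \<in> tangent_atlas A" and D: "D \<in> tangent_atlas A"
    and sp: "scale s p \<in> chart_dom C \<inter> chart_dom D"
  show "fibre_scale s (v D) = fderiv (tm.transition C D) (coords C (scale s p)) (fibre_scale s (v C))"
  proof (cases "p \<in> chart_dom C \<and> p \<in> chart_dom D")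
    case True
    let ?T = "tm.transition C D" and ?z = "coords C p"
    have lin: "(fibre_scale s has_derivative fibre_scale s) (at z)" for z
      by (intro derivative_eq_intros) auto
    have "fderiv ?T (fibre_scale s ?z) (fibre_scale s (v C)) = fderiv (\<lambda>z. ?T (fibre_scale s z)) ?z (v C)"
      using tm.differentiable_transition[OF C D, of "scale s p"] sp coords_scale[OF C] fderiv_eq[OF lin]
        differentiableI[OF lin]
      by (subst fderiv_compose[where f = ?T]) auto
    also have "\<dots> = fderiv (\<lambda>z. fibre_scale s (?T z)) ?z (v C)"
      using True C D natural_transition_scale by (subst fderiv_cong[OF tm.open_overlap[OF C D]]) auto
    also have "\<dots> = fibre_scale s (fderiv ?T ?z (v C))"
      using tm.differentiable_transition[OF C D, of p] True fderiv_eq[OF lin] differentiableI[OF lin]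
      by (subst fderiv_compose[where f = "fibre_scale s"]) auto
    finally show ?thesis
      using tm.tangent_spaceD[OF v C D] True coords_scale[OF C] by simp
  next
    \<comment> \<open>Here \<open>p\<close> is not in the tangent bundle although its multiple is,
      which can happen only for \<open>s = 0\<close>; the components of \<open>v\<close> are then
      zero by normalisation.\<close>
    case False
    obtain c d where c: "C = natural_chart A c" "D = natural_chart A d" using C D by (metis tangent_atlasE)
    from False sp have "p \<notin> tangent_bundle A" by (auto simp: c chart_dom_natural)
    then have "v C = 0" "v D = 0" using tm.tangent_space_zero[OF v] tangent_bundleD by blast+
    then show ?thesis
      using linear_0[OF linear_frechet_derivative[OF tm.differentiable_transition[OF C D, of "scale s p"]]] sp
      by (simp flip: zero_prod_def)
  qed
qed

text \<open>Differentiating \<open>T (x, s y) = fibre_scale s (T (x, y))\<close> at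
  \<open>s = 1\<close> in two ways gives the transformation law.\<close>

lemma liouville_tangent: "liouville A p \<in> tangent_space (tangent_atlas A) p"
  unfolding tangent_space_def
proof (intro CollectI conjI allI impI ballI)
  fix C assume "\<not> (C \<in> tangent_atlas A \<and> p \<in> chart_dom C)"
  then show "liouville A p C = 0" unfolding liouville_def by (rule if_not_P)
next
  fix C D assume C: "C \<in> tangent_atlas A" and D: "D \<in> tangent_atlas A" and p: "p \<in> chart_dom C \<inter> chart_dom D"
  let ?T = "tm.transition C D" and ?z = "coords C p"
  have "((\<lambda>s. fibre_scale s ?z) has_vector_derivative (0, snd ?z)) (at 1)"
    by (auto intro!: derivative_eq_intros simp: has_vector_derivative_def)
  then have "((\<lambda>s. ?T (fibre_scale s ?z)) has_vector_derivative fderiv ?T ?z (0, snd ?z)) (at 1)"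
    using has_vector_derivative_compose[of "\<lambda>s. fibre_scale s ?z" "(0, snd ?z)" 1 ?T]
      tm.differentiable_transition[OF C D, of p] p by auto
  then have "((\<lambda>s. fibre_scale s (?T ?z)) has_vector_derivative fderiv ?T ?z (0, snd ?z)) (at 1)"
    using natural_transition_scale[OF C D] p by simp
  moreover have "((\<lambda>s. fibre_scale s (?T ?z)) has_vector_derivative (0, snd (?T ?z))) (at 1)"
    by (auto intro!: derivative_eq_intros simp: has_vector_derivative_def)
  ultimately have "fderiv ?T ?z (0, snd ?z) = (0, snd (?T ?z))"
    by (rule vector_derivative_unique_at)
  then show "liouville A p D = fderiv ?T ?z (liouville A p C)"
    using C D p by (simp add: liouville_def)
qed

lemma liouville_chart: "C \<in> tangent_atlas A \<Longrightarrow> p \<in> chart_dom C \<Longrightarrow> liouville A p C = (0, snd (coords C p))"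
  by (simp add: liouville_def)

end

section \<open>Second derivatives\<close>

text \<open>Linearity in the inner direction is not linearity of one derivative at \<open>x\<close>:
  the identities are needed on a neighbourhood before differentiating again.\<close>

lemma linear_second_fderiv:
  fixes f :: "'a::euclidean_space \<Rightarrow> 'b::real_normed_vector"
  assumes "open S" "smooth_on S f" "x \<in> S"
  shows "linear (\<lambda>u. fderiv (\<lambda>y. fderiv f y u) x v)"
proof (rule linearI)
  note d = smooth_on_has_derivative[OF smooth_on_fderiv[OF assms(2)] assms(3)]
  fix u w :: 'a and r :: real
  have "fderiv (\<lambda>y. fderiv f y (u + w)) x v = fderiv (\<lambda>y. fderiv f y u + fderiv f y w) x v"
    using assms by (subst fderiv_cong[OF assms(1,3)]) (auto simp: linear_add[OF linear_fderiv])
  also have "\<dots> = fderiv (\<lambda>y. fderiv f y u) x v + fderiv (\<lambda>y. fderiv f y w) x v"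
    by (rule fderiv_eq) (intro has_derivative_add d)
  finally show "fderiv (\<lambda>y. fderiv f y (u + w)) x v
      = fderiv (\<lambda>y. fderiv f y u) x v + fderiv (\<lambda>y. fderiv f y w) x v" .
  have "fderiv (\<lambda>y. fderiv f y (r *\<^sub>R u)) x v = fderiv (\<lambda>y. r *\<^sub>R fderiv f y u) x v"
    using assms by (subst fderiv_cong[OF assms(1,3)]) (auto simp: linear_scale[OF linear_fderiv])
  also have "\<dots> = r *\<^sub>R fderiv (\<lambda>y. fderiv f y u) x v"
    by (rule fderiv_eq) (intro has_derivative_scaleR_right d)
  finally show "fderiv (\<lambda>y. fderiv f y (r *\<^sub>R u)) x v = r *\<^sub>R fderiv (\<lambda>y. fderiv f y u) x v" .
qed

text \<open>The product rule for a derivative whose foot point and direction both vary. It serves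
  the energy, whose direction is the fibre coordinate, and the total derivative of a function on the
  base.\<close>

lemma fderiv_compose_has_derivative:
  fixes f :: "'a::euclidean_space \<Rightarrow> 'b::real_normed_vector"
  assumes "open S" "smooth_on S f" "\<forall>\<^sub>F y in nhds x. g y \<in> S"
    and g: "(g has_derivative g') (at x)" and k: "(k has_derivative k') (at x)"
  shows "((\<lambda>x. fderiv f (g x) (k x)) has_derivative
      (\<lambda>v. fderiv (\<lambda>y. fderiv f y (k x)) (g x) (g' v) + fderiv f (g x) (k' v))) (at x)"
proof -
  have gx: "g x \<in> S" using assms(3) eventually_nhds_x_imp_x by blast
  have expand: "fderiv f y w = (\<Sum>b\<in>Basis. (w \<bullet> b) *\<^sub>R fderiv f y b)" if "y \<in> S" for y w
    using fderiv_expand smooth_on_differentiable[OF assms(2) that] by blast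
  have "((\<lambda>y. \<Sum>b\<in>Basis. (k y \<bullet> b) *\<^sub>R fderiv f (g y) b) has_derivative
      (\<lambda>v. \<Sum>b\<in>Basis. (k x \<bullet> b) *\<^sub>R fderiv (\<lambda>y. fderiv f y b) (g x) (g' v) + (k' v \<bullet> b) *\<^sub>R fderiv f (g x) b)) (at x)"
    by (intro has_derivative_sum has_derivative_scaleR has_derivative_inner_left k
        has_derivative_compose[where g = "\<lambda>y. fderiv f y b" for b, OF g]
        smooth_on_has_derivative[OF smooth_on_fderiv[OF assms(2)] gx])
  also have "(\<lambda>v. \<Sum>b\<in>Basis. (k x \<bullet> b) *\<^sub>R fderiv (\<lambda>y. fderiv f y b) (g x) (g' v) + (k' v \<bullet> b) *\<^sub>R fderiv f (g x) b)
     = (\<lambda>v. fderiv (\<lambda>y. fderiv f y (k x)) (g x) (g' v) + fderiv f (g x) (k' v))"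
  proof
    fix v
    let ?L = "\<lambda>u. fderiv (\<lambda>y. fderiv f y u) (g x) (g' v)"
    have "?L (\<Sum>b\<in>Basis. (k x \<bullet> b) *\<^sub>R b) = (\<Sum>b\<in>Basis. (k x \<bullet> b) *\<^sub>R ?L b)"
      unfolding linear_sum[OF linear_second_fderiv[OF assms(1,2) gx]]
        linear_scale[OF linear_second_fderiv[OF assms(1,2) gx]] ..
    then show "(\<Sum>b\<in>Basis. (k x \<bullet> b) *\<^sub>R ?L b + (k' v \<bullet> b) *\<^sub>R fderiv f (g x) b) = ?L (k x) + fderiv f (g x) (k' v)"
      using expand[OF gx, of "k' v"] by (simp add: euclidean_representation sum.distrib)
  qed
  finally show ?thesis
    by (rule has_derivative_transform_eventually)
      (use gx assms(3) expand in \<open>auto simp: eventually_nhds_conv_at elim!: eventually_mono\<close>)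
qed


section \<open>The fixed energy function in a chart\<close>

abbreviation vertical_hessian :: "('e \<times> 'e \<Rightarrow> real) \<Rightarrow> 'e::euclidean_space \<times> 'e \<Rightarrow> 'e \<Rightarrow> 'e \<Rightarrow> real" where
  "vertical_hessian f z u w \<equiv> fderiv (\<lambda>z. fderiv f z (0, w)) z (0, u)"

definition local_energy :: "('e::euclidean_space \<times> 'e \<Rightarrow> real) \<Rightarrow> 'e \<times> 'e \<Rightarrow> real" where
  "local_energy f z = fderiv f z (0, snd z) - f z"

text \<open>Quantifying over all vectors \<open>w\<close> in place of coordinate indices allows
  linear algebra without sums.\<close>

definition euler_lagrange_at :: "('e \<times> 'e \<Rightarrow> real) \<Rightarrow> 'e::euclidean_space \<times> 'e \<Rightarrow> 'e \<times> 'e \<Rightarrow> bool" where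
  "euler_lagrange_at f z v \<longleftrightarrow> (\<forall>w. fderiv (\<lambda>z. fderiv f z (0, w)) z v = fderiv f z (w, 0))"

lemma local_energy_has_derivative:
  assumes "open S" "smooth_on S f" "z \<in> S"
  shows "(local_energy f has_derivative
    (\<lambda>v. fderiv (\<lambda>z'. fderiv f z' (0, snd z)) z v + fderiv f z (0, snd v) - fderiv f z v)) (at z)"
proof -
  have "((\<lambda>z. fderiv f z (0, snd z) - f z) has_derivative
    (\<lambda>v. fderiv (\<lambda>z'. fderiv f z' (0, snd z)) z v + fderiv f z (0, snd v) - fderiv f z v)) (at z)"
    by (intro has_derivative_diff fderiv_compose_has_derivative[OF assms(1,2), where g = "\<lambda>x. x"]
        smooth_on_has_derivative[OF assms(2,3)] has_derivative_ident has_derivative_Pair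
        has_derivative_const has_derivative_snd eventually_nhds_in_open assms)
  then show ?thesis by (simp add: local_energy_def[abs_def])
qed

lemmas local_energy_differentiable = differentiableI[OF local_energy_has_derivative]

text \<open>On vertical vectors the first-order terms in the derivative of the energy cancel, which
  ties the energy to the convexity of \<open>f\<close>.\<close>

lemma local_energy_vertical:
  assumes "open S" "smooth_on S f" "z \<in> S"
  shows "fderiv (local_energy f) z (0, b) = vertical_hessian f z b (snd z)"
  using fderiv_eq[OF local_energy_has_derivative[OF assms], of "(0, b)"] by simp

text \<open>The terms with the vertical part of \<open>v\<close> cancel, and the Euler-Lagrange
  equation in the direction \<open>snd z\<close> cancels the rest.\<close>

lemma local_energy_conserved:
  assumes "open S" "smooth_on S f" "z \<in> S" "euler_lagrange_at f z v" "fst v = snd z"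
  shows "fderiv (local_energy f) z v = 0"
proof -
  have "fderiv f z v = fderiv f z (fst v, 0) + fderiv f z (0, snd v)"
    using linear_add[OF linear_fderiv[OF assms(2,3)], of "(fst v, 0)" "(0, snd v)"] by simp
  then show ?thesis
    using fderiv_eq[OF local_energy_has_derivative[OF assms(1-3)], of v] assms(4,5)
    by (simp add: euler_lagrange_at_def)
qed

lemma vertical_path_has_derivative: "((\<lambda>r. (x, r *\<^sub>R y)) has_vector_derivative (0, y)) (at r)"
  by (auto intro!: derivative_eq_intros simp: has_vector_derivative_def)

text \<open>Along the ray the derivative of the energy is \<open>r\<close> times the Hessian applied
  to \<open>y\<close> twice.\<close>

lemma local_energy_ray_mono:
  assumes "open S" "smooth_on S f" "\<And>z w. z \<in> S \<Longrightarrow> w \<noteq> 0 \<Longrightarrow> vertical_hessian f z w w > 0"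
    and "y \<noteq> 0" "0 \<le> s" "s < t" "\<And>r. s \<le> r \<Longrightarrow> r \<le> t \<Longrightarrow> (x, r *\<^sub>R y) \<in> S"
  shows "local_energy f (x, s *\<^sub>R y) < local_energy f (x, t *\<^sub>R y)"
proof -
  have der: "((\<lambda>r. local_energy f (x, r *\<^sub>R y)) has_real_derivative r * vertical_hessian f (x, r *\<^sub>R y) y y) (at r)"
    if "s \<le> r" "r \<le> t" for r
  proof -
    have "((\<lambda>r. local_energy f (x, r *\<^sub>R y)) has_vector_derivative fderiv (local_energy f) (x, r *\<^sub>R y) (0, y)) (at r)"
      by (intro has_vector_derivative_compose[OF vertical_path_has_derivative]
          local_energy_differentiable[OF assms(1,2)] assms(7) that)
    also have "fderiv (local_energy f) (x, r *\<^sub>R y) (0, y) = vertical_hessian f (x, r *\<^sub>R y) y (r *\<^sub>R y)"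
      using that assms by (simp add: local_energy_vertical)
    also have "\<dots> = r * vertical_hessian f (x, r *\<^sub>R y) y y"
      using linear_scale[OF linear_second_fderiv[OF assms(1,2) assms(7)[OF that]], of r "(0, y)" "(0, y)"] by simp
    finally show ?thesis by (simp add: has_real_derivative_iff_has_vector_derivative)
  qed
  show ?thesis
  \<comment> \<open>For \<open>s = 0\<close> the derivative vanishes at the left end, hence the
    version that asks for positivity in the open interval only.\<close>
  proof (rule DERIV_pos_imp_increasing_open[OF assms(6)])
    fix r assume "s < r" "r < t"
    then show "\<exists>d. ((\<lambda>r. local_energy f (x, r *\<^sub>R y)) has_real_derivative d) (at r) \<and> d > 0"
      using der[of r] assms(3)[OF assms(7)[of r] assms(4)] assms(5) by fastforce
  next
    show "continuous_on {s..t} (\<lambda>r. local_energy f (x, r *\<^sub>R y))"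
      by (intro continuous_at_imp_continuous_on ballI DERIV_isCont[OF der]) auto
  qed
qed

text \<open>The situation in one natural chart: \<open>V\<close> is the image of
  \<open>over U W\<close>, hence free of zero vectors, and \<phi> is the expression of
  \<open>f\<close> on the base.\<close>

locale local_fixed_energy =
  fixes V :: "('e::euclidean_space \<times> 'e) set" and l \<iota> :: "'e \<times> 'e \<Rightarrow> real" and e :: real
    and N :: "'e set" and \<phi> :: "'e \<Rightarrow> real"
  assumes open_V: "open V"
    and cone: "z \<in> V \<Longrightarrow> 0 < s \<Longrightarrow> (fst z, s *\<^sub>R snd z) \<in> V"
    and slit: "z \<in> V \<Longrightarrow> snd z \<noteq> 0"
    and smooth_l: "smooth_on V l" and smooth_\<iota>: "smooth_on V \<iota>"
    and \<iota>_pos: "z \<in> V \<Longrightarrow> \<iota> z > 0"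
    and convex: "z \<in> V \<Longrightarrow> w \<noteq> 0 \<Longrightarrow> vertical_hessian l z w w > 0"
    and energy: "z \<in> V \<Longrightarrow> local_energy l (fst z, (1 / \<iota> z) *\<^sub>R snd z) = e"
    and open_N: "open N" and smooth_\<phi>: "smooth_on N \<phi>" and V_over_N: "z \<in> V \<Longrightarrow> fst z \<in> N"
begin

definition \<rho> :: "'e \<times> 'e \<Rightarrow> 'e \<times> 'e" where
  "\<rho> z = (fst z, (1 / \<iota> z) *\<^sub>R snd z)"

definition F :: "'e \<times> 'e \<Rightarrow> real" where
  "F z = \<iota> z * (l (\<rho> z) + e) + fderiv \<phi> (fst z) (snd z)"

lemma \<rho>_mem: "z \<in> V \<Longrightarrow> \<rho> z \<in> V"
  using cone \<iota>_pos by (simp add: \<rho>_def)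

text \<open>The energy is strictly monotone along rays, and the segment between two positive
  multiples of a vector stays in \<open>V\<close>.\<close>

lemma ray_unique:
  assumes "z \<in> V" "s > 0" "t > 0"
    "local_energy l (fst z, s *\<^sub>R snd z) = local_energy l (fst z, t *\<^sub>R snd z)"
  shows "s = t"
proof -
  have False if "0 < s" "s < t"
    "local_energy l (fst z, s *\<^sub>R snd z) = local_energy l (fst z, t *\<^sub>R snd z)" for s t
    using local_energy_ray_mono[OF open_V smooth_l convex slit[OF assms(1)], of s t "fst z"] that
      cone[OF assms(1)] by auto
  then show ?thesis using assms by (metis linorder_neqE_linordered_idom)
qed

text \<open>Both \<open>1 / \<iota> (x, y)\<close> and \<open>s / \<iota> (x, s y)\<close> scale
  \<open>y\<close> to energy \<open>e\<close>, so they coincide.\<close>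

lemma \<iota>_homogeneous:
  assumes "z \<in> V" "s > 0"
  shows "\<iota> (fst z, s *\<^sub>R snd z) = s * \<iota> z"
proof -
  have "1 / \<iota> (fst z, s *\<^sub>R snd z) * s = 1 / \<iota> z"
    using ray_unique[OF assms(1), of "1 / \<iota> (fst z, s *\<^sub>R snd z) * s" "1 / \<iota> z"]
      energy[OF assms(1)] energy[OF cone[OF assms]] \<iota>_pos[OF assms(1)] \<iota>_pos[OF cone[OF assms]] assms
    by simp
  then show ?thesis using \<iota>_pos[OF assms(1)] \<iota>_pos[OF cone[OF assms]] by (simp add: field_simps)
qed

lemma energy_level_iff:
  assumes "z \<in> V" shows "local_energy l z = e \<longleftrightarrow> \<iota> z = 1"
proof
  assume "local_energy l z = e"
  then have "1 / \<iota> z = 1"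
    using ray_unique[OF assms, of "1 / \<iota> z" 1] energy[OF assms] \<iota>_pos[OF assms] by simp
  then show "\<iota> z = 1" by simp
next
  assume "\<iota> z = 1"
  then show "local_energy l z = e" using energy[OF assms] by simp
qed

lemma \<rho>_has_derivative:
  assumes "z \<in> V"
  shows "(\<rho> has_derivative (\<lambda>v. (fst v, (1 / \<iota> z) *\<^sub>R snd v - (fderiv \<iota> z v / (\<iota> z)\<^sup>2) *\<^sub>R snd z))) (at z)"
proof -
  have "((\<lambda>z. (fst z, (1 / \<iota> z) *\<^sub>R snd z)) has_derivative
      (\<lambda>v. (fst v, (1 / \<iota> z) *\<^sub>R snd v - (fderiv \<iota> z v / (\<iota> z)\<^sup>2) *\<^sub>R snd z))) (at z)"
  proof (rule has_derivative_Pair[OF has_derivative_fst[OF has_derivative_ident]])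
    have "((\<lambda>z. 1 / \<iota> z) has_derivative (\<lambda>v. - (fderiv \<iota> z v / (\<iota> z)\<^sup>2))) (at z)"
      using has_derivative_divide[OF has_derivative_const[of 1] smooth_on_has_derivative[OF smooth_\<iota> assms]]
        \<iota>_pos[OF assms] by (simp add: power2_eq_square divide_inverse mult_ac)
    from has_derivative_scaleR[OF this has_derivative_snd[OF has_derivative_ident]]
    show "((\<lambda>z. (1 / \<iota> z) *\<^sub>R snd z) has_derivative
        (\<lambda>v. (1 / \<iota> z) *\<^sub>R snd v - (fderiv \<iota> z v / (\<iota> z)\<^sup>2) *\<^sub>R snd z)) (at z)" by simp
  qed
  then show ?thesis by (simp add: \<rho>_def[abs_def])
qed

lemma fderiv_\<rho>:
  "z \<in> V \<Longrightarrow> fderiv \<rho> z v = (fst v, (1 / \<iota> z) *\<^sub>R snd v - (fderiv \<iota> z v / (\<iota> z)\<^sup>2) *\<^sub>R snd z)"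
  by (rule fderiv_eq[OF \<rho>_has_derivative])

lemma smooth_\<rho>: "smooth_on V \<rho>"
proof -
  have "smooth_on V (\<lambda>z. (fst z, inverse (\<iota> z) *\<^sub>R snd z))"
    using \<iota>_pos by (intro smooth_on_Pair smooth_on_scaleR smooth_on_inverse smooth_on_fst smooth_on_snd
        open_V smooth_\<iota>) force
  then show ?thesis by (simp add: \<rho>_def[abs_def] divide_inverse)
qed

lemma smooth_F: "smooth_on V F"
proof -
  have "smooth_on V (\<lambda>z. \<iota> z * (l (\<rho> z) + e) + fderiv \<phi> (fst z) (snd z))"
    using V_over_N \<rho>_mem
    by (intro smooth_on_add smooth_on_mult open_V smooth_\<iota> smooth_on_const smooth_on_fst smooth_on_snd
        smooth_on_compose[OF open_V _ smooth_l smooth_\<rho>] smooth_on_fderiv_compose[OF open_V _ smooth_\<phi>]) auto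
  then show ?thesis by (simp add: F_def[abs_def])
qed

lemma l_plus_e: "z \<in> V \<Longrightarrow> l (\<rho> z) + e = fderiv l (\<rho> z) (0, (1 / \<iota> z) *\<^sub>R snd z)"
  using energy[of z] by (simp add: local_energy_def \<rho>_def)

text \<open>The derivatives of \<open>\<iota>\<close> cancel: they occur with the factor \<open>l + e\<close> minus the vertical
  derivative of \<open>l\<close>, which vanishes on the energy level.\<close>

lemma fderiv_F:
  assumes "z \<in> V"
  shows "fderiv F z v = fderiv l (\<rho> z) (\<iota> z *\<^sub>R fst v, snd v)
    + fderiv (\<lambda>x. fderiv \<phi> x (snd z)) (fst z) (fst v) + fderiv \<phi> (fst z) (snd v)"
proof -
  have lin: "linear (fderiv l (\<rho> z))" by (rule linear_fderiv[OF smooth_l \<rho>_mem[OF assms]])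
  have ev: "\<forall>\<^sub>F z' in nhds z. fst z' \<in> N"
    using eventually_nhds_in_open[OF open_V assms] by eventually_elim (rule V_over_N)
  have "(F has_derivative (\<lambda>v. \<iota> z * fderiv l (\<rho> z) (fderiv \<rho> z v) + fderiv \<iota> z v * (l (\<rho> z) + e)
     + (fderiv (\<lambda>x. fderiv \<phi> x (snd z)) (fst z) (fst v) + fderiv \<phi> (fst z) (snd v)))) (at z)"
    unfolding F_def[abs_def]
  proof (rule has_derivative_add[OF _ fderiv_compose_has_derivative[OF open_N smooth_\<phi> ev]])
    have "((\<lambda>z. l (\<rho> z) + e) has_derivative (\<lambda>v. fderiv l (\<rho> z) (fderiv \<rho> z v))) (at z)"
      using has_derivative_add[OF has_derivative_compose[OF smooth_on_has_derivative[OF smooth_\<rho> assms]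
            smooth_on_has_derivative[OF smooth_l \<rho>_mem[OF assms]]] has_derivative_const[of e]] by simp
    from has_derivative_mult[OF smooth_on_has_derivative[OF smooth_\<iota> assms] this]
    show "((\<lambda>z. \<iota> z * (l (\<rho> z) + e)) has_derivative (\<lambda>v. \<iota> z * fderiv l (\<rho> z) (fderiv \<rho> z v)
        + fderiv \<iota> z v * (l (\<rho> z) + e))) (at z)" .
  qed (auto intro!: derivative_eq_intros)
  from fderiv_eq[OF this, of v]
  have "fderiv F z v = \<iota> z * fderiv l (\<rho> z) (fderiv \<rho> z v) + fderiv \<iota> z v * (l (\<rho> z) + e)
     + (fderiv (\<lambda>x. fderiv \<phi> x (snd z)) (fst z) (fst v) + fderiv \<phi> (fst z) (snd v))" .
  moreover have "\<iota> z * fderiv l (\<rho> z) (fderiv \<rho> z v) + fderiv \<iota> z v * (l (\<rho> z) + e)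
    = fderiv l (\<rho> z) (\<iota> z *\<^sub>R fst v, snd v)"
  proof -
    have "\<iota> z * fderiv l (\<rho> z) (fderiv \<rho> z v) + fderiv \<iota> z v * (l (\<rho> z) + e)
      = fderiv l (\<rho> z) (\<iota> z *\<^sub>R fderiv \<rho> z v + fderiv \<iota> z v *\<^sub>R (0, (1 / \<iota> z) *\<^sub>R snd z))"
      unfolding linear_add[OF lin] linear_scale[OF lin] l_plus_e[OF assms] by simp
    also have "\<iota> z *\<^sub>R fderiv \<rho> z v + fderiv \<iota> z v *\<^sub>R (0, (1 / \<iota> z) *\<^sub>R snd z) = (\<iota> z *\<^sub>R fst v, snd v)"
      using \<iota>_pos[OF assms] by (simp add: fderiv_\<rho>[OF assms] algebra_simps power2_eq_square)
    finally show ?thesis .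
  qed
  ultimately show ?thesis by simp
qed

lemma fderiv_F_vertical: "z \<in> V \<Longrightarrow> fderiv F z (0, w) = fderiv l (\<rho> z) (0, w) + fderiv \<phi> (fst z) w"
  using linear_0[OF linear_fderiv[OF smooth_on_fderiv[OF smooth_\<phi>] V_over_N]] by (simp add: fderiv_F)

lemma F_homogeneous:
  assumes "z \<in> V" shows "fderiv F z (0, snd z) = F z"
proof -
  have "fderiv l (\<rho> z) (0, snd z) = \<iota> z * fderiv l (\<rho> z) (0, (1 / \<iota> z) *\<^sub>R snd z)"
    using linear_scale[OF linear_fderiv[OF smooth_l \<rho>_mem[OF assms]], of "\<iota> z" "(0, (1 / \<iota> z) *\<^sub>R snd z)"]
      \<iota>_pos[OF assms] by simp
  then show ?thesis using assms by (simp add: fderiv_F_vertical F_def l_plus_e)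
qed

text \<open>Up to the term with \<phi>, the vertical derivative of \<open>F\<close> is that of
  \<open>l\<close> composed with \<rho>; so the chain rule suffices and no second derivative of
  \<iota> appears.\<close>

lemma second_fderiv_F:
  assumes "z \<in> V"
  shows "fderiv (\<lambda>z. fderiv F z (0, w)) z v
    = fderiv (\<lambda>z. fderiv l z (0, w)) (\<rho> z) (fderiv \<rho> z v) + fderiv (\<lambda>x. fderiv \<phi> x w) (fst z) (fst v)"
proof -
  have "fderiv (\<lambda>z. fderiv F z (0, w)) z v = fderiv (\<lambda>z. fderiv l (\<rho> z) (0, w) + fderiv \<phi> (fst z) w) z v"
    using fderiv_F_vertical by (subst fderiv_cong[OF open_V assms]) auto
  also have "\<dots> = fderiv (\<lambda>z. fderiv l z (0, w)) (\<rho> z) (fderiv \<rho> z v) + fderiv (\<lambda>x. fderiv \<phi> x w) (fst z) (fst v)"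
    by (rule fderiv_eq) (intro has_derivative_add
        has_derivative_compose[OF smooth_on_has_derivative[OF smooth_\<rho> assms], where g = "\<lambda>z. fderiv l z (0, w)"]
        has_derivative_compose[where f = fst and g = "\<lambda>x. fderiv \<phi> x w"]
        smooth_on_has_derivative[OF smooth_on_fderiv[OF smooth_l] \<rho>_mem[OF assms]]
        smooth_on_has_derivative[OF smooth_on_fderiv[OF smooth_\<phi>] V_over_N[OF assms]]
        has_derivative_fst has_derivative_ident)
  finally show ?thesis .
qed

text \<open>The energy relation, differentiated once. It drives both the Hessian formula and the
  vanishing of the derivative of \<iota> along the extended field.\<close>

lemma energy_constant:
  assumes "z \<in> V" shows "fderiv (local_energy l) (\<rho> z) (fderiv \<rho> z v) = 0"
proof -
  have "fderiv (local_energy l) (\<rho> z) (fderiv \<rho> z v) = fderiv (\<lambda>z. local_energy l (\<rho> z)) z v"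
    by (intro fderiv_compose[symmetric] smooth_on_differentiable[OF smooth_\<rho> assms]
        local_energy_differentiable[OF open_V smooth_l \<rho>_mem[OF assms]])
  also have "\<dots> = fderiv (\<lambda>z. e) z v"
    by (subst fderiv_cong[OF open_V assms]) (use energy in \<open>auto simp: \<rho>_def\<close>)
  finally show ?thesis by simp
qed

lemma fderiv_\<iota>_vertical:
  assumes "z \<in> V" shows "fderiv \<iota> z (0, snd z) = \<iota> z"
proof -
  have "((\<lambda>s. \<iota> (fst z, s *\<^sub>R snd z)) has_vector_derivative fderiv \<iota> (fst z, 1 *\<^sub>R snd z) (0, snd z)) (at 1)"
    using smooth_on_differentiable[OF smooth_\<iota> assms]
    by (intro has_vector_derivative_compose[OF vertical_path_has_derivative]) simp
  moreover have "\<forall>\<^sub>F s in nhds 1. \<iota> (fst z, s *\<^sub>R snd z) = s * \<iota> z"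
    using eventually_nhds_in_open[of "{0<..}" "1::real"]
    by (auto elim!: eventually_mono simp: \<iota>_homogeneous[OF assms])
  ultimately have "((\<lambda>s. s * \<iota> z) has_vector_derivative fderiv \<iota> z (0, snd z)) (at 1)"
    by simp (rule has_vector_derivative_cong_eventually)
  moreover have "((\<lambda>s. s * \<iota> z) has_vector_derivative \<iota> z) (at 1)"
    by (auto intro!: derivative_eq_intros simp: has_vector_derivative_def)
  ultimately show ?thesis by (rule vector_derivative_unique_at)
qed

text \<open>\<rho> is invariant under positive fibre scaling, so its derivative in the radial
  direction is zero.\<close>

lemma second_fderiv_F_radial:
  assumes "z \<in> V" shows "vertical_hessian F z (snd z) w = 0"
proof -
  have "fderiv \<rho> z (0, snd z) = 0"
    using \<iota>_pos[OF assms] by (simp add: fderiv_\<rho>[OF assms] fderiv_\<iota>_vertical[OF assms] power2_eq_square zero_prod_def)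
  moreover have "linear (fderiv (\<lambda>z. fderiv l z (0, w)) (\<rho> z))" "linear (fderiv (\<lambda>x. fderiv \<phi> x w) (fst z))"
    by (rule linear_fderiv[OF smooth_on_fderiv[OF smooth_l] \<rho>_mem[OF assms]]
        linear_fderiv[OF smooth_on_fderiv[OF smooth_\<phi>] V_over_N[OF assms]])+
  ultimately show ?thesis by (simp add: second_fderiv_F[OF assms] linear_0)
qed

text \<open>Differentiating the energy relation along \<open>(0, w)\<close> shows that the vector \<open>u\<close> is orthogonal to
  the fibre coordinate with respect to the Hessian of \<open>l\<close>, whence no Cauchy--Schwarz inequality is needed.\<close>

lemma vertical_hessian_F:
  assumes "z \<in> V"
  defines "u \<equiv> \<lambda>w. w - (fderiv \<iota> z (0, w) / \<iota> z) *\<^sub>R snd z"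
  shows "vertical_hessian F z w w = vertical_hessian l (\<rho> z) (u w) (u w) / \<iota> z"
proof -
  note pos = \<iota>_pos[OF assms(1)]
  let ?B = "vertical_hessian l (\<rho> z)"
  define y where "y = snd z"
  have l1: "linear (?B b)" for b
    using linear_compose[OF _ linear_second_fderiv[OF open_V smooth_l \<rho>_mem[OF assms(1)], of "(0, b)"], of "\<lambda>w. (0, w)"]
    by (simp add: o_def linear_iff)
  have l2: "linear (fderiv (\<lambda>z. fderiv l z (0, w)) (\<rho> z))" for w
    by (rule linear_fderiv[OF smooth_on_fderiv[OF smooth_l] \<rho>_mem[OF assms(1)]])
  have \<rho>w: "fderiv \<rho> z (0, w) = (1 / \<iota> z) *\<^sub>R (0, u w)"
    using pos by (simp add: fderiv_\<rho>[OF assms(1)] u_def scaleR_diff_right power2_eq_square)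
  have B: "fderiv (\<lambda>z. fderiv l z (0, w')) (\<rho> z) (fderiv \<rho> z (0, w)) = ?B (u w) w' / \<iota> z" for w'
    unfolding \<rho>w linear_scale[OF l2] by simp
  have "?B (u w) (snd (\<rho> z)) = 0"
  proof -
    have lin: "linear (fderiv (local_energy l) (\<rho> z))"
      by (intro linear_frechet_derivative local_energy_differentiable[OF open_V smooth_l \<rho>_mem[OF assms(1)]])
    have "(1 / \<iota> z) * fderiv (local_energy l) (\<rho> z) (0, u w) = 0"
      using energy_constant[OF assms(1), of "(0, w)"] unfolding \<rho>w linear_scale[OF lin] by simp
    then show ?thesis
      using pos local_energy_vertical[OF open_V smooth_l \<rho>_mem[OF assms(1)], of "u w"] by simp
  qed
  then have "?B (u w) (snd z) = 0"
    using linear_scale[OF l1, of "1 / \<iota> z" "snd z" "u w"] pos by (simp add: \<rho>_def)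
  \<comment> \<open>\<open>w\<close> differs from \<open>u w\<close> by a radial vector, which is
    orthogonal to \<open>u w\<close>.\<close>
  then have "?B (u w) (u w + (fderiv \<iota> z (0, w) / \<iota> z) *\<^sub>R snd z) = ?B (u w) (u w)"
    unfolding linear_add[OF l1] linear_scale[OF l1] by simp
  then have "?B (u w) w = ?B (u w) (u w)"
    by (simp add: u_def)
  moreover have "linear (fderiv (\<lambda>x. fderiv \<phi> x w) (fst z))"
    by (rule linear_fderiv[OF smooth_on_fderiv[OF smooth_\<phi>] V_over_N[OF assms(1)]])
  ultimately show ?thesis
    by (simp add: second_fderiv_F[OF assms(1)] B linear_0)
qed

text \<open>The vector \<open>v\<close> is the homogeneous extension of the Lagrangian vector field from the energy level.\<close>

lemma homogeneous_extension:
  assumes "z \<in> V" and g: "euler_lagrange_at l (\<rho> z) g" "fst g = snd (\<rho> z)"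
  defines "v \<equiv> (\<iota> z *\<^sub>R fst g, (\<iota> z)\<^sup>2 *\<^sub>R snd g)"
  shows "fderiv \<iota> z v = 0" and "euler_lagrange_at F z v"
proof -
  note pos = \<iota>_pos[OF assms(1)] and \<rho> = \<rho>_mem[OF assms(1)]
  have linE: "linear (fderiv (local_energy l) (\<rho> z))"
    by (intro linear_frechet_derivative local_energy_differentiable[OF open_V smooth_l \<rho>])
  \<comment> \<open>Up to a radial error proportional to the derivative of \<iota> along
    \<open>v\<close>, the derivative of \<rho> maps \<open>v\<close> to a multiple of
    \<open>g\<close>.\<close>
  have \<rho>v: "fderiv \<rho> z v = \<iota> z *\<^sub>R g - (fderiv \<iota> z v / \<iota> z) *\<^sub>R (0, snd (\<rho> z))"
    using pos by (simp add: prod_eq_iff fderiv_\<rho>[OF assms(1)] v_def \<rho>_def power2_eq_square)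
  have "0 = fderiv (local_energy l) (\<rho> z) (fderiv \<rho> z v)"
    using energy_constant[OF assms(1)] by simp
  also have "\<dots> = \<iota> z * fderiv (local_energy l) (\<rho> z) g
      - (fderiv \<iota> z v / \<iota> z) * fderiv (local_energy l) (\<rho> z) (0, snd (\<rho> z))"
    unfolding \<rho>v linear_diff[OF linE] linear_scale[OF linE] by simp
  \<comment> \<open>Energy is conserved along \<open>g\<close>, while its radial derivative is a
    positive value of the Hessian; so the error must vanish.\<close>
  also have "\<dots> = - (fderiv \<iota> z v / \<iota> z) * vertical_hessian l (\<rho> z) (snd (\<rho> z)) (snd (\<rho> z))"
    using local_energy_conserved[OF open_V smooth_l \<rho> g] local_energy_vertical[OF open_V smooth_l \<rho>] by simp
  finally show \<iota>v: "fderiv \<iota> z v = 0"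
    using convex[OF \<rho> slit[OF \<rho>]] pos by simp
  show "euler_lagrange_at F z v"
    unfolding euler_lagrange_at_def
  proof
    fix w
    have lin: "linear (fderiv (\<lambda>z. fderiv l z (0, w)) (\<rho> z))" "linear (fderiv l (\<rho> z))" "linear (fderiv \<phi> (fst z))"
      by (rule linear_fderiv[OF smooth_on_fderiv[OF smooth_l] \<rho>] linear_fderiv[OF smooth_l \<rho>]
        linear_fderiv[OF smooth_\<phi> V_over_N[OF assms(1)]])+
    have fv: "fst v = snd z" using g(2) pos by (simp add: v_def \<rho>_def)
    have "fderiv (\<lambda>z. fderiv F z (0, w)) z v = \<iota> z * fderiv (\<lambda>z. fderiv l z (0, w)) (\<rho> z) g
        + fderiv (\<lambda>x. fderiv \<phi> x w) (fst z) (snd z)"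
      using \<rho>v linear_scale[OF lin(1)] by (simp add: second_fderiv_F[OF assms(1)] \<iota>v fv flip: zero_prod_def)
    \<comment> \<open>The total derivative contributes the same second derivative of \<phi> to both
      sides, with its two directions exchanged.\<close>
    also have "\<dots> = fderiv l (\<rho> z) (\<iota> z *\<^sub>R w, 0) + fderiv (\<lambda>x. fderiv \<phi> x (snd z)) (fst z) w"
      using g(1) linear_scale[OF lin(2), of "\<iota> z" "(w, 0)"]
        fderiv_commute[OF open_N smooth_\<phi> V_over_N[OF assms(1)], of w "snd z"]
      by (simp add: euler_lagrange_at_def)
    also have "\<dots> = fderiv F z (w, 0)"
      using linear_0[OF lin(3)] by (simp add: fderiv_F[OF assms(1)])
    finally show "fderiv (\<lambda>z. fderiv F z (0, w)) z v = fderiv F z (w, 0)" .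
  qed
qed

section \<open>The half square of \<open>F\<close>\<close>

lemma fderiv_half_square:
  assumes "z \<in> V" shows "fderiv (half_square F) z v = F z * fderiv F z v"
proof -
  have "((\<lambda>z. (1/2) * (F z)\<^sup>2) has_derivative (\<lambda>v. F z * fderiv F z v)) (at z)"
    using smooth_on_has_derivative[OF smooth_F assms] by (auto intro!: derivative_eq_intros)
  then show ?thesis by (simp add: half_square_def[abs_def] fderiv_eq)
qed

lemma second_fderiv_half_square:
  assumes "z \<in> V"
  shows "fderiv (\<lambda>z. fderiv (half_square F) z (0, w)) z v
    = F z * fderiv (\<lambda>z. fderiv F z (0, w)) z v + fderiv F z v * fderiv F z (0, w)"
proof -
  have "fderiv (\<lambda>z. fderiv (half_square F) z (0, w)) z v = fderiv (\<lambda>z. F z * fderiv F z (0, w)) z v"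
    using fderiv_half_square by (subst fderiv_cong[OF open_V assms]) auto
  also have "\<dots> = F z * fderiv (\<lambda>z. fderiv F z (0, w)) z v + fderiv F z v * fderiv F z (0, w)"
    by (rule fderiv_eq) (intro has_derivative_mult smooth_on_has_derivative[OF _ assms] smooth_F smooth_on_fderiv)
  finally show ?thesis .
qed

text \<open>The Hessian is \<open>F\<close> times that of \<open>F\<close> plus the square of the
  vertical derivative of \<open>F\<close>. The first summand vanishes only in radial directions,
  where homogeneity makes the second one positive.\<close>

lemma half_square_convex:
  assumes "z \<in> V" "F z > 0" "w \<noteq> 0"
  shows "vertical_hessian (half_square F) z w w > 0"
proof -
  define u where "u = w - (fderiv \<iota> z (0, w) / \<iota> z) *\<^sub>R snd z"
  note H = second_fderiv_half_square[OF assms(1)] vertical_hessian_F[OF assms(1), of w, folded u_def]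
  note pos = \<iota>_pos[OF assms(1)]
  show ?thesis
  proof (cases "u = 0")
    case True
    have "fderiv F z (0, w) = (fderiv \<iota> z (0, w) / \<iota> z) * F z"
      using True linear_scale[OF linear_fderiv[OF smooth_F assms(1)], of "fderiv \<iota> z (0, w) / \<iota> z" "(0, snd z)"]
        F_homogeneous[OF assms(1)] by (simp add: u_def)
    moreover have "fderiv \<iota> z (0, w) / \<iota> z \<noteq> 0" using True assms(3) by (auto simp: u_def)
    ultimately have "fderiv F z (0, w) \<noteq> 0" using assms(2) by simp
    moreover have "vertical_hessian l (\<rho> z) u u = 0"
      using True linear_0[OF linear_fderiv[OF smooth_on_fderiv[OF smooth_l] \<rho>_mem[OF assms(1)]]]
      by (simp flip: zero_prod_def)
    ultimately show ?thesis unfolding H by (simp add: power2_eq_square flip: zero_less_power2)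
  next
    case False
    then show ?thesis unfolding H
      using assms(2) pos convex[OF \<rho>_mem[OF assms(1)] False] by (intro add_pos_nonneg mult_pos_pos divide_pos_pos) auto
  qed
qed

text \<open>At a zero of \<open>F\<close> both summands vanish in the radial direction: one carries
  the factor \<open>F\<close>, the other the radial derivative of \<open>F\<close>, which is
  \<open>F\<close> again.\<close>

lemma regular_imp_nonzero:
  assumes "z \<in> V" "\<And>u. (\<And>w. vertical_hessian (half_square F) z u w = 0) \<Longrightarrow> u = 0"
  shows "F z \<noteq> 0"
proof
  assume "F z = 0"
  then have "vertical_hessian (half_square F) z (snd z) w = 0" for w
    by (simp add: second_fderiv_half_square[OF assms(1)] F_homogeneous[OF assms(1)])
  with assms slit show False by blast
qed

text \<open>The corrected vector annihilates \<open>F\<close>, which removes the extra product term.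
  The other term is unaffected, as radial vectors lie in the kernel of the Hessian of
  \<open>F\<close>.\<close>

lemma euler_lagrange_half_square:
  assumes "z \<in> V" "F z \<noteq> 0" "euler_lagrange_at F z v"
  shows "euler_lagrange_at (half_square F) z (v - (fderiv F z v / F z) *\<^sub>R (0, snd z))"
  unfolding euler_lagrange_at_def
proof
  fix w
  let ?v = "v - (fderiv F z v / F z) *\<^sub>R (0, snd z)"
  have lin: "linear (fderiv F z)" "linear (fderiv (\<lambda>z. fderiv F z (0, w)) z)"
    by (rule linear_fderiv[OF smooth_F assms(1)] linear_fderiv[OF smooth_on_fderiv[OF smooth_F] assms(1)])+
  have "fderiv F z ?v = 0"
    unfolding linear_diff[OF lin(1)] linear_scale[OF lin(1)] F_homogeneous[OF assms(1)] using assms(2) by simp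
  moreover have "fderiv (\<lambda>z. fderiv F z (0, w)) z ?v = fderiv F z (w, 0)"
    unfolding linear_diff[OF lin(2)] linear_scale[OF lin(2)] second_fderiv_F_radial[OF assms(1)]
    using assms(3) by (simp add: euler_lagrange_at_def)
  ultimately show "fderiv (\<lambda>z. fderiv (half_square F) z (0, w)) z ?v = fderiv (half_square F) z (w, 0)"
    by (simp add: second_fderiv_half_square[OF assms(1)] fderiv_half_square[OF assms(1)])
qed

end

section \<open>Positivity after adding a total derivative\<close>

lemma vertical_derivative_ray_mono:
  assumes "open S" "smooth_on S f" "\<And>z w. z \<in> S \<Longrightarrow> w \<noteq> 0 \<Longrightarrow> vertical_hessian f z w w > 0"
    and "y \<noteq> 0" "s < t" "\<And>r. s \<le> r \<Longrightarrow> r \<le> t \<Longrightarrow> (x, r *\<^sub>R y) \<in> S"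
  shows "fderiv f (x, s *\<^sub>R y) (0, y) < fderiv f (x, t *\<^sub>R y) (0, y)"
proof (rule DERIV_pos_imp_increasing[OF assms(5)])
  fix r assume r: "s \<le> r" "r \<le> t"
  have "((\<lambda>r. fderiv f (x, r *\<^sub>R y) (0, y)) has_vector_derivative vertical_hessian f (x, r *\<^sub>R y) y y) (at r)"
    by (rule has_vector_derivative_compose[OF vertical_path_has_derivative, where f = "\<lambda>z. fderiv f z (0, y)"])
      (use r assms in \<open>auto intro: smooth_on_differentiable[OF smooth_on_fderiv[OF assms(2)]]\<close>)
  then show "\<exists>d. ((\<lambda>r. fderiv f (x, r *\<^sub>R y) (0, y)) has_real_derivative d) (at r) \<and> d > 0"
    using assms(3)[OF assms(6)[OF r] assms(4)] by (auto simp: has_real_derivative_iff_has_vector_derivative)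
qed

text \<open>The vectors of energy \<open>e\<close> over a neighbourhood need not form a bounded set.
  But short vectors have smaller energy, so a ray passes a small sphere before it reaches the level;
  on that sphere compactness keeps the gap positive for nearby base points, and further out
  convexity only enlarges the derivative.\<close>

lemma vertical_derivative_gap:
  fixes f :: "'e::euclidean_space \<times> 'e \<Rightarrow> real"
  assumes "open N" "smooth_on (N \<times> UNIV) f" "x\<^sub>0 \<in> N"
    and conv: "\<And>z w. z \<in> N \<times> UNIV \<Longrightarrow> w \<noteq> 0 \<Longrightarrow> vertical_hessian f z w w > 0"
    and lt: "local_energy f (x\<^sub>0, 0) < e"
  obtains r where "r > 0" "ball x\<^sub>0 r \<subseteq> N"
    "\<And>x y. x \<in> ball x\<^sub>0 r \<Longrightarrow> local_energy f (x, y) = e \<Longrightarrow> fderiv f (x\<^sub>0, 0) (0, y) < fderiv f (x, y) (0, y)"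
proof -
  let ?S = "N \<times> (UNIV :: 'e set)"
  have oS: "open ?S" using assms(1) by (simp add: open_Times)
  have contE: "continuous_on ?S (local_energy f)"
    using local_energy_has_derivative[OF oS assms(2)]
    by (meson continuous_at_imp_continuous_on has_derivative_continuous)
  \<comment> \<open>The gap as a function of both variables. Over \<open>x\<^sub>0\<close> it is
    positive for nonzero \<open>y\<close>, being the growth of the radial derivative from the zero
    vector to \<open>y\<close>.\<close>
  define \<kappa> where "\<kappa> z = fderiv f z (0, snd z) - fderiv f (x\<^sub>0, 0) (0, snd z)" for z
  have cont\<kappa>: "continuous_on ?S \<kappa>"
  proof -
    have "linear (\<lambda>z::'e \<times> 'e. fderiv f (x\<^sub>0, 0) (0, snd z))"
      using linear_compose[OF _ linear_fderiv[OF assms(2), of "(x\<^sub>0, 0)"], of "\<lambda>z::'e \<times> 'e. (0, snd z)"] assms(3)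
      by (simp add: o_def linear_iff)
    then have "bounded_linear (\<lambda>z::'e \<times> 'e. fderiv f (x\<^sub>0, 0) (0, snd z))"
      by (simp add: linear_conv_bounded_linear)
    then have "smooth_on ?S \<kappa>"
      unfolding \<kappa>_def[abs_def]
      by (intro smooth_on_minus oS smooth_on_fderiv_compose[OF oS _ assms(2)] smooth_on_bounded_linear
          bounded_linear_ident bounded_linear_Pair bounded_linear_zero bounded_linear_snd) auto
    then show ?thesis by (rule smooth_on_continuous_on)
  qed
  have "open (?S \<inter> local_energy f -` {..<e})"
    by (rule continuous_open_preimage[OF contE oS]) simp
  moreover have "(x\<^sub>0, 0) \<in> ?S \<inter> local_energy f -` {..<e}" using lt assms(3) by simp
  ultimately obtain \<delta>0 where \<delta>0: "\<delta>0 > 0" "ball (x\<^sub>0, 0) \<delta>0 \<subseteq> ?S \<inter> local_energy f -` {..<e}"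
    using open_contains_ball by metis
  \<comment> \<open>Half the radius, since the distance in the product is bounded by the sum of base
    and fibre distances.\<close>
  define \<delta> where "\<delta> = \<delta>0 / 2"
  have \<delta>: "\<delta> > 0" using \<delta>0 by (simp add: \<delta>_def)
  have small: "local_energy f (x, y) < e" if "dist x\<^sub>0 x < \<delta>" "norm y < \<delta>" for x y
  proof -
    have "dist (x\<^sub>0, 0) (x, y) \<le> dist x\<^sub>0 x + norm y"
      using sqrt_sum_squares_le_sum_abs[of "dist x\<^sub>0 x" "norm y"] by (simp add: dist_Pair_Pair)
    also have "\<dots> < \<delta>0" using that by (simp add: \<delta>_def)
    finally show ?thesis using \<delta>0 by auto
  qed
  let ?K = "{x\<^sub>0} \<times> sphere (0::'e) \<delta>" and ?B = "?S \<inter> \<kappa> -` {0<..}"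
  have oB: "open ?B" by (rule continuous_open_preimage[OF cont\<kappa> oS]) simp
  have "?K \<subseteq> ?B"
  proof clarify
    fix y :: 'e assume "y \<in> sphere 0 \<delta>"
    then have "y \<noteq> 0" using \<delta> by auto
    then have "\<kappa> (x\<^sub>0, y) > 0"
      using vertical_derivative_ray_mono[OF oS assms(2) conv, of y 0 1 x\<^sub>0] assms(3) by (simp add: \<kappa>_def)
    then show "(x\<^sub>0, y) \<in> ?B" using assms(3) by simp
  qed
  moreover have "?K \<noteq> {}"
  proof -
    obtain b :: 'e where "b \<in> Basis" using nonempty_Basis by fastforce
    then have "(x\<^sub>0, \<delta> *\<^sub>R b) \<in> ?K" using \<delta> by simp
    then show ?thesis by blast
  qed
  moreover have "compact ?K" by (intro compact_Times) auto
  ultimately obtain \<epsilon> where \<epsilon>: "\<epsilon> > 0" "{z. infdist z ?K \<le> \<epsilon>} \<subseteq> ?B"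
    using compact_in_open_separated[of ?K ?B] oB by metis
  obtain r0 where r0: "r0 > 0" "ball x\<^sub>0 r0 \<subseteq> N" using assms(1,3) open_contains_ball by blast
  define r where "r = min r0 (min \<epsilon> \<delta>)"
  show ?thesis
  proof (rule that[of r])
    show "r > 0" "ball x\<^sub>0 r \<subseteq> N" using r0 \<epsilon> \<delta> by (auto simp: r_def)
    fix x y assume x: "x \<in> ball x\<^sub>0 r" and e: "local_energy f (x, y) = e"
    have xN: "x \<in> N" and d: "dist x\<^sub>0 x < \<delta>" "dist x\<^sub>0 x < \<epsilon>" using x r0 by (auto simp: r_def)
    have y: "norm y \<ge> \<delta>" using small[OF d(1)] e by force
    then have y0: "y \<noteq> 0" using \<delta> by auto
    \<comment> \<open>Shrinks \<open>y\<close> to the sphere of radius \<delta>; the factor is at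
      most 1 because shorter vectors have energy below \<open>e\<close>.\<close>
    define s where "s = \<delta> / norm y"
    have s: "0 < s" "s \<le> 1" "norm (s *\<^sub>R y) = \<delta>" using y y0 \<delta> by (auto simp: s_def)
    have "infdist (x, s *\<^sub>R y) ?K \<le> dist (x, s *\<^sub>R y) (x\<^sub>0, s *\<^sub>R y)"
      by (rule infdist_le) (use s in auto)
    also have "\<dots> \<le> \<epsilon>" using d by (simp add: dist_Pair_Pair dist_commute)
    finally have "\<kappa> (x, s *\<^sub>R y) > 0" using \<epsilon> by auto
    moreover have "\<kappa> (x, s *\<^sub>R y) = s * (fderiv f (x, s *\<^sub>R y) (0, y) - fderiv f (x\<^sub>0, 0) (0, y))"
      using linear_scale[OF linear_fderiv[OF assms(2), of "(x, s *\<^sub>R y)"], of s "(0, y)"]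
        linear_scale[OF linear_fderiv[OF assms(2), of "(x\<^sub>0, 0)"], of s "(0, y)"] xN assms(3)
      by (simp add: \<kappa>_def algebra_simps)
    ultimately have "fderiv f (x\<^sub>0, 0) (0, y) < fderiv f (x, s *\<^sub>R y) (0, y)"
      using s by (simp add: zero_less_mult_iff)
    also have "\<dots> \<le> fderiv f (x, 1 *\<^sub>R y) (0, y)"
      using vertical_derivative_ray_mono[OF oS assms(2) conv y0, of s 1 x] xN s by (cases "s = 1") auto
    finally show "fderiv f (x\<^sub>0, 0) (0, y) < fderiv f (x, y) (0, y)" by simp
  qed
qed

section \<open>Coordinate expressions of Lagrangian conditions\<close>

lemma linear_axis_expand:
  fixes h :: "real^'n \<Rightarrow> real"
  assumes "linear h" shows "h w = (\<Sum>i\<in>UNIV. w $ i * h (axis i 1))"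
proof -
  have "h w = h (\<Sum>i\<in>UNIV. w $ i *\<^sub>R axis i 1)"
    by (simp add: basis_expansion flip: scalar_mult_eq_scaleR)
  then show ?thesis by (simp add: linear_sum[OF assms] linear_scale[OF assms])
qed

context
  fixes S :: "((real^'n) \<times> (real^'n)) set" and g :: "(real^'n) \<times> (real^'n) \<Rightarrow> real" and z
  assumes S: "open S" "smooth_on S g" "z \<in> S"
begin

lemma linear_vertical: "linear (\<lambda>w. fderiv (\<lambda>z. fderiv g z v) z (0, w))"
  "linear (\<lambda>w. fderiv (\<lambda>z. fderiv g z (0, w)) z v)" "linear (\<lambda>w. fderiv g z (w, 0))"
proof -
  have 1: "linear (\<lambda>w::real^'n. (0::real^'n, w))" "linear (\<lambda>w::real^'n. (w, 0::real^'n))"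
    by (simp_all add: linear_iff)
  show "linear (\<lambda>w. fderiv (\<lambda>z. fderiv g z v) z (0, w))"
    using linear_compose[OF 1(1) linear_fderiv[OF smooth_on_fderiv[OF S(2)] S(3)]] by (simp add: o_def)
  show "linear (\<lambda>w. fderiv (\<lambda>z. fderiv g z (0, w)) z v)"
    using linear_compose[OF 1(1) linear_second_fderiv[OF S]] by (simp add: o_def)
  show "linear (\<lambda>w. fderiv g z (w, 0))"
    using linear_compose[OF 1(2) linear_fderiv[OF S(2,3)]] by (simp add: o_def)
qed

lemma fibre_hessian_inner: "w \<bullet> (fibre_hessian g z *v u) = vertical_hessian g z w u"
proof -
  have "vertical_hessian g z w u = (\<Sum>i\<in>UNIV. w $ i * vertical_hessian g z (axis i 1) u)"
    by (rule linear_axis_expand[OF linear_vertical(1)])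
  also have "\<dots> = (\<Sum>i\<in>UNIV. w $ i * (\<Sum>j\<in>UNIV. u $ j * vertical_hessian g z (axis i 1) (axis j 1)))"
    by (subst linear_axis_expand[OF linear_vertical(2), of u]) (rule refl)
  also have "\<dots> = w \<bullet> (fibre_hessian g z *v u)"
    by (simp add: inner_vec_def matrix_vector_mult_def fibre_hessian_def partial_y_def[abs_def] mult.commute)
  finally show ?thesis ..
qed

lemma euler_lagrange_at_iff:
  "(\<forall>i. fderiv (partial_y i g) z v - partial_x i g z = 0) \<longleftrightarrow> euler_lagrange_at g z v"
proof
  assume L: "\<forall>i. fderiv (partial_y i g) z v - partial_x i g z = 0"
  show "euler_lagrange_at g z v"
    unfolding euler_lagrange_at_def
  proof
    fix w
    show "fderiv (\<lambda>z. fderiv g z (0, w)) z v = fderiv g z (w, 0)"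
      using L unfolding linear_axis_expand[OF linear_vertical(2), of w v]
        linear_axis_expand[OF linear_vertical(3), of w]
      by (simp add: partial_y_def[abs_def] partial_x_def)
  qed
qed (simp add: euler_lagrange_at_def partial_y_def[abs_def] partial_x_def)

end

lemma invertible_hessian_imp:
  fixes H :: "real^'n^'n"
  assumes "invertible H" "\<And>w. u \<bullet> (H *v w) = 0" shows "u = 0"
proof -
  obtain H' where "H ** H' = mat 1" using assms(1) unfolding invertible_def by blast
  then have "H *v (H' *v u) = u" by (simp add: matrix_vector_mul_assoc)
  then show ?thesis using assms(2)[of "H' *v u"] by simp
qed

lemma second_fderiv_cong:
  assumes "open S" "z \<in> S" "\<And>x. x \<in> S \<Longrightarrow> f x = g x"
  shows "fderiv (\<lambda>z. fderiv f z u) z v = fderiv (\<lambda>z. fderiv g z u) z v"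
proof -
  have "fderiv f y u = fderiv g y u" if "y \<in> S" for y
    using fderiv_cong[OF assms(1) that assms(3)] by simp
  then show ?thesis
    using fderiv_cong[OF assms(1,2), of "\<lambda>z. fderiv f z u" "\<lambda>z. fderiv g z u"] by simp
qed

lemma euler_lagrange_at_cong:
  assumes "open S" "z \<in> S" "\<And>x. x \<in> S \<Longrightarrow> f x = g x"
  shows "euler_lagrange_at f z v = euler_lagrange_at g z v"
  unfolding euler_lagrange_at_def
  using second_fderiv_cong[OF assms] fderiv_cong[OF assms(1,2), of f g] assms(3) by simp

section \<open>Homogeneous functions and sprays\<close>

definition cone :: "('q, 'e::euclidean_space) tangent set \<Rightarrow> bool" where
  "cone V \<longleftrightarrow> (\<forall>p\<in>V. \<forall>s>0. scale s p \<in> V)"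

lemma coneD: "cone V \<Longrightarrow> p \<in> V \<Longrightarrow> s > 0 \<Longrightarrow> scale s p \<in> V"
  by (simp add: cone_def)

context base_atlas
begin

text \<open>The factor \<open>1 / r\<close> compensates that the Liouville field at
  \<open>scale r p\<close> has fibre component \<open>r y\<close>.\<close>

lemma scale_curve_has_velocity:
  assumes p: "p \<in> tangent_bundle A" and r: "r > 0"
  shows "has_velocity (tangent_atlas A) (\<lambda>s. scale s p) (\<lambda>C. (1 / r) *\<^sub>R liouville A (scale r p) C) r"
proof -
  obtain C where C: "C \<in> tangent_atlas A" "p \<in> chart_dom C" using p by (rule tangent_bundle_chart)
  show ?thesis
  proof (rule tm.has_velocityI[OF C(1)])
    show "scale r p \<in> chart_dom C" using C by (rule scale_mem_chart_dom)
    show "\<forall>\<^sub>F s in nhds r. scale s p \<in> chart_dom C" using C by (simp add: scale_mem_chart_dom)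
    show "((\<lambda>s. coords C (scale s p)) has_vector_derivative (1 / r) *\<^sub>R liouville A (scale r p) C) (at r)"
      using r vertical_path_has_derivative[of "fst (coords C p)" "snd (coords C p)" r]
      by (simp add: coords_scale[OF C(1)] liouville_chart[OF C(1) scale_mem_chart_dom[OF C]])
  qed (intro tm.tangent_space_scaleR liouville_tangent)
qed

lemma scale_deriv:
  assumes "smooth_fun (tangent_atlas A) V g" "atlas_open (tangent_atlas A) V" "cone V" "p \<in> V" "r > 0"
  shows "((\<lambda>s. g (scale s p)) has_real_derivative
     dir_deriv (tangent_atlas A) g (scale r p) (liouville A (scale r p)) / r) (at r)"
proof -
  have p: "p \<in> tangent_bundle A"
    using assms(2,4) points_tangent_atlas by (auto simp: atlas_open_def)
  have sp: "scale r p \<in> V" using assms by (simp add: cone_def)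
  have "dir_deriv (tangent_atlas A) g (scale r p) (\<lambda>C. (1 / r) *\<^sub>R liouville A (scale r p) C)
     = dir_deriv (tangent_atlas A) g (scale r p) (liouville A (scale r p)) / r"
    using tm.dir_deriv_add_scaleR[OF assms(1) sp assms(2) liouville_tangent liouville_tangent, of "1 / r - 1"]
    by (simp add: algebra_simps diff_divide_distrib)
  then show ?thesis
    using tm.has_velocity_fun[OF assms(1) sp scale_curve_has_velocity[OF p assms(5)]] by simp
qed

lemma one_homogeneousI:
  assumes "smooth_fun (tangent_atlas A) V g" "atlas_open (tangent_atlas A) V" "cone V"
    and g: "\<And>p s. p \<in> V \<Longrightarrow> s > 0 \<Longrightarrow> g (scale s p) = s * g p"
  shows "one_homogeneous A V g"
  unfolding one_homogeneous_def
proof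
  fix p assume p: "p \<in> V"
  have "((\<lambda>s. s * g p) has_real_derivative dir_deriv (tangent_atlas A) g p (liouville A p)) (at 1)"
    using scale_deriv[OF assms(1-3) p, of 1]
    by (rule DERIV_cong_ev[THEN iffD1, rotated 3])
      (auto simp: g[OF p] eventually_nhds intro!: exI[of _ "{0<..}"])
  moreover have "((\<lambda>s. s * g p) has_real_derivative g p) (at 1)"
    by (auto intro!: derivative_eq_intros)
  ultimately show "dir_deriv (tangent_atlas A) g p (liouville A p) = g p"
    by (rule DERIV_unique)
qed

text \<open>Euler's relation makes the derivative of \<open>g (scale s p) / s\<close> vanish for
  positive \<open>s\<close>, so this quotient keeps its value at 1.\<close>

lemma one_homogeneousD:
  assumes "smooth_fun (tangent_atlas A) V g" "atlas_open (tangent_atlas A) V" "cone V"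
    and "one_homogeneous A V g" "p \<in> V" "s > 0"
  shows "g (scale s p) = s * g p"
proof -
  have "((\<lambda>s. g (scale s p) / s) has_real_derivative 0) (at r within {0<..})" if "r \<in> {0<..}" for r
  proof -
    have "((\<lambda>s. g (scale s p)) has_real_derivative g (scale r p) / r) (at r)"
      using scale_deriv[OF assms(1-3,5), of r] that assms(4) coneD[OF assms(3,5), of r]
      by (simp add: one_homogeneous_def)
    then have "((\<lambda>s. g (scale s p) / s) has_real_derivative 0) (at r)"
      using that by (auto intro!: derivative_eq_intros)
    then show ?thesis by (rule DERIV_subset) simp
  qed
  then have "\<exists>c. \<forall>r\<in>{0<..}. g (scale r p) / r = c"
    by (rule has_field_derivative_zero_constant[OF convex_real_interval(3)])
  then obtain c where c: "\<And>r. r > 0 \<Longrightarrow> g (scale r p) / r = c" by auto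
  have "g (scale s p) / s = g (scale 1 p) / 1" using c[OF assms(6)] c[of 1] by simp
  then show ?thesis using assms(6) by (simp add: field_simps)
qed

text \<open>The scaling rule is the integrated form of the bracket relation. Its derivative at
  \<open>s = 1\<close> is \<open>(X\<^sub>1, 2 X\<^sub>2)\<close>, and the derivative of the
  Liouville field along \<open>X\<close> subtracts \<open>(0, X\<^sub>2)\<close>.\<close>

lemma quadratic_imp_spray:
  assumes "atlas_open (tangent_atlas A) V" "cone V" "V \<subseteq> slit_tangent_bundle A" "second_order A V X"
    and X: "\<And>p s C. p \<in> V \<Longrightarrow> s > 0 \<Longrightarrow> X (scale s p) C = (s *\<^sub>R fst (X p C), s\<^sup>2 *\<^sub>R snd (X p C))"
  shows "spray A V X"
  unfolding spray_def
proof (intro conjI ballI assms)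
  show "openin (atlas_topology (tangent_atlas A)) V"
    using assms(1) openin_atlas_topology[OF smooth_tangent_atlas] by blast
  fix p assume p: "p \<in> V"
  have vf: "vector_field (tangent_atlas A) V X" using assms(4) by (simp add: second_order_def)
  show "lie_bracket (tangent_atlas A) (liouville A) X p = X p"
  proof
    fix C
    show "lie_bracket (tangent_atlas A) (liouville A) X p C = X p C"
    proof (cases "C \<in> tangent_atlas A \<and> p \<in> chart_dom C")
      case False
      then have "X p C = 0"
        using tm.tangent_space_zero[OF tm.vector_fieldD(1)[OF vf p]] by blast
      moreover have "lie_bracket (tangent_atlas A) (liouville A) X p C = 0"
        unfolding lie_bracket_def using False by (rule if_not_P)
      ultimately show ?thesis by simp
    next
      case True
      then have C: "C \<in> tangent_atlas A" "p \<in> chart_dom C" by auto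
      let ?z = "coords C p" and ?V = "coords C ` (chart_dom C \<inter> V)"
      have oV: "open ?V" by (rule tm.open_coords_image[OF C(1) assms(1)])
      have zV: "?z \<in> ?V" using C p by blast
      have "fderiv (\<lambda>x. liouville A (param C x) C) ?z (X p C) = fderiv (\<lambda>x. (0, snd x)) ?z (X p C)"
        using C by (subst fderiv_cong[OF oV zV]) (auto simp: liouville_chart)
      also have "\<dots> = (0, snd (X p C))"
        by (rule fderiv_eq) (auto intro!: derivative_eq_intros)
      finally have 1: "fderiv (\<lambda>x. liouville A (param C x) C) ?z (X p C) = (0, snd (X p C))" .
      have "((\<lambda>s. X (param C (fst ?z, s *\<^sub>R snd ?z)) C) has_vector_derivative
          fderiv (\<lambda>x. X (param C x) C) (fst ?z, 1 *\<^sub>R snd ?z) (0, snd ?z)) (at 1)"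
        using smooth_on_differentiable[OF tm.vector_fieldD(2)[OF vf C(1)] zV]
        by (intro has_vector_derivative_compose[OF vertical_path_has_derivative,
              where f = "\<lambda>x. X (param C x) C"]) simp
      moreover have "\<forall>\<^sub>F s in nhds 1. X (param C (fst ?z, s *\<^sub>R snd ?z)) C
          = (s *\<^sub>R fst (X p C), s\<^sup>2 *\<^sub>R snd (X p C))"
        by (rule eventually_mono[OF eventually_nhds_in_open[of "{0<..}" "1::real"]])
          (use C p X in \<open>simp_all add: param_scale\<close>)
      ultimately have "((\<lambda>s. (s *\<^sub>R fst (X p C), s\<^sup>2 *\<^sub>R snd (X p C))) has_vector_derivative
          fderiv (\<lambda>x. X (param C x) C) ?z (0, snd ?z)) (at 1)"
        by simp (rule has_vector_derivative_cong_eventually)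
      moreover have "((\<lambda>s. (s *\<^sub>R fst (X p C), s\<^sup>2 *\<^sub>R snd (X p C))) has_vector_derivative
          (fst (X p C), 2 *\<^sub>R snd (X p C))) (at 1)"
        by (auto intro!: derivative_eq_intros simp: has_vector_derivative_def)
      ultimately have 2: "fderiv (\<lambda>x. X (param C x) C) ?z (0, snd ?z) = (fst (X p C), 2 *\<^sub>R snd (X p C))"
        by (rule vector_derivative_unique_at)
      show ?thesis
        using C by (simp add: lie_bracket_def liouville_chart 1 2 prod_eq_iff scaleR_2)
    qed
  qed
qed

lemma second_orderD:
  assumes "second_order A V X" "p \<in> V" "C \<in> tangent_atlas A" "p \<in> chart_dom C"
  shows "fst (X p C) = snd (coords C p)"
  using assms by (auto simp: second_order_def)

end

section \<open>The fixed energy function and its spray\<close>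

text \<open>With \<open>W\<close> and \<open>f\<close> as parameters, one development serves both
  the regular case and the function built later for positivity.\<close>

locale fixed_energy = base_atlas A for A :: "('q, real^'n) chart set" +
  fixes L \<iota> :: "('q, real^'n) tangent \<Rightarrow> real"
    and \<Gamma>\<^sub>L :: "('q, real^'n) tangent \<Rightarrow> (('q, real^'n) tangent, (real^'n) \<times> (real^'n)) tvec"
    and e :: real and U :: "('q, real^'n) tangent set" and W :: "'q set" and f :: "'q \<Rightarrow> real"
  assumes smooth_L: "smooth_fun (tangent_atlas A) (tangent_bundle A) L"
    and convex_L: "strongly_convex A (tangent_bundle A) L"
    and field_L: "lagrangian_vector_field A (tangent_bundle A) L \<Gamma>\<^sub>L"
    and open_cone_U: "open_cone A U"
    and smooth_\<iota>_U: "smooth_fun (tangent_atlas A) U \<iota>" and \<iota>_pos_U: "p \<in> U \<Longrightarrow> \<iota> p > 0"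
    and energy_U: "p \<in> U \<Longrightarrow> energy A L (scale (1 / \<iota> p) p) = e"
    and open_W: "atlas_open A W" and smooth_f: "smooth_fun A W f"
begin

abbreviation "TA \<equiv> tangent_atlas A"
abbreviation "UW \<equiv> over U W"
abbreviation "FF \<equiv> add_total_derivative A f (fixed_energy_function L \<iota> e)"
abbreviation "rescale p \<equiv> scale (1 / \<iota> p) p"

lemma open_U: "atlas_open TA U"
  using open_cone_U openin_atlas_topology[OF smooth_tangent_atlas] by (simp add: open_cone_def)

lemma open_UW: "atlas_open TA UW"
  by (rule atlas_open_over[OF open_U open_W])

lemma UW_U: "p \<in> UW \<Longrightarrow> p \<in> U" and UW_W: "p \<in> UW \<Longrightarrow> fst p \<in> W"
  by (auto simp: over_def)

lemma cone_UW: "cone UW"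
  using open_cone_U by (auto simp: cone_def over_def open_cone_def)

lemma UW_slit: "UW \<subseteq> slit_tangent_bundle A"
  using open_cone_U by (auto simp: over_def open_cone_def)

lemma open_cone_UW: "open_cone A UW"
  using open_UW cone_UW UW_slit openin_atlas_topology[OF smooth_tangent_atlas]
  by (simp add: open_cone_def cone_def)

lemma UW_bundle: "p \<in> UW \<Longrightarrow> p \<in> tangent_bundle A"
  using UW_slit by (auto simp: slit_tangent_bundle_def)

lemma smooth_\<iota>: "smooth_fun TA UW \<iota>"
  by (rule tm.smooth_fun_subset[OF smooth_\<iota>_U]) (auto simp: over_def)

lemma \<iota>_pos: "p \<in> UW \<Longrightarrow> \<iota> p > 0"
  by (rule \<iota>_pos_U[OF UW_U])

lemma rescale_mem: "p \<in> UW \<Longrightarrow> rescale p \<in> UW"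
  using \<iota>_pos cone_UW by (auto simp: cone_def)

lemma scale_UW: "p \<in> UW \<Longrightarrow> s > 0 \<Longrightarrow> scale s p \<in> UW"
  using cone_UW by (auto simp: cone_def)

lemma open_tangent_bundle: "atlas_open TA (tangent_bundle A)"
  using tm.atlas_open_points points_tangent_atlas by simp

lemma smooth_L_chart:
  assumes "C \<in> TA" shows "smooth_on (coords C ` chart_dom C) (\<lambda>z. L (param C z))" "open (coords C ` chart_dom C)"
proof -
  have "chart_dom C \<inter> tangent_bundle A = chart_dom C" using tangent_bundleD[OF assms] by blast
  then show "smooth_on (coords C ` chart_dom C) (\<lambda>z. L (param C z))" "open (coords C ` chart_dom C)"
    using smooth_L tm.open_coords_image[OF assms open_tangent_bundle] assms unfolding smooth_fun_def by auto
qed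

lemma energy_chart:
  assumes "C \<in> TA" "p \<in> chart_dom C"
  shows "energy A L p = local_energy (\<lambda>z. L (param C z)) (coords C p)"
  using tm.dir_deriv_chart[OF smooth_L tangent_bundleD[OF assms] liouville_tangent assms] assms
  by (simp add: energy_def local_energy_def liouville_chart)

lemma convex_L_chart:
  assumes "C \<in> TA" "z \<in> coords C ` chart_dom C" "w \<noteq> 0"
  shows "vertical_hessian (\<lambda>z. L (param C z)) z w w > 0"
proof -
  obtain p where p: "p \<in> chart_dom C" "z = coords C p" using assms by blast
  then have "w \<bullet> (fibre_hessian (\<lambda>z. L (param C z)) z *v w) > 0"
    using convex_L assms tangent_bundleD[OF assms(1) p(1)] unfolding strongly_convex_def by blast
  then show ?thesis
    by (simp add: fibre_hessian_inner[OF smooth_L_chart(2,1)[OF assms(1)] assms(2)])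
qed

lemma local_fixed_energy:
  assumes c: "c \<in> A"
  defines "C \<equiv> natural_chart A c"
  shows "local_fixed_energy (coords C ` (chart_dom C \<inter> UW)) (\<lambda>z. L (param C z)) (\<lambda>z. \<iota> (param C z)) e
    (coords c ` (chart_dom c \<inter> W)) (\<lambda>x. f (param c x))"
proof -
  have C: "C \<in> TA" using c by (simp add: C_def natural_chart_mem)
  show ?thesis
  proof
    show "open (coords C ` (chart_dom C \<inter> UW))" by (rule tm.open_coords_image[OF C open_UW])
    show "smooth_on (coords C ` (chart_dom C \<inter> UW)) (\<lambda>z. L (param C z))"
      by (rule smooth_on_subset[OF smooth_L_chart(1)[OF C]]) auto
    show "smooth_on (coords C ` (chart_dom C \<inter> UW)) (\<lambda>z. \<iota> (param C z))"
      using smooth_\<iota> C by (simp add: smooth_fun_def)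
    show "open (coords c ` (chart_dom c \<inter> W))" by (rule base.open_coords_image[OF c open_W])
    show "smooth_on (coords c ` (chart_dom c \<inter> W)) (\<lambda>x. f (param c x))"
      using smooth_f c by (simp add: smooth_fun_def)
    fix z assume "z \<in> coords C ` (chart_dom C \<inter> UW)"
    then obtain p where p: "p \<in> chart_dom C" "p \<in> UW" "z = coords C p" by blast
    show "(fst z, s *\<^sub>R snd z) \<in> coords C ` (chart_dom C \<inter> UW)" if "0 < s" for s
      using scale_mem_chart_dom[OF C p(1), of s] scale_UW[OF p(2) that] coords_scale[OF C, of s p] p(3)
      by (metis IntI image_eqI)
    show "snd z \<noteq> 0"
    proof
      assume "snd z = 0"
      then have "snd p c = 0" using p by (simp add: C_def coords_natural)
      moreover have "fst p \<in> chart_dom c" "snd p \<in> tangent_space A (fst p)"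
        using p by (auto simp: C_def chart_dom_natural tangent_bundle_iff)
      ultimately have "snd p = (\<lambda>c. 0)"
        using base.tangent_space_eqI[OF _ base.tangent_space_scaleR[of "snd p" "fst p" 0] c] by simp
      then show False using p UW_slit by (auto simp: slit_tangent_bundle_def)
    qed
    show "\<iota> (param C z) > 0" using p C \<iota>_pos by simp
    show "vertical_hessian (\<lambda>z. L (param C z)) z w w > 0" if "w \<noteq> 0" for w
      by (rule convex_L_chart[OF C _ that]) (use p in blast)
    show "local_energy (\<lambda>z. L (param C z)) (fst z, (1 / \<iota> (param C z)) *\<^sub>R snd z) = e"
      using energy_U[OF UW_U[OF p(2)]] energy_chart[OF C scale_mem_chart_dom[OF C p(1)]] p C
      by (simp add: coords_scale)
    show "fst z \<in> coords c ` (chart_dom c \<inter> W)"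
      using p UW_W by (auto simp: C_def coords_natural chart_dom_natural)
  qed
qed

abbreviation "local_F c \<equiv> local_fixed_energy.F (\<lambda>z. L (param (natural_chart A c) z))
  (\<lambda>z. \<iota> (param (natural_chart A c) z)) e (\<lambda>x. f (param c x))"

abbreviation "local_\<rho> c \<equiv> local_fixed_energy.\<rho> (\<lambda>z. \<iota> (param (natural_chart A c) z))"

lemma local_\<rho>:
  assumes "c \<in> A" "p \<in> chart_dom (natural_chart A c)"
  shows "local_\<rho> c (coords (natural_chart A c) p) = coords (natural_chart A c) (rescale p)"
  unfolding local_fixed_energy.\<rho>_def[OF local_fixed_energy[OF assms(1)]]
  using assms natural_chart_mem by (simp add: coords_scale)

lemma local_F:
  assumes c: "c \<in> A" and p: "p \<in> chart_dom (natural_chart A c)" "p \<in> UW"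
  shows "FF p = local_F c (coords (natural_chart A c) p)"
proof -
  note C = natural_chart_mem[OF c]
  have "fst p \<in> chart_dom c" "snd p \<in> tangent_space A (fst p)"
    using p by (auto simp: chart_dom_natural tangent_bundle_iff)
  then show ?thesis
    using c C p UW_W[OF p(2)] base.dir_deriv_chart[OF smooth_f] scale_mem_chart_dom[OF C p(1)]
    by (simp add: local_fixed_energy.F_def[OF local_fixed_energy[OF c]] add_total_derivative_def
        fixed_energy_function_def local_\<rho>) (simp add: coords_natural)
qed

lemma local_F_eq:
  assumes "c \<in> A" "z \<in> coords (natural_chart A c) ` (chart_dom (natural_chart A c) \<inter> UW)"
  shows "FF (param (natural_chart A c) z) = local_F c z"
proof -
  obtain p where "p \<in> chart_dom (natural_chart A c)" "p \<in> UW" "z = coords (natural_chart A c) p"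
    using assms by blast
  then show ?thesis using local_F[OF assms(1)] natural_chart_mem[OF assms(1)] by simp
qed

lemma smooth_FF: "smooth_fun TA UW FF"
  unfolding smooth_fun_def
proof
  fix C assume "C \<in> TA"
  then obtain c where c: "c \<in> A" "C = natural_chart A c" by (rule tangent_atlasE)
  show "smooth_on (coords C ` (chart_dom C \<inter> UW)) (\<lambda>z. FF (param C z))"
    unfolding c(2)
    by (rule smooth_on_cong[OF _ _ local_fixed_energy.smooth_F[OF local_fixed_energy[OF c(1)]]])
      (use c tm.open_coords_image[OF \<open>C \<in> TA\<close> open_UW] local_F_eq in simp_all)
qed

lemma UW_chart:
  assumes "p \<in> UW"
  obtains c where "c \<in> A" "p \<in> chart_dom (natural_chart A c)"
    "coords (natural_chart A c) p \<in> coords (natural_chart A c) ` (chart_dom (natural_chart A c) \<inter> UW)"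
  using tangent_bundle_chart[OF UW_bundle[OF assms]] assms by (metis IntI imageI tangent_atlasE)

section \<open>Homogeneity and the extended field\<close>

lemma \<iota>_scale:
  assumes "p \<in> UW" "s > 0" shows "\<iota> (scale s p) = s * \<iota> p"
proof -
  obtain c where c: "c \<in> A" "p \<in> chart_dom (natural_chart A c)"
    "coords (natural_chart A c) p \<in> coords (natural_chart A c) ` (chart_dom (natural_chart A c) \<inter> UW)"
    using assms(1) by (rule UW_chart)
  show ?thesis
    using local_fixed_energy.\<iota>_homogeneous[OF local_fixed_energy[OF c(1)] c(3) assms(2)] c natural_chart_mem[OF c(1)]
    by (simp add: param_scale)
qed

lemma rescale_scale: "p \<in> UW \<Longrightarrow> s > 0 \<Longrightarrow> rescale (scale s p) = rescale p"
  using \<iota>_pos[of p] by (simp add: \<iota>_scale scale_scale)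

lemma energy_level_iff:
  assumes "p \<in> UW" shows "energy A L p = e \<longleftrightarrow> \<iota> p = 1"
proof -
  obtain c where c: "c \<in> A" "p \<in> chart_dom (natural_chart A c)"
    "coords (natural_chart A c) p \<in> coords (natural_chart A c) ` (chart_dom (natural_chart A c) \<inter> UW)"
    using assms(1) by (rule UW_chart)
  show ?thesis
    using local_fixed_energy.energy_level_iff[OF local_fixed_energy[OF c(1)] c(3)] c natural_chart_mem[OF c(1)]
      energy_chart[OF natural_chart_mem[OF c(1)] c(2)] by simp
qed

lemma FF_scale:
  assumes "p \<in> UW" "s > 0" shows "FF (scale s p) = s * FF p"
proof -
  have "snd p \<in> tangent_space A (fst p)" using UW_bundle[OF assms(1)] by (simp add: tangent_bundle_iff)
  from base.dir_deriv_add_scaleR[OF smooth_f UW_W[OF assms(1)] open_W this this, of "s - 1"]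
  have "dir_deriv A f (fst p) (\<lambda>c. s *\<^sub>R snd p c) = s * dir_deriv A f (fst p) (snd p)"
    by (simp add: algebra_simps)
  moreover have "fixed_energy_function L \<iota> e (scale s p) = s * fixed_energy_function L \<iota> e p"
    using rescale_scale[OF assms] assms by (simp add: fixed_energy_function_def \<iota>_scale)
  moreover have "snd (scale s p) = (\<lambda>c. s *\<^sub>R snd p c)" by (simp add: scale_def)
  ultimately show ?thesis by (simp add: add_total_derivative_def distrib_left)
qed

text \<open>\<open>rescale p\<close> depends only on the ray of \<open>p\<close>, so the powers of
  \<iota> alone give the components the degrees 1 and 2 of a spray.\<close>

definition \<Gamma> :: "('q, real^'n) tangent \<Rightarrow> (('q, real^'n) tangent, (real^'n) \<times> (real^'n)) tvec" where
  "\<Gamma> p = (\<lambda>C. (\<iota> p *\<^sub>R fst (\<Gamma>\<^sub>L (rescale p) C), (\<iota> p)\<^sup>2 *\<^sub>R snd (\<Gamma>\<^sub>L (rescale p) C)))"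

lemma second_order_L: "second_order A (tangent_bundle A) \<Gamma>\<^sub>L"
  and vector_field_L: "vector_field TA (tangent_bundle A) \<Gamma>\<^sub>L"
  using field_L by (auto simp: lagrangian_vector_field_def second_order_def)

lemma euler_lagrange_L:
  assumes "C \<in> TA" "p \<in> chart_dom C"
  shows "euler_lagrange_at (\<lambda>z. L (param C z)) (coords C p) (\<Gamma>\<^sub>L p C)"
  using field_L assms tangent_bundleD[OF assms]
    euler_lagrange_at_iff[OF smooth_L_chart(2,1)[OF assms(1)], of "coords C p" "\<Gamma>\<^sub>L p C"]
  by (auto simp: lagrangian_vector_field_def)

lemma \<Gamma>_scale:
  "p \<in> UW \<Longrightarrow> s > 0 \<Longrightarrow> \<Gamma> (scale s p) C = (s *\<^sub>R fst (\<Gamma> p C), s\<^sup>2 *\<^sub>R snd (\<Gamma> p C))"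
  using rescale_scale[of p s] by (simp add: \<Gamma>_def \<iota>_scale power_mult_distrib)

lemma \<Gamma>_tangent:
  assumes "p \<in> UW" shows "\<Gamma> p \<in> tangent_space TA p"
proof -
  have "\<Gamma>\<^sub>L (rescale p) \<in> tangent_space TA (rescale p)"
    by (intro tm.vector_fieldD(1)[OF vector_field_L] scale_mem_tangent_bundle UW_bundle assms)
  \<comment> \<open>Fibre scaling by \<iota> multiplies the vertical part once; scaling the whole
    vector by \<iota> then yields the factors \<iota> and \<open>\<iota>\<^sup>2\<close>.\<close>
  from tm.tangent_space_scaleR[OF scaled_tangent[OF this, of "\<iota> p"], of "\<iota> p"] \<iota>_pos[OF assms]
  show ?thesis by (simp add: scale_scale \<Gamma>_def power2_eq_square)
qed

lemma \<Gamma>_second_order: "second_order A UW \<Gamma>"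
  unfolding second_order_def vector_field_def
proof (intro conjI ballI \<Gamma>_tangent)
  fix C p assume C: "C \<in> TA" and p: "p \<in> chart_dom C \<inter> UW"
  then have "fst (\<Gamma>\<^sub>L (rescale p) C) = (1 / \<iota> p) *\<^sub>R snd (coords C p)"
    using second_orderD[OF second_order_L _ C, of "rescale p"] scale_mem_tangent_bundle[OF UW_bundle]
      scale_mem_chart_dom[OF C] by (simp add: coords_scale[OF C])
  then show "fst (\<Gamma> p C) = snd (coords C p)" using p \<iota>_pos[of p] by (simp add: \<Gamma>_def)
next
  fix C assume C: "C \<in> TA"
  then obtain c where c: "c \<in> A" "C = natural_chart A c" by (rule tangent_atlasE)
  let ?V = "coords C ` (chart_dom C \<inter> UW)" and ?G = "\<lambda>z. \<Gamma>\<^sub>L (param C z) C"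
  interpret loc: local_fixed_energy ?V "\<lambda>z. L (param C z)" "\<lambda>z. \<iota> (param C z)" e
    "coords c ` (chart_dom c \<inter> W)" "\<lambda>x. f (param c x)"
    unfolding c(2) by (rule local_fixed_energy[OF c(1)])
  have G: "smooth_on ?V ?G"
    by (rule smooth_on_subset[OF tm.vector_fieldD(2)[OF vector_field_L C]]) (use UW_bundle in blast)
  have sub: "loc.\<rho> ` ?V \<subseteq> ?V" using loc.\<rho>_mem by blast
  have "smooth_on ?V (\<lambda>z. (\<iota> (param C z) *\<^sub>R fst (?G (loc.\<rho> z)),
      (\<iota> (param C z) * \<iota> (param C z)) *\<^sub>R snd (?G (loc.\<rho> z))))"
    by (intro smooth_on_Pair smooth_on_scaleR smooth_on_mult loc.open_V loc.smooth_\<iota>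
        smooth_on_linear_compose[where h = fst and g = "\<lambda>z. ?G (loc.\<rho> z)"]
        smooth_on_linear_compose[where h = snd and g = "\<lambda>z. ?G (loc.\<rho> z)"]
        smooth_on_compose[OF loc.open_V sub G loc.smooth_\<rho>] bounded_linear_fst bounded_linear_snd)
  then show "smooth_on ?V (\<lambda>z. \<Gamma> (param C z) C)"
  proof (rule smooth_on_cong[OF loc.open_V, rotated])
    fix z assume "z \<in> ?V"
    then obtain p where p: "p \<in> chart_dom C" "z = coords C p" by blast
    then have "param C (loc.\<rho> z) = rescale p"
      using c C local_\<rho>[OF c(1), of p] scale_mem_chart_dom[OF C p(1)] by simp
    then show "(\<iota> (param C z) *\<^sub>R fst (?G (loc.\<rho> z)), (\<iota> (param C z) * \<iota> (param C z)) *\<^sub>R snd (?G (loc.\<rho> z)))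
        = \<Gamma> (param C z) C"
      using p C by (simp add: \<Gamma>_def power2_eq_square)
  qed
qed

lemma \<Gamma>_local:
  assumes c: "c \<in> A" and p: "p \<in> chart_dom (natural_chart A c)" "p \<in> UW"
  shows "euler_lagrange_at (local_F c) (coords (natural_chart A c) p) (\<Gamma> p (natural_chart A c))"
    and "dir_deriv TA \<iota> p (\<Gamma> p) = 0"
proof -
  let ?C = "natural_chart A c"
  note C = natural_chart_mem[OF c]
  let ?V = "coords ?C ` (chart_dom ?C \<inter> UW)"
  interpret loc: local_fixed_energy ?V "\<lambda>z. L (param ?C z)" "\<lambda>z. \<iota> (param ?C z)" e
    "coords c ` (chart_dom c \<inter> W)" "\<lambda>x. f (param c x)"
    by (rule local_fixed_energy[OF c(1)])
  have z: "coords ?C p \<in> ?V" using p by blast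
  have n: "rescale p \<in> chart_dom ?C" by (rule scale_mem_chart_dom[OF C p(1)])
  have EL: "euler_lagrange_at (\<lambda>z. L (param ?C z)) (loc.\<rho> (coords ?C p)) (\<Gamma>\<^sub>L (rescale p) ?C)"
    using euler_lagrange_L[OF C n] local_\<rho>[OF c p(1)] by simp
  have "fst (\<Gamma>\<^sub>L (rescale p) ?C) = snd (loc.\<rho> (coords ?C p))"
    using second_orderD[OF second_order_L _ C n] tangent_bundleD[OF C n] local_\<rho>[OF c p(1)] by simp
  note ext = loc.homogeneous_extension[OF z EL this]
  have \<Gamma>: "\<Gamma> p ?C = (\<iota> (param ?C (coords ?C p)) *\<^sub>R fst (\<Gamma>\<^sub>L (rescale p) ?C),
     (\<iota> (param ?C (coords ?C p)))\<^sup>2 *\<^sub>R snd (\<Gamma>\<^sub>L (rescale p) ?C))"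
    using C p by (simp add: \<Gamma>_def)
  show "euler_lagrange_at (local_F c) (coords ?C p) (\<Gamma> p ?C)"
    unfolding \<Gamma> by (rule ext(2))
  show "dir_deriv TA \<iota> p (\<Gamma> p) = 0"
    unfolding tm.dir_deriv_chart[OF smooth_\<iota> p(2) \<Gamma>_tangent[OF p(2)] C p(1)] \<Gamma> by (rule ext(1))
qed

lemma \<Gamma>_\<iota>: "p \<in> UW \<Longrightarrow> dir_deriv TA \<iota> p (\<Gamma> p) = 0"
  using UW_chart \<Gamma>_local(2) by metis

lemma \<Gamma>_spray: "spray A UW \<Gamma>"
  by (rule quadratic_imp_spray[OF open_UW cone_UW UW_slit \<Gamma>_second_order \<Gamma>_scale])

lemma \<iota>_one_homogeneous: "one_homogeneous A UW \<iota>"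
  by (rule one_homogeneousI[OF smooth_\<iota> open_UW cone_UW \<iota>_scale])

lemma FF_one_homogeneous: "one_homogeneous A UW FF"
  by (rule one_homogeneousI[OF smooth_FF open_UW cone_UW FF_scale])

text \<open>No integral curve is constructed: a straight line in a chart with velocity
  \<open>\<Gamma> p\<close> is pushed to the level set by \<open>rescale\<close>. Since
  \<open>\<Gamma>(\<iota>) = 0\<close> and \<iota> is 1 at \<open>p\<close>, the velocity at
  \<open>p\<close> is unchanged.\<close>

lemma \<Gamma>_tangent_to: "tangent_to TA \<Gamma> {p \<in> UW. \<iota> p = 1}"
  unfolding tangent_to_def
proof
  fix p assume p: "p \<in> {p \<in> UW. \<iota> p = 1}"
  then obtain c where c: "c \<in> A" "p \<in> chart_dom (natural_chart A c)"
    "coords (natural_chart A c) p \<in> coords (natural_chart A c) ` (chart_dom (natural_chart A c) \<inter> UW)"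
    using UW_chart by blast
  define C where "C = natural_chart A c"
  have C: "C \<in> TA" "p \<in> chart_dom C" using c natural_chart_mem by (auto simp: C_def)
  let ?V = "coords C ` (chart_dom C \<inter> UW)"
  interpret loc: local_fixed_energy ?V "\<lambda>z. L (param C z)" "\<lambda>z. \<iota> (param C z)" e
    "coords c ` (chart_dom c \<inter> W)" "\<lambda>x. f (param c x)"
    unfolding C_def by (rule local_fixed_energy[OF c(1)])
  define z v where "z = coords C p" and "v = \<Gamma> p C"
  have z: "z \<in> ?V" using C p by (simp add: z_def)
  have \<beta>: "((\<lambda>s. z + s *\<^sub>R v) has_vector_derivative v) (at 0)"
    by (auto intro!: derivative_eq_intros simp: has_vector_derivative_def)
  obtain \<epsilon> where \<epsilon>: "\<epsilon> > 0" "\<And>s. \<bar>s\<bar> < \<epsilon> \<Longrightarrow> z + s *\<^sub>R v \<in> ?V"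
  proof -
    have "((\<lambda>s. z + s *\<^sub>R v) \<longlongrightarrow> z + 0 *\<^sub>R v) (nhds 0)" by (intro tendsto_intros filterlim_ident)
    then have "\<forall>\<^sub>F s in nhds 0. z + s *\<^sub>R v \<in> ?V"
      by (rule topological_tendstoD) (use loc.open_V z in auto)
    then show ?thesis
      using that by (auto simp: eventually_nhds_metric dist_real_def)
  qed
  define \<gamma> where "\<gamma> s = rescale (param C (z + s *\<^sub>R v))" for s
  have mem: "param C w \<in> UW" "param C w \<in> chart_dom C" "coords C (param C w) = w" if "w \<in> ?V" for w
    using that C by auto
  have coords_\<gamma>: "coords C (\<gamma> s) = loc.\<rho> (z + s *\<^sub>R v)" if "\<bar>s\<bar> < \<epsilon>" for s
    using local_\<rho>[OF c(1), of "param C (z + s *\<^sub>R v)"] mem[OF \<epsilon>(2)[OF that]] by (simp add: \<gamma>_def C_def)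
  have near: "\<forall>\<^sub>F s in nhds 0. \<bar>s\<bar> < \<epsilon>"
    using \<epsilon>(1) by (auto simp: eventually_nhds_metric)
  have "\<gamma> 0 = p" using p C by (simp add: \<gamma>_def z_def)
  moreover have "\<gamma> s \<in> {p \<in> UW. \<iota> p = 1}" if "\<bar>s\<bar> < \<epsilon>" for s
    using mem(1)[OF \<epsilon>(2)[OF that]] \<iota>_pos rescale_mem by (simp add: \<gamma>_def \<iota>_scale less_imp_neq[symmetric])
  moreover have "has_velocity TA \<gamma> (\<Gamma> p) 0"
  proof (rule tm.has_velocityI[OF C(1)])
    show "\<gamma> 0 \<in> chart_dom C" using \<open>\<gamma> 0 = p\<close> C by simp
    show "\<forall>\<^sub>F s in nhds 0. \<gamma> s \<in> chart_dom C"
      using near by eventually_elim (simp add: \<gamma>_def scale_mem_chart_dom[OF C(1)] mem \<epsilon>)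
    have "((\<lambda>s. loc.\<rho> (z + s *\<^sub>R v)) has_vector_derivative fderiv loc.\<rho> (z + 0 *\<^sub>R v) v) (at 0)"
      using smooth_on_differentiable[OF loc.smooth_\<rho> z]
      by (intro has_vector_derivative_compose[OF \<beta>]) simp
    moreover have "fderiv loc.\<rho> (z + 0 *\<^sub>R v) v = v"
      using \<Gamma>_\<iota>[of p] p C tm.dir_deriv_chart[OF smooth_\<iota> _ \<Gamma>_tangent C]
      by (simp add: loc.fderiv_\<rho>[OF z]) (simp add: z_def v_def)
    moreover have "\<forall>\<^sub>F s in nhds 0. loc.\<rho> (z + s *\<^sub>R v) = coords C (\<gamma> s)"
      using near by eventually_elim (simp add: coords_\<gamma>)
    ultimately show "((\<lambda>s. coords C (\<gamma> s)) has_vector_derivative \<Gamma> p C) (at 0)"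
      by (simp add: v_def has_vector_derivative_cong_eventually)
    show "\<Gamma> p \<in> tangent_space TA (\<gamma> 0)" using \<Gamma>_tangent p \<open>\<gamma> 0 = p\<close> by simp
  qed
  ultimately show "\<exists>\<gamma> \<epsilon>. \<epsilon> > 0 \<and> \<gamma> 0 = p \<and> (\<forall>s. \<bar>s\<bar> < \<epsilon> \<longrightarrow> \<gamma> s \<in> {p \<in> UW. \<iota> p = 1}) \<and> has_velocity TA \<gamma> (\<Gamma> p) 0"
    using \<epsilon>(1) by (intro exI[of _ \<gamma>] exI[of _ \<epsilon>]) auto
qed

text \<open>\<iota> is constant along a curve inside the level set.\<close>

lemma tangent_to_level_imp:
  assumes "tangent_to TA X {p \<in> UW. \<iota> p = 1}" "p \<in> UW" "\<iota> p = 1"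
  shows "dir_deriv TA \<iota> p (X p) = 0"
proof -
  obtain \<gamma> \<epsilon> where \<gamma>: "\<epsilon> > 0" "\<gamma> 0 = p" "\<And>s. \<bar>s\<bar> < \<epsilon> \<Longrightarrow> \<gamma> s \<in> {p \<in> UW. \<iota> p = 1}" "has_velocity TA \<gamma> (X p) 0"
    using assms unfolding tangent_to_def by blast
  have "((\<lambda>s. \<iota> (\<gamma> s)) has_real_derivative dir_deriv TA \<iota> p (X p)) (at 0)"
    using tm.has_velocity_fun[OF smooth_\<iota> _ \<gamma>(4)] \<gamma>(2) assms by simp
  then have "((\<lambda>s. 1) has_real_derivative dir_deriv TA \<iota> p (X p)) (at 0)"
    by (rule DERIV_cong_ev[THEN iffD1, rotated 3])
      (use \<gamma> in \<open>auto simp: eventually_nhds_metric dist_real_def intro!: exI[of _ \<epsilon>]\<close>)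
  then show ?thesis using DERIV_unique DERIV_const by blast
qed

lemma \<Gamma>_eq_\<Gamma>\<^sub>L: "p \<in> UW \<Longrightarrow> \<iota> p = 1 \<Longrightarrow> \<Gamma>\<^sub>L p = \<Gamma> p"
  by (simp add: \<Gamma>_def)

text \<open>Chosen so that \<open>\<Gamma> - P \<Delta>\<close> annihilates \<open>F\<close>
  wherever \<open>F\<close> is nonzero, in view of \<open>\<Delta>(F) = F\<close>.\<close>

definition P :: "('q, real^'n) tangent \<Rightarrow> real" where
  "P p = dir_deriv TA FF p (\<Gamma> p) / FF p"

definition \<Gamma>\<^sub>E :: "('q, real^'n) tangent \<Rightarrow> (('q, real^'n) tangent, (real^'n) \<times> (real^'n)) tvec" where
  "\<Gamma>\<^sub>E p = (\<lambda>C. \<Gamma> p C + (- P p) *\<^sub>R liouville A p C)"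

text \<open>Differentiating \<open>F (scale s p) = s F p\<close> along \<Gamma>, whose components
  have degrees 1 and 2, gives the numerator degree 2.\<close>

lemma P_scale:
  assumes "p \<in> UW" "s > 0" shows "P (scale s p) = s * P p"
proof -
  obtain c where c: "c \<in> A" "p \<in> chart_dom (natural_chart A c)"
    "coords (natural_chart A c) p \<in> coords (natural_chart A c) ` (chart_dom (natural_chart A c) \<inter> UW)"
    using assms(1) by (rule UW_chart)
  let ?C = "natural_chart A c"
  note C = natural_chart_mem[OF c(1)]
  let ?V = "coords ?C ` (chart_dom ?C \<inter> UW)" and ?F = "\<lambda>z. FF (param ?C z)" and ?z = "coords ?C p"
  have sp: "scale s p \<in> chart_dom ?C" "scale s p \<in> UW"
    using scale_mem_chart_dom[OF C c(2)] scale_UW assms by auto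
  have lin: "(fibre_scale s has_derivative fibre_scale s) (at z)" for z :: "(real^'n) \<times> (real^'n)"
    by (intro derivative_eq_intros) auto
  have dF: "?F differentiable (at (fibre_scale s ?z))" "?F differentiable (at ?z)"
    using tm.smooth_fun_differentiable[OF smooth_FF C] sp c assms coords_scale[OF C] by metis+
  have "fderiv ?F (fibre_scale s ?z) (fibre_scale s (\<Gamma> p ?C)) = fderiv (\<lambda>z. ?F (fibre_scale s z)) ?z (\<Gamma> p ?C)"
    using fderiv_compose[OF differentiableI[OF lin] dF(1)] fderiv_eq[OF lin] by simp
  also have "\<dots> = fderiv (\<lambda>z. s * ?F z) ?z (\<Gamma> p ?C)"
    using C assms by (subst fderiv_cong[OF tm.open_coords_image[OF C open_UW] c(3)]) (auto simp: param_scale FF_scale)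
  also have "\<dots> = s * fderiv ?F ?z (\<Gamma> p ?C)"
    by (rule fderiv_eq) (intro has_derivative_mult_right, use dF(2) in \<open>simp flip: frechet_derivative_works\<close>)
  finally have 1: "fderiv ?F (fibre_scale s ?z) (fibre_scale s (\<Gamma> p ?C)) = s * fderiv ?F ?z (\<Gamma> p ?C)" .
  have "\<Gamma> (scale s p) ?C = s *\<^sub>R fibre_scale s (\<Gamma> p ?C)"
    using assms by (simp add: \<Gamma>_scale power2_eq_square)
  then have "dir_deriv TA FF (scale s p) (\<Gamma> (scale s p)) = s * (s * dir_deriv TA FF p (\<Gamma> p))"
    using 1 linear_scale[OF linear_frechet_derivative[OF dF(1)], of s "fibre_scale s (\<Gamma> p ?C)"]
      tm.dir_deriv_chart[OF smooth_FF assms(1) \<Gamma>_tangent[OF assms(1)] C c(2)]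
      tm.dir_deriv_chart[OF smooth_FF sp(2) \<Gamma>_tangent[OF sp(2)] C sp(1)] coords_scale[OF C, of s p]
    by simp
  then show ?thesis using assms by (simp add: P_def FF_scale)
qed

context
  assumes FF_nonzero: "p \<in> UW \<Longrightarrow> FF p \<noteq> 0"
begin

lemma smooth_P: "smooth_fun TA UW P"
  unfolding P_def[abs_def]
  using \<Gamma>_second_order
  by (intro tm.smooth_fun_divide open_UW FF_nonzero tm.smooth_fun_dir_deriv smooth_FF) (auto simp: second_order_def)

lemma \<Gamma>\<^sub>E_tangent: "p \<in> UW \<Longrightarrow> \<Gamma>\<^sub>E p \<in> tangent_space TA p"
  unfolding \<Gamma>\<^sub>E_def by (intro tm.tangent_space_add tm.tangent_space_scaleR liouville_tangent \<Gamma>_tangent)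

lemma \<Gamma>\<^sub>E_second_order: "second_order A UW \<Gamma>\<^sub>E"
  unfolding second_order_def vector_field_def
proof (intro conjI ballI \<Gamma>\<^sub>E_tangent)
  fix C p assume C: "C \<in> TA" and p: "p \<in> chart_dom C \<inter> UW"
  then show "fst (\<Gamma>\<^sub>E p C) = snd (coords C p)"
    using second_orderD[OF \<Gamma>_second_order, of p C] by (simp add: \<Gamma>\<^sub>E_def liouville_chart)
next
  fix C assume C: "C \<in> TA"
  let ?V = "coords C ` (chart_dom C \<inter> UW)"
  note o = tm.open_coords_image[OF C open_UW]
  have "smooth_on ?V (\<lambda>z. \<Gamma> (param C z) C + (- 1 * P (param C z)) *\<^sub>R (0, snd z))"
    using \<Gamma>_second_order smooth_P C
    by (intro smooth_on_add smooth_on_scaleR smooth_on_mult smooth_on_Pair smooth_on_const smooth_on_snd o)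
      (auto simp: second_order_def smooth_fun_def vector_field_def)
  then show "smooth_on ?V (\<lambda>z. \<Gamma>\<^sub>E (param C z) C)"
    by (rule smooth_on_cong[OF o, rotated]) (use C in \<open>auto simp: \<Gamma>\<^sub>E_def liouville_chart\<close>)
qed

lemma \<Gamma>\<^sub>E_canonical: "canonical_spray A UW FF \<Gamma>\<^sub>E"
  unfolding canonical_spray_def lagrangian_vector_field_def
proof (intro conjI ballI \<Gamma>\<^sub>E_second_order)
  fix C p assume C: "C \<in> TA" and p: "p \<in> chart_dom C \<inter> UW"
  then obtain c where c: "c \<in> A" "C = natural_chart A c" by (auto elim: tangent_atlasE)
  let ?V = "coords C ` (chart_dom C \<inter> UW)" and ?z = "coords C p"
  interpret loc: local_fixed_energy ?V "\<lambda>z. L (param C z)" "\<lambda>z. \<iota> (param C z)" e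
    "coords c ` (chart_dom c \<inter> W)" "\<lambda>x. f (param c x)"
    unfolding c(2) by (rule local_fixed_energy[OF c(1)])
  have z: "?z \<in> ?V" using p by blast
  have eq: "half_square FF (param C z) = half_square loc.F z" if "z \<in> ?V" for z
    using local_F_eq[OF c(1), of z] that by (simp add: half_square_def c(2))
  have Fz: "loc.F ?z = FF p" "loc.F ?z \<noteq> 0"
    using local_F[OF c(1), of p] p c(2) FF_nonzero[of p] by auto
  have "smooth_on ?V (\<lambda>z. (1/2) * (loc.F z * loc.F z))"
    by (intro smooth_on_mult smooth_on_const loc.open_V loc.smooth_F)
  then have "smooth_on ?V (\<lambda>z. half_square FF (param C z))"
    by (rule smooth_on_cong[OF loc.open_V, rotated]) (simp only: eq, simp add: half_square_def power2_eq_square)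
  from euler_lagrange_at_iff[OF loc.open_V this z, of "\<Gamma>\<^sub>E p C"]
  have iff: "(\<forall>i. fderiv (partial_y i (\<lambda>z. half_square FF (param C z))) ?z (\<Gamma>\<^sub>E p C)
      - partial_x i (\<lambda>z. half_square FF (param C z)) ?z = 0)
      \<longleftrightarrow> euler_lagrange_at (\<lambda>z. half_square FF (param C z)) ?z (\<Gamma>\<^sub>E p C)" .
  have "fderiv loc.F ?z = fderiv (\<lambda>z. FF (param C z)) ?z"
    by (rule fderiv_cong[OF loc.open_V z]) (use local_F_eq[OF c(1)] c(2) in simp)
  then have "P p = fderiv loc.F ?z (\<Gamma> p C) / loc.F ?z"
    using tm.dir_deriv_chart[OF smooth_FF _ \<Gamma>_tangent C, of p] p Fz by (simp add: P_def)
  then have "\<Gamma>\<^sub>E p C = \<Gamma> p C - (fderiv loc.F ?z (\<Gamma> p C) / loc.F ?z) *\<^sub>R (0, snd ?z)"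
    using C p by (simp add: \<Gamma>\<^sub>E_def liouville_chart)
  moreover have "euler_lagrange_at loc.F ?z (\<Gamma> p C)"
    using \<Gamma>_local(1)[OF c(1), of p] p c(2) by simp
  ultimately have "euler_lagrange_at (half_square loc.F) ?z (\<Gamma>\<^sub>E p C)"
    using loc.euler_lagrange_half_square[OF z Fz(2)] by simp
  then have "euler_lagrange_at (\<lambda>z. half_square FF (param C z)) ?z (\<Gamma>\<^sub>E p C)"
    using euler_lagrange_at_cong[OF loc.open_V z eq] by simp
  with iff show "\<forall>i. fderiv (partial_y i (\<lambda>z. half_square FF (param C z))) ?z (\<Gamma>\<^sub>E p C)
      - partial_x i (\<lambda>z. half_square FF (param C z)) ?z = 0" by blast
qed

end

lemma smooth_half_square_FF: "smooth_fun TA UW (half_square FF)"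
proof -
  have "smooth_fun TA UW (\<lambda>p. FF p * (FF p / 2))"
    using smooth_FF tm.smooth_fun_divide[OF open_UW _ smooth_FF, of "\<lambda>_. 2"]
    by (intro tm.smooth_fun_mult open_UW) (auto simp: smooth_fun_def smooth_on_const)
  then show ?thesis by (simp add: half_square_def[abs_def] power2_eq_square)
qed

section \<open>Consequences of regularity\<close>

lemma regular_chart:
  assumes "regular A UW (half_square FF)" "C \<in> TA" "p \<in> chart_dom C" "p \<in> UW"
    "\<And>w. vertical_hessian (\<lambda>z. half_square FF (param C z)) (coords C p) u w = 0"
  shows "u = 0"
proof (rule invertible_hessian_imp)
  show "invertible (fibre_hessian (\<lambda>z. half_square FF (param C z)) (coords C p))"
    using assms unfolding regular_def by blast
  show "u \<bullet> (fibre_hessian (\<lambda>z. half_square FF (param C z)) (coords C p) *v w) = 0" for w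
    using assms smooth_half_square_FF
    by (subst fibre_hessian_inner[OF tm.open_coords_image[OF assms(2) open_UW]]) (auto simp: smooth_fun_def)
qed

lemma regular_nonzero:
  assumes "regular A UW (half_square FF)" "p \<in> UW"
  shows "FF p \<noteq> 0"
proof -
  obtain c where c: "c \<in> A" "p \<in> chart_dom (natural_chart A c)"
    "coords (natural_chart A c) p \<in> coords (natural_chart A c) ` (chart_dom (natural_chart A c) \<inter> UW)"
    using assms(2) by (rule UW_chart)
  let ?C = "natural_chart A c"
  note C = natural_chart_mem[OF c(1)]
  note loc = local_fixed_energy[OF c(1)]
  have "vertical_hessian (half_square (local_F c)) (coords ?C p) u w
      = vertical_hessian (\<lambda>z. half_square FF (param ?C z)) (coords ?C p) u w" for u w
    by (rule second_fderiv_cong[OF tm.open_coords_image[OF C open_UW] c(3)])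
      (simp add: half_square_def local_F_eq[OF c(1)])
  then have "local_F c (coords ?C p) \<noteq> 0"
    by (intro local_fixed_energy.regular_imp_nonzero[OF loc c(3)] regular_chart[OF assms(1) C c(2) assms(2)]) simp
  then show ?thesis using local_F[OF c(1,2) assms(2)] by simp
qed

text \<open>Second-order fields have the same horizontal part, so the difference of two solutions is
  vertical; the Euler-Lagrange equations place it in the kernel of an invertible Hessian.\<close>

lemma canonical_spray_unique:
  assumes "regular A UW (half_square FF)" "canonical_spray A UW FF X" "p \<in> UW"
  shows "X p = \<Gamma>\<^sub>E p"
proof -
  note nz = regular_nonzero[OF assms(1)]
  obtain c where c: "c \<in> A" "p \<in> chart_dom (natural_chart A c)"
    "coords (natural_chart A c) p \<in> coords (natural_chart A c) ` (chart_dom (natural_chart A c) \<inter> UW)"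
    using assms(3) by (rule UW_chart)
  let ?C = "natural_chart A c"
  note C = natural_chart_mem[OF c(1)]
  let ?V = "coords ?C ` (chart_dom ?C \<inter> UW)" and ?E = "\<lambda>z. half_square FF (param ?C z)" and ?z = "coords ?C p"
  have o: "open ?V" "smooth_on ?V ?E"
    using tm.open_coords_image[OF C open_UW] smooth_half_square_FF C by (auto simp: smooth_fun_def)
  have EL: "euler_lagrange_at ?E ?z (Y p ?C)" "fst (Y p ?C) = snd ?z" "Y p \<in> tangent_space TA p"
    if "canonical_spray A UW FF Y" for Y
    using that C c(2) assms(3) euler_lagrange_at_iff[OF o c(3), of "Y p ?C"]
    unfolding canonical_spray_def lagrangian_vector_field_def second_order_def vector_field_def by auto
  note can = \<Gamma>\<^sub>E_canonical[OF nz]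
  define u where "u = snd (X p ?C) - snd (\<Gamma>\<^sub>E p ?C)"
  have d: "(0, u) = X p ?C - \<Gamma>\<^sub>E p ?C"
    using EL(2)[OF assms(2)] EL(2)[OF can] by (simp add: u_def prod_eq_iff)
  have "vertical_hessian ?E ?z u w = 0" for w
    unfolding d using EL(1)[OF assms(2)] EL(1)[OF can] linear_diff[OF linear_fderiv[OF smooth_on_fderiv[OF o(2)] c(3)]]
    by (simp add: euler_lagrange_at_def)
  then have "u = 0" by (rule regular_chart[OF assms(1) C c(2) assms(3)])
  with d have "X p ?C = \<Gamma>\<^sub>E p ?C" by (simp flip: zero_prod_def)
  then show ?thesis
    using tm.tangent_space_eqI[OF EL(3)[OF assms(2)] EL(3)[OF can] C c(2)] by simp
qed

text \<open>By uniqueness \<open>X\<close> is \<open>\<Gamma> - P \<Delta>\<close>, so its spray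
  property follows from the degrees of \<Gamma> and \<open>P\<close>.\<close>

lemma canonical_spray_projectively_equivalent:
  assumes "regular A UW (half_square FF)" "canonical_spray A UW FF X"
  shows "projectively_equivalent A UW X \<Gamma>"
  unfolding projectively_equivalent_def
proof (intro conjI exI[of _ P] ballI allI \<Gamma>_spray)
  note nz = regular_nonzero[OF assms(1)]
  have X: "X p C = \<Gamma> p C + (- P p) *\<^sub>R liouville A p C" if "p \<in> UW" for p C
    using canonical_spray_unique[OF assms that] by (simp add: \<Gamma>\<^sub>E_def)
  show "smooth_fun TA UW P" by (rule smooth_P[OF nz])
  then show "one_homogeneous A UW P" by (rule one_homogeneousI[OF _ open_UW cone_UW P_scale])
  show "\<Gamma> p C = X p C + P p *\<^sub>R liouville A p C" if "p \<in> UW" for p C using X[OF that] by simp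
  show "spray A UW X"
  proof (rule quadratic_imp_spray[OF open_UW cone_UW UW_slit])
    show "second_order A UW X"
      using assms(2) by (simp add: canonical_spray_def lagrangian_vector_field_def)
    fix p C and s :: real assume p: "p \<in> UW" and s: "s > 0"
    have "liouville A (scale s p) C = s *\<^sub>R liouville A p C"
    proof (cases "C \<in> TA \<and> p \<in> chart_dom C")
      case True
      then show ?thesis
        by (simp add: liouville_chart scale_mem_chart_dom coords_scale)
    next
      \<comment> \<open>Scaling by a positive factor neither enters nor leaves a chart domain, so
        both sides have the default value 0.\<close>
      case False
      moreover have "scale (1 / s) (scale s p) = p" using s by (simp add: scale_scale)
      then have "\<not> (C \<in> TA \<and> scale s p \<in> chart_dom C)"
        using False scale_mem_chart_dom[of C "scale s p" "1 / s"] by auto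
      ultimately show ?thesis unfolding liouville_def by (simp only: if_False scaleR_zero_right)
    qed
    moreover have "fst (liouville A p C) = 0" by (simp add: liouville_def)
    ultimately show "X (scale s p) C = (s *\<^sub>R fst (X p C), s\<^sup>2 *\<^sub>R snd (X p C))"
      using p s scale_UW[OF p s]
      by (simp add: X \<Gamma>_scale P_scale prod_eq_iff algebra_simps power2_eq_square)
  qed
qed

text \<open>The sprays differ by a multiple of the Liouville field. On the level set the multiple is
  zero, as both sprays annihilate \<iota> there and the Liouville field does not. Every ray meets
  the level set, so homogeneity of the factors gives the rest.\<close>

lemma projectively_equivalent_unique:
  assumes "projectively_equivalent A UW X \<Gamma>" "projectively_equivalent A UW X Y"
    "tangent_to TA Y {p \<in> UW. \<iota> p = 1}" "p \<in> UW"
  shows "Y p = \<Gamma> p"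
proof -
  obtain R where R: "smooth_fun TA UW R" "one_homogeneous A UW R"
    "\<And>p C. p \<in> UW \<Longrightarrow> \<Gamma> p C = X p C + R p *\<^sub>R liouville A p C"
    using assms(1) unfolding projectively_equivalent_def by blast
  obtain R' where R': "smooth_fun TA UW R'" "one_homogeneous A UW R'"
    "\<And>p C. p \<in> UW \<Longrightarrow> Y p C = X p C + R' p *\<^sub>R liouville A p C"
    using assms(2) unfolding projectively_equivalent_def by blast
  have level: "R' q = R q" if "q \<in> UW" "\<iota> q = 1" for q
  proof -
    have "Y q = (\<lambda>C. \<Gamma> q C + (R' q - R q) *\<^sub>R liouville A q C)"
      using R(3)[OF that(1)] R'(3)[OF that(1)] by (simp add: fun_eq_iff algebra_simps)
    then have "dir_deriv TA \<iota> q (Y q) = dir_deriv TA \<iota> q (\<Gamma> q) + (R' q - R q) * dir_deriv TA \<iota> q (liouville A q)"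
      using tm.dir_deriv_add_scaleR[OF smooth_\<iota> that(1) open_UW \<Gamma>_tangent[OF that(1)] liouville_tangent] by simp
    then show ?thesis
      using tangent_to_level_imp[OF assms(3) that] \<Gamma>_\<iota>[OF that(1)] \<iota>_one_homogeneous that
      by (simp add: one_homogeneous_def)
  qed
  have "\<iota> (rescale p) = 1" using assms(4) \<iota>_pos[OF assms(4)] by (simp add: \<iota>_scale)
  then have "R' (rescale p) = R (rescale p)" by (intro level rescale_mem assms(4))
  moreover have "R' (rescale p) = (1 / \<iota> p) * R' p" "R (rescale p) = (1 / \<iota> p) * R p"
    using \<iota>_pos[OF assms(4)] one_homogeneousD[OF R'(1) open_UW cone_UW R'(2) assms(4), of "1 / \<iota> p"]
      one_homogeneousD[OF R(1) open_UW cone_UW R(2) assms(4), of "1 / \<iota> p"] by simp_all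
  ultimately have "R' p = R p" using \<iota>_pos[OF assms(4)] by simp
  then show ?thesis using R(3)[OF assms(4)] R'(3)[OF assms(4)] by (simp add: fun_eq_iff)
qed

end

section \<open>Reparametrization by arc length\<close>

text \<open>Extended real end points treat bounded and unbounded intervals alike; openness of
  \<open>I\<close> makes both of them strict bounds.\<close>

lemma open_interval_antiderivative:
  fixes h :: "real \<Rightarrow> real"
  assumes "open I" "is_interval I" "continuous_on I h"
  obtains H where "\<And>t. t \<in> I \<Longrightarrow> (H has_real_derivative h t) (at t)"
proof (cases "I = {}")
  case False
  define a b where "a = (INF t\<in>I. ereal t)" and "b = (SUP t\<in>I. ereal t)"
  have outer: "a < ereal t \<and> ereal t < b" if t: "t \<in> I" for t
  proof -
    obtain d where d: "d > 0" "ball t d \<subseteq> I" using assms(1) t open_contains_ball by blast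
    have "t - d/2 \<in> ball t d" "t + d/2 \<in> ball t d" using d(1) by (auto simp: dist_real_def)
    then have "t - d/2 \<in> I" "t + d/2 \<in> I" using d by auto
    then have "a \<le> ereal (t - d/2)" "ereal (t + d/2) \<le> b"
      unfolding a_def b_def by (auto intro: INF_lower SUP_upper)
    moreover have "ereal (t - d/2) < ereal t" "ereal t < ereal (t + d/2)" using d(1) by auto
    ultimately show ?thesis using order_le_less_trans order_less_le_trans by blast
  qed
  have inner: "t \<in> I" if t: "a < ereal t" "ereal t < b" for t
  proof -
    obtain s r where "s \<in> I" "s < t" "r \<in> I" "t < r"
      using t by (auto simp: a_def b_def INF_less_iff less_SUP_iff)
    then show ?thesis using mem_is_interval_1_I[OF assms(2)] less_imp_le by metis
  qed
  from False outer have "a < b" by (metis ex_in_conv less_trans)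
  then obtain H where "\<And>t. a < ereal t \<Longrightarrow> ereal t < b \<Longrightarrow> (H has_vector_derivative h t) (at t)"
    using einterval_antiderivative[of a b h] inner assms(1,3) continuous_on_eq_continuous_at by blast
  then show ?thesis
    using outer by (intro that[of H]) (simp add: has_real_derivative_iff_has_vector_derivative)
qed (use that in simp)

text \<open>Bootstrapping: if \<phi> is of class \<open>k\<close>, then so is the right hand side of
  its differential equation, hence \<phi> is of class \<open>Suc k\<close>.\<close>

lemma smooth_on_inverse_ode:
  fixes \<phi> h :: "real \<Rightarrow> real"
  assumes "open J" "open I" "smooth_on I h" "\<And>t. t \<in> I \<Longrightarrow> h t \<noteq> 0"
    and \<phi>: "\<And>s. s \<in> J \<Longrightarrow> \<phi> s \<in> I" "\<And>s. s \<in> J \<Longrightarrow> (\<phi> has_real_derivative 1 / h (\<phi> s)) (at s)"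
  shows "smooth_on J \<phi>"
  unfolding smooth_on_def
proof
  fix k show "Ck_on k J \<phi>"
  proof (induction k)
    case 0
    then show ?case
      using \<phi>(2) by (auto intro!: continuous_at_imp_continuous_on DERIV_isCont)
  next
    case (Suc k)
    have "Ck_on k J (\<lambda>s. inverse (h (\<phi> s)) * v)" for v
      using Suc assms(1,2,4) \<phi>(1) assms(3)[unfolded smooth_on_def]
      by (intro Ck_on_bilinear[OF bounded_bilinear_mult] Ck_on_const
          Ck_on_compose[of J \<phi> I _ "\<lambda>t. inverse (h t)"] Ck_on_inverse) auto
    then show ?case
      using \<phi>(2) by (intro Ck_on_SucI[OF assms(1), of _ "\<lambda>s v. inverse (h (\<phi> s)) * v"])
        (auto simp: has_field_derivative_def divide_inverse)
  qed
qed

text \<open>\<phi> is the inverse of an antiderivative of \<open>h\<close>; this is arc length when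
  \<open>h\<close> is the value of \<open>F\<close> along a lift.\<close>

lemma arc_length_reparametrization:
  fixes h :: "real \<Rightarrow> real"
  assumes I: "open I" "is_interval I" and h: "smooth_on I h" "\<And>t. t \<in> I \<Longrightarrow> h t > 0"
  obtains J \<phi> where "orientation_preserving_reparametrization J I \<phi>"
    "\<And>s. s \<in> J \<Longrightarrow> \<phi> s \<in> I" "\<And>s. s \<in> J \<Longrightarrow> (\<phi> has_real_derivative 1 / h (\<phi> s)) (at s)"
proof -
  obtain H where H: "\<And>t. t \<in> I \<Longrightarrow> (H has_real_derivative h t) (at t)"
    using open_interval_antiderivative[OF I smooth_on_continuous_on[OF h(1)]] by blast
  have mono: "H s < H t" if "s \<in> I" "t \<in> I" "s < t" for s t
  proof (rule DERIV_pos_imp_increasing[OF that(3)])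
    fix x assume "s \<le> x" "x \<le> t"
    then have "x \<in> I" using mem_is_interval_1_I[OF I(2) that(1,2)] by blast
    then show "\<exists>y. (H has_real_derivative y) (at x) \<and> 0 < y" using H h(2) by blast
  qed
  have inj: "inj_on H I" by (rule linorder_inj_onI) (use mono in force)+
  have cont: "continuous_on I H"
    by (intro continuous_at_imp_continuous_on ballI DERIV_isCont[OF H])
  define J where "J = H ` I"
  define \<phi> where "\<phi> = inv_into I H"
  have \<phi>H: "\<phi> (H t) = t" if "t \<in> I" for t using inj that by (simp add: \<phi>_def)
  have \<phi>_mem: "\<phi> s \<in> I" if "s \<in> J" for s using that \<phi>H by (auto simp: J_def)
  have oJ: "open J"
    using injective_eq_1d_open_map_UNIV[OF cont I(2)] inj I(1) by (auto simp: J_def)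
  have iJ: "is_interval J"
    unfolding is_interval_connected_1 J_def
    by (rule connected_continuous_image[OF cont]) (use I(2) is_interval_connected_1 in blast)
  have der: "(\<phi> has_real_derivative 1 / h (\<phi> s)) (at s)" if s: "s \<in> J" for s
  proof -
    obtain t where t: "t \<in> I" "s = H t" using s by (auto simp: J_def)
    have "(\<phi> has_derivative (*) (1 / h t)) (at (H t))"
      by (rule has_derivative_inverse_strong[OF I(1) t(1) cont \<phi>H, of "\<lambda>v. h t * v"])
        (use H[OF t(1)] h(2)[OF t(1)] in \<open>auto simp: has_field_derivative_def o_def id_def\<close>)
    then show ?thesis
      using t by (simp add: \<phi>H has_field_derivative_def)
  qed
  have "smooth_on J \<phi>"
    by (rule smooth_on_inverse_ode[OF oJ I(1) h(1) _ \<phi>_mem der]) (use h(2) in force)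
  moreover have "deriv \<phi> s > 0" if "s \<in> J" for s
    using DERIV_imp_deriv[OF der[OF that]] h(2)[OF \<phi>_mem[OF that]] by simp
  moreover have "bij_betw \<phi> J I"
    unfolding \<phi>_def J_def by (rule bij_betw_inv_into[OF inj_on_imp_bij_betw[OF inj]])
  ultimately have "orientation_preserving_reparametrization J I \<phi>"
    using oJ iJ by (simp add: orientation_preserving_reparametrization_def)
  then show ?thesis using that \<phi>_mem der by blast
qed

section \<open>Geodesics from solutions of the Euler-Lagrange equations\<close>

context fixed_energy
begin

text \<open>In a chart the acceleration of the solution and that of \<open>\<Gamma>\<^sub>L\<close>
  satisfy the same linear equations, whose matrix is the positive definite Hessian.\<close>

lemma euler_lagrange_solution_has_velocity:
  assumes x: "euler_lagrange_solution A L I x"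
    and lift: "\<And>t. t \<in> I \<Longrightarrow> tangent_lift A x t \<in> tangent_bundle A" and t: "t \<in> I"
  shows "has_velocity TA (tangent_lift A x) (\<Gamma>\<^sub>L (tangent_lift A x t)) t"
proof -
  define \<gamma> where "\<gamma> = tangent_lift A x"
  have fst_\<gamma>: "fst (\<gamma> s) = x s" for s by (simp add: \<gamma>_def tangent_lift_def)
  obtain C where C: "C \<in> TA" "\<gamma> t \<in> chart_dom C"
    using tangent_bundle_chart[OF lift[OF t]] unfolding \<gamma>_def by blast
  then obtain c where c: "c \<in> A" "C = natural_chart A c" by (auto elim: tangent_atlasE)
  have xt: "x t \<in> chart_dom c" using C(2) by (simp add: c(2) chart_dom_natural fst_\<gamma>)
  let ?l = "\<lambda>z. L (param C z)" and ?V = "coords C ` chart_dom C" and ?z = "coords C (\<gamma> t)"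
  note l = smooth_L_chart(2,1)[OF C(1)]
  have z: "?z \<in> ?V" using C by blast
  have vx: "has_velocity A x (snd (\<gamma> t)) t" and dif: "(\<lambda>s. coords C (\<gamma> s)) differentiable (at t)"
    and EL: "\<And>i. ((\<lambda>s. partial_y i ?l (coords C (\<gamma> s))) has_real_derivative partial_x i ?l ?z) (at t)"
    and oI: "open I"
    using x t C unfolding euler_lagrange_solution_def \<gamma>_def by auto
  obtain b where b: "((\<lambda>s. coords C (\<gamma> s)) has_vector_derivative b) (at t)"
    using dif vector_derivative_works by blast
  \<comment> \<open>The horizontal part of the velocity of the lift is the velocity of
    \<open>x\<close>, hence the fibre coordinate.\<close>
  have "((\<lambda>s. fst (coords C (\<gamma> s))) has_vector_derivative fst b) (at t)"
    using has_derivative_fst[OF b[unfolded has_vector_derivative_def]] by (simp add: has_vector_derivative_def)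
  moreover have "(\<lambda>s. fst (coords C (\<gamma> s))) = (\<lambda>s. coords c (x s))"
    by (simp add: c(2) coords_natural fst_\<gamma>)
  ultimately have "fst b = snd (\<gamma> t) c"
    using base.has_velocity_chart(2)[OF vx c(1) xt] vector_derivative_unique_at by metis
  then have fb: "fst b = fst (\<Gamma>\<^sub>L (\<gamma> t) C)"
    using second_orderD[OF second_order_L tangent_bundleD[OF C] C] by (simp add: c(2) coords_natural)
  have "fderiv (partial_y i ?l) ?z b = partial_x i ?l ?z" for i
  proof -
    have "partial_y i ?l differentiable (at ?z)"
      unfolding partial_y_def[abs_def] by (rule smooth_on_differentiable[OF smooth_on_fderiv[OF l(2)] z])
    then have "((\<lambda>s. partial_y i ?l (coords C (\<gamma> s))) has_vector_derivative fderiv (partial_y i ?l) ?z b) (at t)"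
      by (rule has_vector_derivative_compose[OF b])
    then show ?thesis
      using EL[of i] vector_derivative_unique_at by (metis has_real_derivative_iff_has_vector_derivative)
  qed
  then have ELb: "euler_lagrange_at ?l ?z b" using euler_lagrange_at_iff[OF l z, of b] by simp
  define u where "u = snd b - snd (\<Gamma>\<^sub>L (\<gamma> t) C)"
  have d: "(0, u) = b - \<Gamma>\<^sub>L (\<gamma> t) C" using fb by (simp add: u_def prod_eq_iff)
  have "vertical_hessian ?l ?z u w = 0" for w
    unfolding d using ELb euler_lagrange_L[OF C] linear_diff[OF linear_fderiv[OF smooth_on_fderiv[OF l(2)] z]]
    by (simp add: euler_lagrange_at_def)
  then have "u = 0" using convex_L_chart[OF C(1) z] by force
  with d have "b = \<Gamma>\<^sub>L (\<gamma> t) C" by (simp flip: zero_prod_def)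
  with b have "((\<lambda>s. coords C (\<gamma> s)) has_vector_derivative \<Gamma>\<^sub>L (\<gamma> t) C) (at t)" by simp
  moreover have "\<forall>\<^sub>F s in nhds t. \<gamma> s \<in> chart_dom C"
    using base.has_velocity_chart(1)[OF vx c(1) xt] eventually_nhds_in_open[OF oI t]
    by eventually_elim (use lift in \<open>simp add: c(2) chart_dom_natural fst_\<gamma>, simp add: \<gamma>_def\<close>)
  ultimately show ?thesis
    using tm.has_velocityI[OF C(1), of \<gamma> t] C(2) tm.vector_fieldD(1)[OF vector_field_L] tangent_bundleD[OF C]
    by (simp add: \<gamma>_def)
qed

text \<open>The curve is only known to be differentiable. But the derivative of \<open>g\<close>
  along it is \<open>\<Gamma>(g)\<close> along it, again a smooth function on \<open>UW\<close>
  evaluated on the curve, so the argument repeats.\<close>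

lemma smooth_on_integral_curve:
  assumes "open I" "\<And>t. t \<in> I \<Longrightarrow> \<gamma> t \<in> UW" "\<And>t. t \<in> I \<Longrightarrow> has_velocity TA \<gamma> (\<Gamma> (\<gamma> t)) t"
    and "smooth_fun TA UW g"
  shows "smooth_on I (\<lambda>t. g (\<gamma> t))"
proof -
  have der: "((\<lambda>t. g (\<gamma> t)) has_real_derivative dir_deriv TA g (\<gamma> t) (\<Gamma> (\<gamma> t))) (at t)"
    if "t \<in> I" "smooth_fun TA UW g" for t g
    using tm.has_velocity_fun[OF that(2) assms(2)[OF that(1)] assms(3)[OF that(1)]] .
  have "Ck_on k I (\<lambda>t. g (\<gamma> t))" for k
    using assms(4)
  proof (induction k arbitrary: g)
    case 0
    then show ?case by (auto intro!: continuous_at_imp_continuous_on DERIV_isCont[OF der])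
  next
    case (Suc k)
    have "vector_field TA UW \<Gamma>" using \<Gamma>_second_order by (simp add: second_order_def)
    then have "Ck_on k I (\<lambda>t. dir_deriv TA g (\<gamma> t) (\<Gamma> (\<gamma> t)))"
      by (intro Suc.IH tm.smooth_fun_dir_deriv open_UW Suc.prems)
    then have "Ck_on k I (\<lambda>t. dir_deriv TA g (\<gamma> t) (\<Gamma> (\<gamma> t)) * v)" for v
      by (intro Ck_on_bilinear[OF bounded_bilinear_mult] assms(1) Ck_on_const)
    then show ?case
      using der[OF _ Suc.prems]
      by (intro Ck_on_SucI[OF assms(1), of _ "\<lambda>t v. dir_deriv TA g (\<gamma> t) (\<Gamma> (\<gamma> t)) * v"])
        (auto simp: has_field_derivative_def)
  qed
  then show ?thesis by (simp add: smooth_on_def)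
qed

context
  assumes FF_pos: "p \<in> UW \<Longrightarrow> FF p > 0"
begin

lemma half_square_strongly_convex: "strongly_convex A UW (half_square FF)"
  unfolding strongly_convex_def
proof (intro ballI allI impI)
  fix C p and w :: "real^'n" assume C: "C \<in> TA" and p: "p \<in> chart_dom C \<inter> UW" and w: "w \<noteq> 0"
  then obtain c where c: "c \<in> A" "C = natural_chart A c" by (auto elim: tangent_atlasE)
  let ?V = "coords C ` (chart_dom C \<inter> UW)"
  note o = tm.open_coords_image[OF C open_UW]
  have z: "coords C p \<in> ?V" using p by blast
  have "local_F c (coords C p) > 0"
    using local_F[OF c(1), of p] FF_pos[of p] p c(2) by simp
  then have "vertical_hessian (half_square (local_F c)) (coords C p) w w > 0"
    using local_fixed_energy.half_square_convex[OF local_fixed_energy[OF c(1)] _ _ w] z c(2) by simp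
  also have "vertical_hessian (half_square (local_F c)) (coords C p) w w
      = vertical_hessian (\<lambda>z. half_square FF (param C z)) (coords C p) w w"
    by (rule second_fderiv_cong[OF o z]) (simp add: half_square_def local_F_eq[OF c(1)] c(2))
  also have "\<dots> = w \<bullet> (fibre_hessian (\<lambda>z. half_square FF (param C z)) (coords C p) *v w)"
    using smooth_half_square_FF C by (subst fibre_hessian_inner[OF o _ z]) (auto simp: smooth_fun_def)
  finally show "w \<bullet> (fibre_hessian (\<lambda>z. half_square FF (param C z)) (coords C p) *v w) > 0" .
qed

lemma FF_finsler: "finsler_function A UW FF"
  unfolding finsler_function_def
  using open_cone_UW smooth_FF FF_pos FF_one_homogeneous half_square_strongly_convex by blast

text \<open>Along the lift, \<open>\<Gamma>(F) = P F\<close>, so the arc length parametrization has acceleration \<open>- P / F\<^sup>2\<close>,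
  which turns \<open>\<Gamma>\<close> into \<open>\<Gamma>\<^sub>E = \<Gamma> - P \<Delta>\<close>.\<close>

lemma solution_geodesic:
  assumes x: "euler_lagrange_solution A L I x"
    and lift: "\<And>t. t \<in> I \<Longrightarrow> energy A L (tangent_lift A x t) = e \<and> tangent_lift A x t \<in> UW"
  obtains J \<phi> where "orientation_preserving_reparametrization J I \<phi>" "geodesic A UW FF J (x \<circ> \<phi>)"
proof -
  define \<gamma> where "\<gamma> = tangent_lift A x"
  have I: "open I" "is_interval I" using x by (auto simp: euler_lagrange_solution_def)
  have mem: "\<gamma> t \<in> UW" if "t \<in> I" for t using lift that by (simp add: \<gamma>_def)
  have "\<Gamma>\<^sub>L (\<gamma> t) = \<Gamma> (\<gamma> t)" if "t \<in> I" for t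
    using \<Gamma>_eq_\<Gamma>\<^sub>L[OF mem[OF that]] energy_level_iff[OF mem[OF that]] lift[OF that] by (simp add: \<gamma>_def)
  then have vel: "has_velocity TA \<gamma> (\<Gamma> (\<gamma> t)) t" if "t \<in> I" for t
    using euler_lagrange_solution_has_velocity[OF x _ that] UW_bundle mem that by (simp add: \<gamma>_def)
  define h where "h t = FF (\<gamma> t)" for t
  have h_pos: "h t > 0" if "t \<in> I" for t using FF_pos mem that by (simp add: h_def)
  have h_smooth: "smooth_on I h"
    unfolding h_def[abs_def] by (rule smooth_on_integral_curve[OF I(1) mem vel smooth_FF])
  have h_der: "(h has_real_derivative P (\<gamma> t) * h t) (at t)" if "t \<in> I" for t
    using tm.has_velocity_fun[OF smooth_FF mem vel, OF that that] h_pos[OF that]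
    by (simp add: h_def[abs_def] P_def)
  obtain J \<phi> where \<phi>: "orientation_preserving_reparametrization J I \<phi>"
    "\<And>s. s \<in> J \<Longrightarrow> \<phi> s \<in> I" "\<And>s. s \<in> J \<Longrightarrow> (\<phi> has_real_derivative 1 / h (\<phi> s)) (at s)"
    using arc_length_reparametrization[OF I h_smooth h_pos] by blast
  \<comment> \<open>\<open>k\<close> is the derivative of \<phi>, so \<beta> is the lift of the
    reparametrized curve.\<close>
  define k where "k s = 1 / h (\<phi> s)" for s
  define \<beta> where "\<beta> s = scale (k s) (\<gamma> (\<phi> s))" for s
  have nz: "FF p \<noteq> 0" if "p \<in> UW" for p using FF_pos[OF that] by simp
  have J: "open J" "is_interval J" using \<phi>(1) by (auto simp: orientation_preserving_reparametrization_def)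
  have "integral_curve TA UW \<Gamma>\<^sub>E J \<beta>"
    unfolding integral_curve_def
  proof (intro conjI ballI J)
    fix s assume s: "s \<in> J"
    define t where "t = \<phi> s"
    note t = \<phi>(2)[OF s, folded t_def]
    have k_pos: "k s > 0" using h_pos[OF t] by (simp add: k_def t_def)
    show \<beta>_mem: "\<beta> s \<in> UW" using scale_UW[OF mem[OF t] k_pos] by (simp add: \<beta>_def t_def)
    obtain C where C: "C \<in> TA" "\<gamma> t \<in> chart_dom C"
      using tangent_bundle_chart[OF UW_bundle[OF mem[OF t]]] by blast
    have d\<phi>: "(\<phi> has_vector_derivative k s) (at s)"
      using \<phi>(3)[OF s] by (simp add: k_def has_real_derivative_iff_has_vector_derivative)
    have dk: "(k has_real_derivative - P (\<gamma> t) * (k s)\<^sup>2) (at s)"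
    proof -
      have "((\<lambda>s. h (\<phi> s)) has_real_derivative P (\<gamma> t) * h t * k s) (at s)"
        using DERIV_chain2[of h "P (\<gamma> t) * h t" \<phi> s "k s" UNIV] h_der[OF t] \<phi>(3)[OF s]
        by (simp add: t_def k_def)
      then have "((\<lambda>s. 1 / h (\<phi> s)) has_real_derivative - (P (\<gamma> t) * h t * k s) / (h t)\<^sup>2) (at s)"
        using h_pos[OF t] by (auto intro!: derivative_eq_intros simp: t_def power2_eq_square)
      moreover have "- (P (\<gamma> t) * h t * k s) / (h t)\<^sup>2 = - P (\<gamma> t) * (k s)\<^sup>2"
        using h_pos[OF t] by (simp add: k_def t_def power2_eq_square)
      ultimately show ?thesis by (simp add: k_def[abs_def])
    qed
    define \<zeta> where "\<zeta> s = coords C (\<gamma> (\<phi> s))" for s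
    have d\<zeta>: "(\<zeta> has_vector_derivative k s *\<^sub>R \<Gamma> (\<gamma> t) C) (at s)"
      using vector_diff_chain_at[OF d\<phi>, of "\<lambda>t. coords C (\<gamma> t)"] tm.has_velocity_chart(2)[OF vel[OF t] C]
      by (simp add: o_def \<zeta>_def[abs_def] t_def)
    have "((\<lambda>s. (fst (\<zeta> s), k s *\<^sub>R snd (\<zeta> s))) has_vector_derivative
        (k s *\<^sub>R fst (\<Gamma> (\<gamma> t) C), k s *\<^sub>R (k s *\<^sub>R snd (\<Gamma> (\<gamma> t) C)) + (- P (\<gamma> t) * (k s)\<^sup>2) *\<^sub>R snd (\<zeta> s))) (at s)"
      using has_vector_derivative_Pair[OF
          bounded_linear.has_vector_derivative[OF bounded_linear_fst d\<zeta>]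
          has_vector_derivative_scaleR[OF dk bounded_linear.has_vector_derivative[OF bounded_linear_snd d\<zeta>]]]
      by simp
    moreover have "(\<lambda>s. (fst (\<zeta> s), k s *\<^sub>R snd (\<zeta> s))) = (\<lambda>s. coords C (\<beta> s))"
      by (simp add: \<beta>_def \<zeta>_def coords_scale[OF C(1)])
    \<comment> \<open>The degrees match: \<Gamma> at \<open>\<beta> s\<close> carries the factors
      \<open>k\<close> and \<open>k\<^sup>2\<close>, while \<open>P\<close> and the Liouville field
      contribute one factor \<open>k\<close> each.\<close>
    moreover have "(k s *\<^sub>R fst (\<Gamma> (\<gamma> t) C), k s *\<^sub>R (k s *\<^sub>R snd (\<Gamma> (\<gamma> t) C)) + (- P (\<gamma> t) * (k s)\<^sup>2) *\<^sub>R snd (\<zeta> s))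
        = \<Gamma>\<^sub>E (\<beta> s) C"
      using C mem[OF t] k_pos
      by (simp add: \<Gamma>\<^sub>E_def \<beta>_def \<zeta>_def t_def[symmetric] \<Gamma>_scale P_scale liouville_chart scale_mem_chart_dom
          coords_scale power2_eq_square)
    ultimately have d\<beta>: "((\<lambda>s. coords C (\<beta> s)) has_vector_derivative \<Gamma>\<^sub>E (\<beta> s) C) (at s)" by simp
    show "has_velocity TA \<beta> (\<Gamma>\<^sub>E (\<beta> s)) s"
    proof (rule tm.has_velocityI[OF C(1) _ _ d\<beta> \<Gamma>\<^sub>E_tangent[OF nz \<beta>_mem]])
      show "\<beta> s \<in> chart_dom C" using scale_mem_chart_dom[OF C] by (simp add: \<beta>_def t_def)
      have "isCont \<phi> s" using \<phi>(3)[OF s] DERIV_isCont by blast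
      then have "(\<phi> \<longlongrightarrow> t) (nhds s)" by (simp add: isCont_def tendsto_nhds_iff t_def)
      then have "\<forall>\<^sub>F s in nhds s. \<gamma> (\<phi> s) \<in> chart_dom C"
        using tm.has_velocity_chart(1)[OF vel[OF t] C] by (rule eventually_compose_filterlim[rotated])
      then show "\<forall>\<^sub>F s in nhds s. \<beta> s \<in> chart_dom C"
        by eventually_elim (simp add: \<beta>_def scale_mem_chart_dom[OF C(1)])
    qed
  qed
  moreover have "(x \<circ> \<phi>) s = fst (\<beta> s)" for s by (simp add: \<beta>_def \<gamma>_def tangent_lift_def)
  ultimately have "geodesic A UW FF J (x \<circ> \<phi>)"
    unfolding geodesic_def base_integral_curve_def using \<Gamma>\<^sub>E_canonical[OF nz] by blast
  with \<phi>(1) show ?thesis by (rule that)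
qed

end

end

section \<open>Local positivity by a function linear in a chart\<close>

lemma (in atlas) atlas_open_coords_preimage:
  assumes "c \<in> A" "open B"
  shows "atlas_open A {p \<in> chart_dom c. coords c p \<in> B}" (is "atlas_open A ?W")
  unfolding atlas_open_def
proof (intro conjI ballI)
  show "?W \<subseteq> points A" using assms by (auto simp: points_def)
  fix d assume d: "d \<in> A"
  have "coords d ` (chart_dom d \<inter> ?W) = overlap d c \<inter> transition d c -` B"
    using d assms(1) by (auto 0 4)
  then show "open (coords d ` (chart_dom d \<inter> ?W))"
    using continuous_open_preimage[OF smooth_on_continuous_on[OF smooth_transition[OF d assms(1)]]
        open_overlap[OF d assms(1)] assms(2)] by simp
qed

text \<open>Subtracting the linear function with differential \<open>\<partial>L/\<partial>y\<close> at the zero vector over \<open>q\<close> makes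
  \<open>F\<close> positive near \<open>q\<close>, by strict convexity of \<open>L\<close> along the rays in the fibres.\<close>

lemma (in fixed_energy) exists_positive:
  assumes "q \<in> fst ` U"
  obtains W' f' where "atlas_open A W'" "q \<in> W'" "smooth_fun A W' f'"
    "\<And>p. p \<in> over U W' \<Longrightarrow> add_total_derivative A f' (fixed_energy_function L \<iota> e) p > 0"
proof -
  have "smooth_fun A (points A) (\<lambda>_. 0)" by (simp add: smooth_fun_def smooth_on_const)
  \<comment> \<open>The whole manifold with the zero function supplies the facts in charts before a
    neighbourhood is chosen.\<close>
  then interpret whole: fixed_energy A L \<iota> \<Gamma>\<^sub>L e U "points A" "\<lambda>_. 0"
    by unfold_locales
      (simp_all add: smooth_L convex_L field_L open_cone_U smooth_\<iota>_U \<iota>_pos_U energy_U base.atlas_open_points)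
  obtain p0 where p0: "p0 \<in> U" "q = fst p0" using assms by blast
  then have p0': "p0 \<in> over U (points A)"
    using open_cone_U by (auto simp: over_def open_cone_def slit_tangent_bundle_def tangent_bundle_iff)
  obtain c where c: "c \<in> A" "p0 \<in> chart_dom (natural_chart A c)"
    "coords (natural_chart A c) p0 \<in> coords (natural_chart A c) ` (chart_dom (natural_chart A c) \<inter> over U (points A))"
    using p0' by (rule whole.UW_chart)
  define C where "C = natural_chart A c"
  have C: "C \<in> TA" "p0 \<in> chart_dom C" using c natural_chart_mem by (auto simp: C_def)
  let ?N = "coords c ` chart_dom c" and ?l = "\<lambda>z. L (param C z)" and ?x = "coords c q"
  have qc: "q \<in> chart_dom c" using c(2) p0(2) by (simp add: chart_dom_natural)
  have image: "coords C ` chart_dom C = ?N \<times> UNIV"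
    using coords_natural_image[OF c(1), of "chart_dom c"] by (simp add: C_def chart_dom_natural)
  have oN: "open ?N" using base.open_overlap[OF c(1) c(1)] by simp
  have smooth_l: "smooth_on (?N \<times> UNIV) ?l" using smooth_L_chart(1)[OF C(1)] by (simp add: image)
  have convex_l: "vertical_hessian ?l z w w > 0" if "z \<in> ?N \<times> UNIV" "w \<noteq> 0" for z w
    using convex_L_chart[OF C(1) _ that(2)] that(1) image by simp
  have loc: "local_energy ?l (coords C (rescale p)) = e" if "p \<in> over U W'" "p \<in> chart_dom C" for p W'
    using energy_chart[OF C(1) scale_mem_chart_dom[OF C(1) that(2)]] energy_U[of p] that(1)
    by (simp add: over_def)
  \<comment> \<open>The ray through \<open>p0\<close> has energy \<open>e\<close> at a nonzero
    vector, and the energy increases strictly from the zero vector on.\<close>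
  have "local_energy ?l (?x, 0) < e"
  proof -
    define y where "y = snd (coords C (rescale p0))"
    have "snd (coords C p0) \<noteq> 0"
      using local_fixed_energy.slit[OF whole.local_fixed_energy[OF c(1)] c(3)] by (simp add: C_def)
    then have "y \<noteq> 0" using \<iota>_pos_U[OF p0(1)] by (simp add: y_def coords_scale[OF C(1)])
    moreover have "coords C (rescale p0) = (?x, y)"
      by (simp add: y_def C_def coords_natural p0(2) prod_eq_iff)
    ultimately show ?thesis
      using local_energy_ray_mono[OF _ smooth_l convex_l, of y 0 1 ?x] loc[OF p0' C(2)] qc oN
      by (simp add: open_Times)
  qed
  then obtain r where r: "r > 0" "ball ?x r \<subseteq> ?N"
    "\<And>x y. x \<in> ball ?x r \<Longrightarrow> local_energy ?l (x, y) = e \<Longrightarrow> fderiv ?l (?x, 0) (0, y) < fderiv ?l (x, y) (0, y)"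
    using vertical_derivative_gap[OF oN smooth_l _ convex_l, of ?x e] qc by blast
  \<comment> \<open>Being linear in the coordinates, \<open>f'\<close> has the same differential at
    all points of the neighbourhood; the sign turns its sum with \<open>L + e\<close> into the gap
    estimated before.\<close>
  define m where "m y = - fderiv ?l (?x, 0) (0, y)" for y
  have m: "linear m"
    using linear_compose[OF _ linear_fderiv[OF smooth_l, of "(?x, 0)"], of "\<lambda>y. (0, y)"] qc
    unfolding m_def[abs_def] by (intro linear_compose_neg) (simp add: o_def linear_iff)
  define W' where "W' = {p \<in> chart_dom c. coords c p \<in> ball ?x r}"
  define f' where "f' p = m (coords c p)" for p
  have oW: "atlas_open A W'" unfolding W'_def by (rule base.atlas_open_coords_preimage[OF c(1) open_ball])
  have f': "smooth_fun A W' f'"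
    unfolding smooth_fun_def f'_def
  proof
    fix d assume d: "d \<in> A"
    have "smooth_on (coords d ` (chart_dom d \<inter> W')) (base.transition d c)"
      by (rule smooth_on_subset[OF base.smooth_transition[OF d c(1)] image_mono]) (use W'_def in blast)
    then show "smooth_on (coords d ` (chart_dom d \<inter> W')) (\<lambda>x. m (base.transition d c x))"
      by (rule smooth_on_linear_compose[OF base.open_coords_image[OF d oW] m[unfolded linear_conv_bounded_linear]])
  qed
  have "add_total_derivative A f' (fixed_energy_function L \<iota> e) p > 0" if p: "p \<in> over U W'" for p
  proof -
    have pU: "p \<in> U" "fst p \<in> W'" using p by (auto simp: over_def)
    have "p \<in> tangent_bundle A" using pU open_cone_U by (auto simp: open_cone_def slit_tangent_bundle_def)
    then have pC: "p \<in> chart_dom C" and v: "snd p \<in> tangent_space A (fst p)" and pc: "fst p \<in> chart_dom c"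
      and pb: "coords c (fst p) \<in> ball ?x r"
      using pU by (auto simp: C_def chart_dom_natural tangent_bundle_iff W'_def)
    define y where "y = (1 / \<iota> p) *\<^sub>R snd p c"
    note pos = \<iota>_pos_U[OF pU(1)]
    have z: "coords C (rescale p) = (coords c (fst p), y)"
      by (simp add: C_def coords_natural y_def scale_def)
    have le: "local_energy ?l (coords c (fst p), y) = e" using loc[OF p pC] z by simp
    have "fderiv (\<lambda>x. f' (param c x)) (coords c (fst p)) (snd p c) = fderiv m (coords c (fst p)) (snd p c)"
    proof (subst fderiv_cong[OF open_ball pb])
      fix x assume "x \<in> ball ?x r"
      then have "x \<in> ?N" using r(2) by blast
      then show "f' (param c x) = m x" using c(1) by (auto simp: f'_def)
    qed simp
    also have "\<dots> = m (snd p c)"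
      by (rule fderiv_eq) (use m linear_imp_has_derivative in blast)
    also have "\<dots> = \<iota> p * m y"
      using linear_scale[OF m, of "\<iota> p" y] pos by (simp add: y_def)
    finally have df: "dir_deriv A f' (fst p) (snd p) = \<iota> p * m y"
      using base.dir_deriv_chart[OF f' pU(2) v c(1) pc] by simp
    have "L (rescale p) = ?l (coords c (fst p), y)"
      using C(1) scale_mem_chart_dom[OF C(1) pC] by (simp flip: z)
    \<comment> \<open>The energy relation turns \<open>L + e\<close> into the radial derivative of
      \<open>L\<close>, the first half of the gap.\<close>
    then have "L (rescale p) + e = fderiv ?l (coords c (fst p), y) (0, y)"
      using le by (simp add: local_energy_def)
    then have "add_total_derivative A f' (fixed_energy_function L \<iota> e) p
        = \<iota> p * (fderiv ?l (coords c (fst p), y) (0, y) - fderiv ?l (?x, 0) (0, y))"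
      by (simp add: add_total_derivative_def fixed_energy_function_def df m_def right_diff_distrib)
    then show ?thesis using r(3)[OF pb le] pos by simp
  qed
  moreover have "q \<in> W'" using qc r(1) by (simp add: W'_def)
  ultimately show ?thesis using that oW f' by blast
qed

text \<open>Fields are total functions, so uniqueness compares values on \<open>over U W\<close>.
  The equality of the two level sets belongs to the claim, as the restriction of
  \<open>\<Gamma>\<^sub>L\<close> is to the energy level.\<close>

theorem theorem2:
  fixes A :: "('q, real^'n) chart set"
    and L \<iota> :: "('q, real^'n) tangent \<Rightarrow> real"
    and \<Gamma>\<^sub>L :: "('q, real^'n) tangent \<Rightarrow> (('q, real^'n) tangent, (real^'n) \<times> (real^'n)) tvec"
    and e :: real
    and U :: "('q, real^'n) tangent set"
  assumes "smooth_manifold A"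
    and "smooth_fun (tangent_atlas A) (tangent_bundle A) L"
    and "strongly_convex A (tangent_bundle A) L"
    and "lagrangian_vector_field A (tangent_bundle A) L \<Gamma>\<^sub>L"
    and "U \<noteq> {}" and "open_cone A U"
    and "smooth_fun (tangent_atlas A) U \<iota>" and "\<forall>p\<in>U. \<iota> p > 0"
    and "\<forall>p\<in>U. energy A L (scale (1 / \<iota> p) p) = e"
  shows
    "(\<forall>W f. openin (atlas_topology A) W \<longrightarrow> smooth_fun A W f \<longrightarrow>
        regular A (over U W) (half_square (add_total_derivative A f (fixed_energy_function L \<iota> e))) \<longrightarrow>
        (\<exists>\<Gamma>\<^sub>E. canonical_spray A (over U W)
           (add_total_derivative A f (fixed_energy_function L \<iota> e)) \<Gamma>\<^sub>E) \<and>
        (\<forall>\<Gamma>\<^sub>E. canonical_spray A (over U W)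
             (add_total_derivative A f (fixed_energy_function L \<iota> e)) \<Gamma>\<^sub>E \<longrightarrow>
           (\<exists>\<Gamma>. projectively_equivalent A (over U W) \<Gamma>\<^sub>E \<Gamma> \<and>
              tangent_to (tangent_atlas A) \<Gamma> {p \<in> over U W. \<iota> p = 1} \<and>
              (\<forall>\<Gamma>'. projectively_equivalent A (over U W) \<Gamma>\<^sub>E \<Gamma>' \<longrightarrow>
                 tangent_to (tangent_atlas A) \<Gamma>' {p \<in> over U W. \<iota> p = 1} \<longrightarrow>
                 (\<forall>p\<in>over U W. \<Gamma>' p = \<Gamma> p)) \<and>
              {p \<in> over U W. energy A L p = e} = {p \<in> over U W. \<iota> p = 1} \<and>
              (\<forall>p\<in>{p \<in> over U W. \<iota> p = 1}. \<Gamma>\<^sub>L p = \<Gamma> p)))) \<and>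
     (\<forall>q\<in>fst ` U. \<exists>W f. openin (atlas_topology A) W \<and> q \<in> W \<and> smooth_fun A W f \<and>
        finsler_function A (over U W) (add_total_derivative A f (fixed_energy_function L \<iota> e)) \<and>
        (\<forall>I x. euler_lagrange_solution A L I x \<longrightarrow>
           (\<forall>t\<in>I. energy A L (tangent_lift A x t) = e \<and> tangent_lift A x t \<in> over U W) \<longrightarrow>
           (\<exists>J \<phi>. orientation_preserving_reparametrization J I \<phi> \<and>
              geodesic A (over U W) (add_total_derivative A f (fixed_energy_function L \<iota> e))
                J (x \<circ> \<phi>))))"
proof -
  have atlas: "smooth_atlas A" using assms(1) by (simp add: smooth_manifold_def)
  have FE: "fixed_energy A L \<iota> \<Gamma>\<^sub>L e U W f" if "atlas_open A W" "smooth_fun A W f" for W f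
    by unfold_locales (use assms atlas that in auto)
  show ?thesis
    unfolding openin_atlas_topology[OF atlas]
  proof (intro conjI allI impI ballI)
    fix W f
    assume W: "atlas_open A W" "smooth_fun A W f"
      and reg: "regular A (over U W) (half_square (add_total_derivative A f (fixed_energy_function L \<iota> e)))"
    interpret fixed_energy A L \<iota> \<Gamma>\<^sub>L e U W f by (rule FE[OF W])
    show "\<exists>\<Gamma>\<^sub>E. canonical_spray A UW FF \<Gamma>\<^sub>E"
      using \<Gamma>\<^sub>E_canonical[OF regular_nonzero[OF reg]] by blast
    fix X assume X: "canonical_spray A UW FF X"
    note pe = canonical_spray_projectively_equivalent[OF reg X]
    show "\<exists>\<Gamma>. projectively_equivalent A UW X \<Gamma> \<and> tangent_to TA \<Gamma> {p \<in> UW. \<iota> p = 1} \<and>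
        (\<forall>\<Gamma>'. projectively_equivalent A UW X \<Gamma>' \<longrightarrow> tangent_to TA \<Gamma>' {p \<in> UW. \<iota> p = 1} \<longrightarrow>
          (\<forall>p\<in>UW. \<Gamma>' p = \<Gamma> p)) \<and>
        {p \<in> UW. energy A L p = e} = {p \<in> UW. \<iota> p = 1} \<and> (\<forall>p\<in>{p \<in> UW. \<iota> p = 1}. \<Gamma>\<^sub>L p = \<Gamma> p)"
    proof (intro exI[of _ \<Gamma>] conjI allI impI ballI pe \<Gamma>_tangent_to)
      show "Y p = \<Gamma> p" if "projectively_equivalent A UW X Y" "tangent_to TA Y {p \<in> UW. \<iota> p = 1}" "p \<in> UW" for Y p
        by (rule projectively_equivalent_unique[OF pe that])
      show "{p \<in> UW. energy A L p = e} = {p \<in> UW. \<iota> p = 1}" using energy_level_iff by blast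
      show "\<Gamma>\<^sub>L p = \<Gamma> p" if "p \<in> {p \<in> UW. \<iota> p = 1}" for p using that \<Gamma>_eq_\<Gamma>\<^sub>L by blast
    qed
  next
    fix q assume q: "q \<in> fst ` U"
    \<comment> \<open>The empty set is a placeholder that gives access to
      \<open>exists_positive\<close>, which produces its own neighbourhood and function.\<close>
    interpret pre: fixed_energy A L \<iota> \<Gamma>\<^sub>L e U "{}" "\<lambda>_. 0"
      by (rule FE) (auto simp: atlas_open_def smooth_fun_def smooth_on_def Ck_on_const)
    obtain W f where W: "atlas_open A W" "q \<in> W" "smooth_fun A W f"
      and pos: "\<And>p. p \<in> over U W \<Longrightarrow> add_total_derivative A f (fixed_energy_function L \<iota> e) p > 0"
      using pre.exists_positive[OF q] by blast
    interpret fixed_energy A L \<iota> \<Gamma>\<^sub>L e U W f by (rule FE[OF W(1,3)])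
    show "\<exists>W f. atlas_open A W \<and> q \<in> W \<and> smooth_fun A W f \<and>
        finsler_function A (over U W) (add_total_derivative A f (fixed_energy_function L \<iota> e)) \<and>
        (\<forall>I x. euler_lagrange_solution A L I x \<longrightarrow>
           (\<forall>t\<in>I. energy A L (tangent_lift A x t) = e \<and> tangent_lift A x t \<in> over U W) \<longrightarrow>
           (\<exists>J \<phi>. orientation_preserving_reparametrization J I \<phi> \<and>
              geodesic A (over U W) (add_total_derivative A f (fixed_energy_function L \<iota> e))
                J (x \<circ> \<phi>)))"
    proof (intro exI[of _ W] exI[of _ f] conjI allI impI W FF_finsler[OF pos])
      fix I x assume "euler_lagrange_solution A L I x"
        "\<forall>t\<in>I. energy A L (tangent_lift A x t) = e \<and> tangent_lift A x t \<in> UW"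
      then obtain J \<phi> where "orientation_preserving_reparametrization J I \<phi>" "geodesic A UW FF J (x \<circ> \<phi>)"
        using solution_geodesic[OF pos, of I x] by metis
      then show "\<exists>J \<phi>. orientation_preserving_reparametrization J I \<phi> \<and> geodesic A UW FF J (x \<circ> \<phi>)"
        by blast
    qed
  qed
qed

end
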